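(* Let $t$ be an odd integer coprime to $15$, and let $K_t$ denote the corresponding Hashimoto--Hoshi cyclic septic field. Then $K_t$ is non-monogenic and its index is $I(K_t)=1$.
   Context: For $t\in\mathbb{Z}$ the Hashimoto--Hoshi polynomial is $f_t(X)=X^7+a_6X^6+a_5X^5+a_4X^4+a_3X^3+a_2X^2+a_1X+a_0$, where $a_6=-(t^3+t^2+5t+6)$, $a_5=3(3t^3+3t^2+8t+4)$, $a_4=t^7+t^6+9t^5-5t^4-15t^3-22t^2-36t-8$, $a_3=-t(t^7+5t^6+12t^5+24t^4-6t^3+2t^2-20t-16)$, $a_2=t^2(2t^6+7t^5+19t^4+14t^3+2t^2+8t-8)$, $a_1=-t^4(t^4+4t^3+8t^2+4)$, $a_0=t^7$. Let $\theta_t$ be a root of $f_t$ in $\mathbb{C}$ and $K_t=\mathbb{Q}(\theta_t)$. A cyclic septic field is a Galois extension of $\mathbb{Q}$ of degree $7$ with cyclic Galois group. For a number field $K$ with ring of integers $\mathcal{O}_K$ and $\theta\in\mathcal{O}_K$ with $K=\mathbb{Q}(\theta)$, put $I(\theta)=[\mathcal{O}_K:\mathbb{Z}[\theta]]$. The index of $K$ is $I(K)=\gcd\{I(\theta):\theta\in\mathcal{O}_K,\ K=\mathbb{Q}(\theta)\}$. $K$ is monogenic if $\mathcal{O}_K=\mathbb{Z}[\theta]$ for some $\theta\in\mathcal{O}_K$, and non-monogenic otherwise. *)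

theory Defs
  imports
    "HOL-Computational_Algebra.Polynomial"
    "HOL-Algebra.AbelCoset"
    "HOL-Algebra.Generated_Rings"
    "HOL-Algebra.Generated_Fields"
    "HOL-Algebra.Algebraic_Closure_Type"
begin

definition hashimoto_hoshi_poly :: "int \<Rightarrow> int poly" where
  "hashimoto_hoshi_poly t =
    [: t^7,
       - (t^4 * (t^4 + 4*t^3 + 8*t^2 + 4)),
       t^2 * (2*t^6 + 7*t^5 + 19*t^4 + 14*t^3 + 2*t^2 + 8*t - 8),
       - (t * (t^7 + 5*t^6 + 12*t^5 + 24*t^4 - 6*t^3 + 2*t^2 - 20*t - 16)),
       t^7 + t^6 + 9*t^5 - 5*t^4 - 15*t^3 - 22*t^2 - 36*t - 8,
       3 * (3*t^3 + 3*t^2 + 8*t + 4),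
       - (t^3 + t^2 + 5*t + 6),
       1 :]"

text \<open>
  Number fields are represented as subfields of the complex numbers. The record
  \<open>complex_ring\<close> has carrier \<open>UNIV\<close> and the usual operations.
\<close>

abbreviation complex_ring :: "complex ring" where
  "complex_ring \<equiv> ring_of_type_algebra"

text \<open>The field $\mathbb{Q}(\theta)$: any subfield of the complex numbers contains the rationals.\<close>

definition rat_adjoin :: "complex \<Rightarrow> complex set" where
  "rat_adjoin \<theta> = generate_field complex_ring {\<theta>}"

text \<open>The ring $\mathbb{Z}[\theta]$: generated subrings contain \<open>1\<close>, hence the integers.\<close>

definition int_adjoin :: "complex \<Rightarrow> complex set" where
  "int_adjoin \<theta> = generate_ring complex_ring {\<theta>}"

definition ring_of_integers :: "complex set \<Rightarrow> complex set" where
  "ring_of_integers K = {x \<in> K. algebraic_int x}"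

text \<open>
  The index of the additive group $\mathbb{Z}[\theta]$ in $\mathcal{O}_K$, as the number of
  cosets. It is only used when \<open>K\<close> is a number field, \<open>\<theta> \<in> ring_of_integers K\<close> and
  \<open>rat_adjoin \<theta> = K\<close>; then there are finitely many cosets, so the convention that
  \<open>card\<close> of an infinite set is \<open>0\<close> plays no role.
\<close>

definition index_of_element :: "complex set \<Rightarrow> complex \<Rightarrow> nat" where
  "index_of_element K \<theta> =
     card (a_rcosets\<^bsub>complex_ring\<lparr>carrier := ring_of_integers K\<rparr>\<^esub> (int_adjoin \<theta>))"

definition field_index :: "complex set \<Rightarrow> nat" where
  "field_index K =
     Gcd {index_of_element K \<theta> | \<theta>. \<theta> \<in> ring_of_integers K \<and> K = rat_adjoin \<theta>}"

definition monogenic :: "complex set \<Rightarrow> bool" where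
  "monogenic K \<longleftrightarrow> (\<exists>\<theta> \<in> ring_of_integers K. ring_of_integers K = int_adjoin \<theta>)"

end

theory Submission
  imports
    Defs
    "HOL-Analysis.Analysis"
    "HOL-Algebra.Sylow"
    "HOL-Algebra.Multiplicative_Group"
    "HOL-Library.Z2"
    "HOL-Number_Theory.Cong"
begin

text \<open>
  For odd \<open>t\<close> the polynomial \<open>f\<^sub>t\<close> is irreducible already modulo \<open>2\<close>, and an explicit fraction
  \<open>\<tau>\<close> of two polynomials of degree at most three permutes its roots without fixed points. The orbits of \<open>\<tau>\<close> on the
  seven roots have equal length, so \<open>\<tau>\<close> is a cycle of length seven: \<open>K = \<rat>(\<theta>)\<close> is cyclic of degree
  seven, with a generator \<open>\<sigma>\<close> of its Galois group, and it is totally real because complex conjugation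
  cannot permute seven roots without fixing one. Everything else holds in any such field and is
  done in the locale \<open>cyclic_septic_field\<close>. Let \<open>O\<close> be its ring of integers.

  The index is \<open>1\<close> if for every prime \<open>p\<close> some order \<open>\<int>[y]\<close> has index prime to \<open>p\<close>, which means
  that \<open>1, y, \<dots>, y\<^sup>6\<close> are independent modulo \<open>p O\<close>. Let \<open>P\<close> be a maximal ideal over \<open>p\<close>. If its
  seven conjugates differ, then \<open>p\<close> splits completely; an idempotent of \<open>O / p O\<close> yields an element
  with seven different residues when \<open>p \<ge> 7\<close>, and when \<open>p < 7\<close> it yields a root of \<open>f\<^sub>t\<close> modulo
  \<open>p\<close>, which does not exist for \<open>t\<close> prime to \<open>30\<close>. If \<open>\<sigma> P = P\<close> and \<open>\<sigma>\<close> moves some residue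
  class, any element of that class will do. If \<open>\<sigma>\<close> acts trivially on \<open>O / P\<close>, then \<open>p\<close> is totally
  ramified and a uniformizer will do (\<open>exists_independent_mod\<close>, \<open>index_not_divisible\<close>).

  For non-monogenicity, suppose \<open>O = \<int>[\<beta>]\<close> and put \<open>\<alpha> = \<beta> - \<sigma> \<beta>\<close>. Every \<open>x - \<sigma> x\<close> is
  divisible by \<open>\<alpha>\<close>, so \<open>\<sigma>\<close> acts trivially modulo \<open>\<alpha>\<close>, the differences \<open>\<beta> - \<sigma>\<^sup>k \<beta>\<close> are associated
  to \<open>\<alpha>\<close>, and the norm of \<open>x\<close> is congruent to \<open>x\<^sup>7\<close>. With \<open>u = \<sigma> \<alpha> / \<alpha>\<close> one gets
  \<open>1 + u + \<dots> + u\<^sup>6 \<equiv> 0\<close> and, since \<open>1 + u\<close> and \<open>1 + u + u\<^sup>2\<close> are congruent to units of norm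
  \<open>\<plusminus>1\<close>, also \<open>(1 + u)\<^sup>7 \<equiv> \<plusminus>1\<close> and \<open>(1 + u + u\<^sup>2)\<^sup>7 \<equiv> \<plusminus>1\<close> modulo \<open>\<alpha>\<close>. These congruences
  imply \<open>2 \<equiv> 0\<close>; modulo \<open>2\<close> the element \<open>u\<close> is congruent to its trace, a rational integer, and
  then \<open>1 \<equiv> 0\<close> (\<open>differences_are_units\<close>). So all differences of conjugates are units and
  \<open>O\<close> is a lattice of covolume one in \<open>\<real>\<^sup>7\<close>. Such a lattice contains a nonzero vector of length less
  than \<open>2\<close>, but the coordinates of a nonzero integer have product at least one in absolute value,
  so its length is at least the square root of \<open>7\<close> (\<open>no_real_power_basis\<close>).
\<close>

no_notation Formal_Power_Series.fps_nth (infixl "$" 75)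

section \<open>Subrings and polynomials over them\<close>

text \<open>
  Subrings are treated as sets inside an ambient ring, so that the integers, the rationals, a
  number field and its ring of integers can all serve as coefficient domains of polynomials over
  one and the same type.
\<close>

definition csubring :: "'a::comm_ring_1 set \<Rightarrow> bool" where
  "csubring S \<longleftrightarrow> 1 \<in> S \<and> (\<forall>a\<in>S. \<forall>b\<in>S. a - b \<in> S \<and> a * b \<in> S)"

definition poly_over :: "'a::comm_ring_1 set \<Rightarrow> 'a poly \<Rightarrow> bool" where
  "poly_over S p \<longleftrightarrow> (\<forall>i. coeff p i \<in> S)"

context
  fixes S :: "'a::comm_ring_1 set"
  assumes S: "csubring S"
begin

lemma csubring_one: "1 \<in> S" using S by (auto simp: csubring_def)
lemma csubring_diff: "a \<in> S \<Longrightarrow> b \<in> S \<Longrightarrow> a - b \<in> S" using S by (auto simp: csubring_def)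
lemma csubring_mult: "a \<in> S \<Longrightarrow> b \<in> S \<Longrightarrow> a * b \<in> S" using S by (auto simp: csubring_def)
lemma csubring_zero: "0 \<in> S" using csubring_diff[OF csubring_one csubring_one] by simp
lemma csubring_uminus: "a \<in> S \<Longrightarrow> - a \<in> S" using csubring_diff[OF csubring_zero, of a] by simp
lemma csubring_add: "a \<in> S \<Longrightarrow> b \<in> S \<Longrightarrow> a + b \<in> S"
  using csubring_diff[of a "- b"] csubring_uminus[of b] by simp
lemma csubring_power: "a \<in> S \<Longrightarrow> a ^ n \<in> S"
  by (induction n) (auto intro: csubring_one csubring_mult)
lemma csubring_sum: "(\<And>i. i \<in> I \<Longrightarrow> g i \<in> S) \<Longrightarrow> sum g I \<in> S"
  by (induction I rule: infinite_finite_induct) (auto intro: csubring_zero csubring_add)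
lemma csubring_prod: "(\<And>i. i \<in> I \<Longrightarrow> g i \<in> S) \<Longrightarrow> prod g I \<in> S"
  by (induction I rule: infinite_finite_induct) (auto intro: csubring_one csubring_mult)
lemma csubring_of_nat: "of_nat n \<in> S"
  by (induction n) (auto intro: csubring_zero csubring_one csubring_add)
lemma csubring_of_int: "of_int n \<in> S"
  by (cases n rule: int_cases2) (auto intro: csubring_uminus csubring_of_nat)
lemma csubring_Ints: "a \<in> \<int> \<Longrightarrow> a \<in> S"
  by (auto elim!: Ints_cases intro: csubring_of_int)

lemmas csubring_intros = csubring_one csubring_zero csubring_diff csubring_mult csubring_add
  csubring_uminus csubring_power csubring_of_nat csubring_of_int

lemma poly_over_0: "poly_over S 0" by (simp add: poly_over_def csubring_zero)
lemma poly_over_pCons: "a \<in> S \<Longrightarrow> poly_over S p \<Longrightarrow> poly_over S (pCons a p)"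
  by (auto simp: poly_over_def coeff_pCons split: nat.split)
lemma poly_over_diff: "poly_over S p \<Longrightarrow> poly_over S q \<Longrightarrow> poly_over S (p - q)"
  by (auto simp: poly_over_def intro: csubring_diff)
lemma poly_over_add: "poly_over S p \<Longrightarrow> poly_over S q \<Longrightarrow> poly_over S (p + q)"
  by (auto simp: poly_over_def intro: csubring_add)
lemma poly_over_mult: "poly_over S p \<Longrightarrow> poly_over S q \<Longrightarrow> poly_over S (p * q)"
  by (auto simp: poly_over_def coeff_mult intro!: csubring_sum csubring_mult)
lemma poly_over_1: "poly_over S 1"
  using poly_over_pCons[OF csubring_one poly_over_0] by (simp add: one_pCons)
lemma poly_over_prod: "(\<And>i. i \<in> I \<Longrightarrow> poly_over S (g i)) \<Longrightarrow> poly_over S (prod g I)"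
  by (induction I rule: infinite_finite_induct) (auto intro: poly_over_1 poly_over_mult)
lemma poly_over_monom: "a \<in> S \<Longrightarrow> poly_over S (monom a n)"
  by (auto simp: poly_over_def coeff_monom csubring_zero)
lemma poly_over_smult: "a \<in> S \<Longrightarrow> poly_over S p \<Longrightarrow> poly_over S (smult a p)"
  by (auto simp: poly_over_def intro: csubring_mult)

lemmas poly_over_intros = poly_over_0 poly_over_1 poly_over_pCons poly_over_diff poly_over_add
  poly_over_mult poly_over_monom poly_over_smult

lemma poly_over_value: "poly_over S p \<Longrightarrow> x \<in> S \<Longrightarrow> poly p x \<in> S"
  by (auto simp: poly_altdef poly_over_def intro!: csubring_sum csubring_mult csubring_power)

text \<open>
  Long division by a monic polynomial never divides by a coefficient, so it stays over
  \<open>S\<close>.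
\<close>

lemma poly_over_divide_monic:
  assumes "poly_over S g" "lead_coeff g = 1" "poly_over S p"
  obtains q r where "p = q * g + r" "poly_over S q" "poly_over S r" "r = 0 \<or> degree r < degree g"
proof -
  have "\<exists>q r. p = q * g + r \<and> poly_over S q \<and> poly_over S r \<and> (r = 0 \<or> degree r < degree g)"
    using assms(3)
  proof (induction "degree p" arbitrary: p rule: less_induct)
    case less
    show ?case
    proof (cases "p = 0 \<or> degree p < degree g")
      case True
      then show ?thesis using less.prems poly_over_0 by (intro exI[of _ 0] exI[of _ p]) auto
    next
      case False
      define m where "m = monom (lead_coeff p) (degree p - degree g)"
      define p' where "p' = p - m * g"
      have m: "poly_over S m" using less.prems by (auto simp: m_def poly_over_def coeff_monom csubring_zero)
      have p': "poly_over S p'" using m less.prems assms(1) by (auto simp: p'_def intro!: poly_over_diff poly_over_mult)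
      have lp: "lead_coeff p \<noteq> 0" using False by auto
      have "coeff (m * g) (degree p) = lead_coeff p"
        using False assms(2) unfolding m_def by (simp add: coeff_monom_mult)
      then have c0: "coeff p' (degree p) = 0" by (simp add: p'_def)
      have "degree (m * g) \<le> degree p"
        using degree_mult_le[of m g] degree_monom_le[of "lead_coeff p" "degree p - degree g"] False
        unfolding m_def by linarith
      then have dle: "degree p' \<le> degree p" by (simp add: p'_def degree_diff_le)
      have "\<exists>q r. p' = q * g + r \<and> poly_over S q \<and> poly_over S r \<and> (r = 0 \<or> degree r < degree g)"
      proof (cases "p' = 0")
        case True
        then show ?thesis using poly_over_0 by (intro exI[of _ 0] exI[of _ 0]) auto
      next
        case False
        then have "degree p' \<noteq> degree p" using c0 by (metis leading_coeff_0_iff)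
        then show ?thesis using dle p' less.hyps[of p'] by simp
      qed
      then obtain q r where "p' = q * g + r" "poly_over S q" "poly_over S r" "r = 0 \<or> degree r < degree g"
        by blast
      then show ?thesis using m
        by (intro exI[of _ "q + m"] exI[of _ r]) (auto simp: p'_def algebra_simps intro!: poly_over_add)
    qed
  qed
  then show ?thesis using that by blast
qed

end

lemma csubring_Ints_set: "csubring (\<int> :: 'a::comm_ring_1 set)" by (auto simp: csubring_def)
lemma csubring_Rats_set: "csubring (\<rat> :: 'a::field_char_0 set)" by (auto simp: csubring_def)
lemma poly_over_mono: "poly_over S p \<Longrightarrow> S \<subseteq> T \<Longrightarrow> poly_over T p" by (auto simp: poly_over_def)

lemma algebraic_int_poly_over: "algebraic_int x \<longleftrightarrow> (\<exists>p. lead_coeff p = 1 \<and> poly_over \<int> p \<and> poly p x = 0)"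
  unfolding algebraic_int.simps poly_over_def by blast

lemma clear_denominators:
  assumes "poly_over \<rat> h" obtains D :: int where "D > 0" "poly_over \<int> (smult (of_int D) h)"
proof -
  have "\<exists>D>0. poly_over \<int> (smult (of_int D) h)"
    using assms
  proof (induction h)
    case 0
    show ?case by (auto simp: poly_over_def intro: exI[of _ 1])
  next
    case (pCons a h)
    have "coeff (pCons a h) 0 \<in> \<rat>" using pCons.prems unfolding poly_over_def by blast
    then obtain b c :: int where c: "c > 0" "a = of_int b / of_int c" by (auto elim!: Rats_cases')
    have "coeff (pCons a h) (Suc i) \<in> \<rat>" for i using pCons.prems unfolding poly_over_def by blast
    then have "poly_over \<rat> h" by (simp add: poly_over_def)
    then obtain D where D: "D > 0" "poly_over \<int> (smult (of_int D) h)" using pCons.IH by blast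
    have "poly_over \<int> (smult (of_int (c * D)) (pCons a h))"
      using D c by (auto simp: poly_over_def coeff_pCons mult.assoc split: nat.split)
    then show ?case using D(1) c(1) by (intro exI[of _ "c * D"]) auto
  qed
  then show ?thesis using that by blast
qed

lemma poly_over_pcompose:
  assumes S: "csubring S" and "poly_over S p" "poly_over S q" shows "poly_over S (pcompose p q)"
  using assms(2)
proof (induction p)
  case 0
  show ?case by (simp add: poly_over_0[OF S])
next
  case (pCons a p)
  have "coeff (pCons a p) 0 \<in> S" "\<And>i. coeff (pCons a p) (Suc i) \<in> S"
    using pCons.prems unfolding poly_over_def by blast+
  then have "a \<in> S" "poly_over S p" by (simp_all add: poly_over_def)
  then show ?case unfolding pcompose_pCons using pCons.IH assms(3)
    by (intro poly_over_add[OF S] poly_over_mult[OF S] poly_over_pCons[OF S] poly_over_0[OF S])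
qed

lemma Rats_subset_Reals: "\<rat> \<subseteq> (\<real> :: complex set)"
proof
  fix x :: complex assume "x \<in> \<rat>"
  then show "x \<in> \<real>" by (elim Rats_cases') simp
qed

section \<open>The rings generated by one complex number\<close>

lemma csubring_poly_values:
  fixes y :: "'a::comm_ring_1"
  shows "csubring {poly p y | p. poly_over \<int> p}"
proof -
  have "1 \<in> {poly p y | p. poly_over \<int> p}"
    using poly_over_1[OF csubring_Ints_set] by (auto intro!: exI[of _ 1])
  moreover have "\<exists>r. poly p y - poly q y = poly r y \<and> poly_over \<int> r"
    if "poly_over \<int> p" "poly_over \<int> q" for p q
    using that poly_over_diff[OF csubring_Ints_set] by (intro exI[of _ "p - q"]) auto
  moreover have "\<exists>r. poly p y * poly q y = poly r y \<and> poly_over \<int> r"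
    if "poly_over \<int> p" "poly_over \<int> q" for p q
    using that poly_over_mult[OF csubring_Ints_set] by (intro exI[of _ "p * q"]) auto
  ultimately show ?thesis unfolding csubring_def by blast
qed

lemma int_adjoin_eq: "int_adjoin y = {poly p y | p. poly_over \<int> p}" (is "_ = ?R")
proof
  interpret cring "complex_ring :: complex ring" by (rule cring_from_type_algebra)
  have R: "csubring ?R" by (rule csubring_poly_values)
  have neg: "\<ominus>\<^bsub>complex_ring\<^esub> x = - x" for x :: complex
    by (rule minus_equality) (auto simp: ring_of_type_algebra_def)
  have y: "y \<in> ?R"
    by (rule CollectI, rule exI[of _ "[:0, 1:]"]) (simp add: poly_over_def coeff_pCons split: nat.split)
  show "int_adjoin y \<subseteq> ?R"
  proof
    fix x assume "x \<in> int_adjoin y"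
    then have "x \<in> generate_ring complex_ring {y}" by (simp add: int_adjoin_def)
    then show "x \<in> ?R"
    proof induction
      case (a_inv h)
      show ?case unfolding neg by (rule csubring_uminus[OF R a_inv.IH])
    next
      case (eng_add h1 h2)
      then show ?case using csubring_add[OF R, of h1 h2] by (simp add: ring_of_type_algebra_def)
    next
      case (eng_mult h1 h2)
      then show ?case using csubring_mult[OF R, of h1 h2] by (simp add: ring_of_type_algebra_def)
    next
      case (incl h)
      then show ?case using y by simp
    next
      case one
      then show ?case using csubring_one[OF R] by (simp add: ring_of_type_algebra_def)
    qed
  qed
  have "csubring (int_adjoin y)"
    unfolding csubring_def int_adjoin_def
  proof (intro conjI ballI)
    show "1 \<in> generate_ring complex_ring {y}"
      using generate_ring.one[of "complex_ring :: complex ring" "{y}"] by (simp add: ring_of_type_algebra_def)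
  next
    fix a b assume ab: "a \<in> generate_ring complex_ring {y}" "b \<in> generate_ring complex_ring {y}"
    show "a - b \<in> generate_ring complex_ring {y}"
      using generate_ring.eng_add[OF ab(1) generate_ring.a_inv[OF ab(2)]]
      unfolding neg by (simp add: ring_of_type_algebra_def)
    show "a * b \<in> generate_ring complex_ring {y}"
      using generate_ring.eng_mult[OF ab] by (simp add: ring_of_type_algebra_def)
  qed
  note S = this
  have y': "y \<in> int_adjoin y" unfolding int_adjoin_def by (rule generate_ring.incl) simp
  show "?R \<subseteq> int_adjoin y"
    using poly_over_value[OF S _ y'] poly_over_mono csubring_Ints[OF S] by blast
qed

lemma int_adjoin_subring: "csubring (int_adjoin y)"
  unfolding int_adjoin_eq by (rule csubring_poly_values)

section \<open>Finite groups and the index of a subring\<close>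

text \<open>
  A Sylow argument gives a subgroup of order \<open>p\<close>; any of its elements other than
  the unit is killed by \<open>p\<close>.
\<close>

lemma (in group) cauchy_element:
  assumes fin: "finite (carrier G)" and p: "prime p" "p dvd Coset.order G"
  obtains x where "x \<in> carrier G" "x \<noteq> \<one>" "x [^] p = \<one>"
proof -
  obtain m where "Coset.order G = p ^ 1 * m" using p(2) by (auto elim: dvdE)
  then obtain H where H: "subgroup H G" "card H = p ^ 1"
    using sylow_thm[OF p(1) is_group _ fin] by blast
  have "\<not> H \<subseteq> {\<one>}"
    using H(2) prime_gt_1_nat[OF p(1)] card_mono[of "{\<one>}" H] by auto
  then obtain x where x: "x \<in> H" "x \<noteq> \<one>" by blast
  interpret H: group "G\<lparr>carrier := H\<rparr>" using subgroup.subgroup_is_group[OF H(1) is_group] .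
  have "x [^]\<^bsub>G\<lparr>carrier := H\<rparr>\<^esub> Coset.order (G\<lparr>carrier := H\<rparr>) = \<one>\<^bsub>G\<lparr>carrier := H\<rparr>\<^esub>"
    using x by (intro H.pow_order_eq_1) simp
  then have "x [^] p = \<one>" using H(2) by (simp add: Coset.order_def nat_pow_consistent[symmetric])
  then show ?thesis using that x subgroup.mem_carrier[OF H(1)] by blast
qed

text \<open>
  Cauchy's theorem in the additive group \<open>A / H\<close>: a class of order \<open>p\<close>
  is represented by some \<open>a\<close> outside \<open>H\<close> with \<open>p a\<close> in
  \<open>H\<close>.
\<close>

lemma prime_dvd_card_cosets:
  fixes A H :: "complex set"
  assumes A: "csubring A" and H: "csubring H" and HA: "H \<subseteq> A"
    and fin: "finite (a_rcosets\<^bsub>complex_ring\<lparr>carrier := A\<rparr>\<^esub> H)"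
    and p: "prime p" "p dvd card (a_rcosets\<^bsub>complex_ring\<lparr>carrier := A\<rparr>\<^esub> H)"
  obtains a where "a \<in> A" "a \<notin> H" "of_nat p * a \<in> H"
proof -
  define G where "G = add_monoid (complex_ring\<lparr>carrier := A\<rparr>)"
  have G_simps [simp]: "carrier G = A" "\<And>x y. x \<otimes>\<^bsub>G\<^esub> y = x + y" "\<one>\<^bsub>G\<^esub> = 0"
    by (simp_all add: G_def ring_of_type_algebra_def)
  note intros = csubring_zero csubring_add csubring_uminus
  interpret comm_group G
    by (rule comm_groupI) (auto intro: intros[OF A] bexI[OF _ csubring_uminus[OF A]])
  have inv: "inv\<^bsub>G\<^esub> x = - x" if "x \<in> A" for x
    using that by (intro inv_equality) (auto intro: intros[OF A])
  have "subgroup H G"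
    using HA by unfold_locales (auto intro: intros[OF H] simp: inv subset_iff)
  then interpret H: normal H G by (rule normal_iff_subgroup[THEN iffD2])
  interpret Q: group "G Mod H" by (rule H.factorgroup_is_group)
  have Q: "carrier (G Mod H) = a_rcosets\<^bsub>complex_ring\<lparr>carrier := A\<rparr>\<^esub> H"
    by (simp add: FactGroup_def A_RCOSETS_def G_def)
  obtain x where x: "x \<in> carrier (G Mod H)" "x \<noteq> \<one>\<^bsub>G Mod H\<^esub>" "x [^]\<^bsub>G Mod H\<^esub> p = \<one>\<^bsub>G Mod H\<^esub>"
    using Q.cauchy_element[OF _ p(1)] fin p(2) by (auto simp: Q Coset.order_def)
  obtain a where a: "a \<in> A" "x = H #>\<^bsub>G\<^esub> a" using x(1) by (auto simp: FactGroup_def RCOSETS_def)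
  have pow: "a [^]\<^bsub>G\<^esub> n = of_nat n * a" for n :: nat
    by (induction n) (auto simp: algebra_simps)
  have "(H #>\<^bsub>G\<^esub> a) [^]\<^bsub>G Mod H\<^esub> n = H #>\<^bsub>G\<^esub> (a [^]\<^bsub>G\<^esub> n)" for n :: nat
    using a(1) by (intro H.FactGroup_pow) auto
  then have "H #>\<^bsub>G\<^esub> (of_nat p * a) = H" using x(3) a(2) pow by (simp add: FactGroup_def)
  then have "of_nat p * a \<in> H"
    using rcos_self[of "of_nat p * a" H] \<open>subgroup H G\<close> csubring_mult[OF A csubring_of_nat[OF A] a(1)] by simp
  moreover have "a \<notin> H"
    using x(2) a coset_join2[OF _ \<open>subgroup H G\<close>, of a] by (auto simp: FactGroup_def)
  ultimately show ?thesis using that a(1) by blast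
qed

section \<open>Volume and short lattice vectors\<close>

text \<open>
  Cut \<open>S\<close> along the integer grid and translate all pieces into the unit cube. Two
  pieces must meet there, because the volume of \<open>S\<close> exceeds that of the cube.
\<close>

lemma blichfeldt:
  fixes S :: "(real ^ 'n) set"
  assumes meas: "S \<in> lmeasurable" and bdd: "bounded S" and big: "measure lebesgue S > 1"
  obtains x y where "x \<in> S" "y \<in> S" "x \<noteq> y" "\<And>i. (x - y) $ i \<in> \<int>"
proof (rule ccontr)
  assume no: "\<not> thesis"
  define cell :: "('n \<Rightarrow> int) \<Rightarrow> (real ^ 'n) set" where
    "cell v = {x. \<forall>i. of_int (v i) \<le> x $ i \<and> x $ i < of_int (v i) + 1}" for v
  define shift :: "('n \<Rightarrow> int) \<Rightarrow> real ^ 'n" where "shift v = (\<chi> i. of_int (v i))" for v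
  define fl :: "real ^ 'n \<Rightarrow> 'n \<Rightarrow> int" where "fl x = (\<lambda>i. \<lfloor>x $ i\<rfloor>)" for x
  define V where "V = fl ` S"
  have cell_iff: "x \<in> cell v \<longleftrightarrow> fl x = v" for x v
    unfolding cell_def fl_def fun_eq_iff by (auto simp: floor_eq_iff)
  obtain B where B: "\<And>x. x \<in> S \<Longrightarrow> norm x \<le> B" using bdd by (auto simp: bounded_iff)
  have "V \<subseteq> PiE UNIV (\<lambda>_. {\<lfloor>- B\<rfloor>..\<lfloor>B\<rfloor>})"
  proof
    fix v assume "v \<in> V"
    then obtain x where x: "x \<in> S" "v = fl x" by (auto simp: V_def)
    have "- B \<le> x $ i \<and> x $ i \<le> B" for i
      using component_le_norm_cart[of x i] B[OF x(1)] by linarith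
    then have "\<lfloor>- B\<rfloor> \<le> \<lfloor>x $ i\<rfloor> \<and> \<lfloor>x $ i\<rfloor> \<le> \<lfloor>B\<rfloor>" for i by (blast intro: floor_mono)
    then show "v \<in> PiE UNIV (\<lambda>_. {\<lfloor>- B\<rfloor>..\<lfloor>B\<rfloor>})" using x(2) by (auto simp: fl_def)
  qed
  then have finV: "finite V" by (rule finite_subset) (auto intro: finite_PiE)
  have cell_meas: "cell v \<in> sets borel" for v unfolding cell_def by measurable
  have part: "S \<inter> cell v \<in> lmeasurable" for v
    using meas cell_meas by (intro fmeasurable_Int_fmeasurable) auto
  have "S = (\<Union>v\<in>V. S \<inter> cell v)" by (auto simp: V_def cell_iff)
  then have "measure lebesgue S = measure lebesgue (\<Union>v\<in>V. S \<inter> cell v)" by simp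
  also have "\<dots> = (\<Sum>v\<in>V. measure lebesgue (S \<inter> cell v))"
    by (rule measure_UNION'[OF finV part]) (auto simp: pairwise_def disjnt_def cell_iff)
  also have "\<dots> = (\<Sum>v\<in>V. measure lebesgue ((\<lambda>x. x - shift v) ` (S \<inter> cell v)))"
    by (simp add: measure_translation_subtract)
  also have "\<dots> = measure lebesgue (\<Union>v\<in>V. (\<lambda>x. x - shift v) ` (S \<inter> cell v))"
  proof (rule measure_UNION'[symmetric, OF finV])
    show "(\<lambda>x. x - shift v) ` (S \<inter> cell v) \<in> lmeasurable" for v
      using part by (rule measurable_translation_subtract)
    show "pairwise (\<lambda>v w. disjnt ((\<lambda>x. x - shift v) ` (S \<inter> cell v)) ((\<lambda>x. x - shift w) ` (S \<inter> cell w))) V"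
    proof (rule pairwiseI, unfold disjnt_iff, intro allI notI, elim conjE imageE)
      fix v w t x y assume vw: "v \<noteq> w" and x: "t = x - shift v" "x \<in> S \<inter> cell v"
        and y: "t = y - shift w" "y \<in> S \<inter> cell w"
      have "x - y = shift v - shift w" using x(1) y(1) by (simp add: algebra_simps)
      then have "(x - y) $ i \<in> \<int>" for i by (simp add: shift_def)
      moreover have "x \<noteq> y" using vw x(2) y(2) by (auto simp: cell_iff)
      ultimately show False using no that[of x y] x(2) y(2) by blast
    qed
  qed
  also have "\<dots> \<le> measure lebesgue (cbox 0 (\<chi> i. 1) :: (real ^ 'n) set)"
  proof (rule measure_mono_fmeasurable)
    show "(\<Union>v\<in>V. (\<lambda>x. x - shift v) ` (S \<inter> cell v)) \<subseteq> cbox 0 (\<chi> i. 1)"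
      by (auto simp: mem_box_cart shift_def cell_def less_imp_le algebra_simps)
    show "(\<Union>v\<in>V. (\<lambda>x. x - shift v) ` (S \<inter> cell v)) \<in> sets lebesgue"
      using part by (intro sets.finite_UN finV fmeasurableD measurable_translation_subtract)
  qed auto
  also have "\<dots> = content (cbox 0 (\<chi> i. 1) :: (real ^ 'n) set)" by simp
  also have "\<dots> = 1"
    by (subst content_cbox_cart) (auto simp: interval_ne_empty_cart)
  finally show False using big by simp
qed

text \<open>
  The lattice \<open>A \<int>\<^sup>n\<close> has covolume \<open>1 / \<bar>det B\<bar> \<le>
  1\<close>. Two points of the unit ball therefore differ by a nonzero lattice vector, which has
  length less than \<open>2\<close>. Blichfeldt's argument is applied to the image of the ball
  under the inverse \<open>B\<close> of \<open>A\<close>, where the lattice becomes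
  \<open>\<int>\<^sup>n\<close>.
\<close>

lemma short_lattice_vector:
  fixes A B :: "real ^ 'n::{finite, wellorder} ^ 'n::{finite, wellorder}"
  assumes AB: "A ** B = mat 1" and det: "\<bar>det B\<bar> \<ge> 1" and vol: "unit_ball_vol (real CARD('n)) > 1"
  obtains z where "z \<noteq> 0" "\<And>i. z $ i \<in> \<int>" "norm (A *v z) < 2"
proof -
  define S where "S = (\<lambda>x. B *v x) ` ball 0 1"
  have lin: "linear (\<lambda>x. B *v x)" by simp
  have "S \<in> lmeasurable" unfolding S_def by (rule measurable_linear_image[OF lin lmeasurable_ball])
  moreover have "bounded S" unfolding S_def by (intro bounded_linear_image) (auto intro: linear_conv_bounded_linear[THEN iffD1, OF lin])
  moreover have "measure lebesgue S > 1"
  proof -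
    have "measure lebesgue S = \<bar>det B\<bar> * unit_ball_vol (real CARD('n))"
      unfolding S_def by (subst measure_linear_image[OF lin lmeasurable_ball]) (simp add: content_ball)
    also have "1 * 1 < \<dots>" using det vol by (intro mult_le_less_imp_less) auto
    finally show ?thesis by simp
  qed
  ultimately obtain x y where xy: "x \<in> S" "y \<in> S" "x \<noteq> y" "\<And>i. (x - y) $ i \<in> \<int>"
    using blichfeldt by blast
  obtain a b where a: "x = B *v a" "norm a < 1" and b: "y = B *v b" "norm b < 1" using xy by (auto simp: S_def)
  have "A *v (x - y) = a - b"
    unfolding a(1) b(1) by (simp add: matrix_vector_mult_diff_distrib[symmetric] matrix_vector_mul_assoc AB)
  moreover have "norm (a - b) < 2" using norm_triangle_ineq4[of a b] a(2) b(2) by linarith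
  ultimately show ?thesis using that[of "x - y"] xy by simp
qed

text \<open>
  The volume is \<open>16 \<pi>\<^sup>3 / 105\<close>, which is more than \<open>4\<close>.
\<close>

lemma unit_ball_vol_7: "unit_ball_vol 7 > 1"
proof -
  have "1 < 16 * 1 ^ 3 / (105::real) * 27" by simp
  also have "\<dots> \<le> 16 * pi ^ 3 / 105"
    using power_mono[of 3 pi 3] pi_gt3 by simp
  also have "\<dots> = unit_ball_vol 7" by (simp add: eval_unit_ball_vol)
  finally show ?thesis .
qed

text \<open>
  In \<open>\<int>[x]\<close> modulo the seventh cyclotomic polynomial both \<open>(1 +
  x)\<^sup>7 - s1\<close> and \<open>(1 + x + x\<^sup>2)\<^sup>7 - s2\<close> are twice another
  element, and the two halves generate the unit ideal. The Bezout coefficients were found by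
  lattice reduction, one triple for each choice of signs. The integer \<open>2\<close> cannot be
  replaced by \<open>1\<close>: over the field with eight elements all the expressions vanish at
  a primitive seventh root of unity.
\<close>

lemma cyclotomic_7_certificate:
  fixes u :: complex
  assumes "s1 = 1 \<or> s1 = -1" "s2 = 1 \<or> s2 = -1"
  obtains A B C :: "complex poly" where "poly_over \<int> A" "poly_over \<int> B" "poly_over \<int> C"
    "poly A u * ((1 + u) ^ 7 - s1) + poly B u * ((1 + u + u^2) ^ 7 - s2)
      + poly C u * (1 + u + u^2 + u^3 + u^4 + u^5 + u^6) = 2"
proof -
  note simps = algebra_simps eval_nat_numeral
  consider "s1 = 1" "s2 = 1" | "s1 = 1" "s2 = -1" | "s1 = -1" "s2 = 1" | "s1 = -1" "s2 = -1"
    using assms by blast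
  then show ?thesis
  proof cases
    case 1
    show ?thesis
      by (rule that[of "[:-2,0,0,3,3:]" "[:2,0,0,2,2:]"
            "[:2,-2,-14,-70,-203,-357,-434,-390,-268,-140,-54,-14,-2:]"])
        (unfold 1, (auto intro!: poly_over_intros[OF csubring_Ints_set])[3], simp add: simps)
  next
    case 2
    show ?thesis
      by (rule that[of "[:0,0,0,-1,-1:]" "[:4,0,0,2,2:]"
            "[:-6,-22,-84,-200,-343,-451,-476,-402,-270,-140,-54,-14,-2:]"])
        (unfold 2, (auto intro!: poly_over_intros[OF csubring_Ints_set])[3], simp add: simps)
  next
    case 3
    show ?thesis
      by (rule that[of "[:-1,0,-1,0,0,-1:]" "[:-1,0,-2,0,0,-2:]"
            "[:4,10,37,82,140,205,264,286,253,180,100,42,12,2:]"])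
        (unfold 3, (auto intro!: poly_over_intros[OF csubring_Ints_set])[3], simp add: simps)
  next
    case 4
    show ?thesis
      by (rule that[of "[:2,0,0,-1,-1:]" "[:-1,0,0,-1,-1:]"
            "[:0,-7,-7,25,98,178,217,195,134,70,27,7,1:]"])
        (unfold 4, (auto intro!: poly_over_intros[OF csubring_Ints_set])[3], simp add: simps)
  qed
qed

section \<open>Cyclic fields of degree seven\<close>

lemma exists_inverse_mod_7:
  assumes "0 < k" "k < (7::nat)" shows "\<exists>m. (k * m) mod 7 = 1"
proof -
  have "k \<in> {1,2,3,4,5,6}" using assms by auto
  moreover have "(1 * 1) mod 7 = (1::nat)" "(2 * 4) mod 7 = (1::nat)" "(3 * 5) mod 7 = (1::nat)"
     "(4 * 2) mod 7 = (1::nat)" "(5 * 3) mod 7 = (1::nat)" "(6 * 6) mod 7 = (1::nat)" by simp_all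
  ultimately show ?thesis by blast
qed

lemma power_7_mod_7: "7 dvd c ^ 7 - (c::int)"
proof -
  have "c mod 7 \<in> {0,1,2,3,4,5,6}" using pos_mod_bound[of 7 c] pos_mod_sign[of 7 c] by auto
  moreover have "(c ^ 7) mod 7 = ((c mod 7) ^ 7) mod 7" by (simp add: power_mod)
  ultimately have "(c ^ 7) mod 7 = c mod 7" by auto
  then show ?thesis by (simp add: mod_eq_dvd_iff)
qed

text \<open>
  Galois theory enters only through an automorphism \<open>\<sigma>\<close> of order seven whose
  fixed field is \<open>\<rat>\<close>; that the field has degree seven is a consequence
  (\<open>zero_poly_if_root\<close>, \<open>int_adjoin_denominator\<close>). The polynomial
  \<open>f\<close> serves to make \<open>\<int>[\<theta>]\<close> a ring in which every rational
  element is an integer.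
\<close>

locale cyclic_septic_field =
  fixes K :: "complex set" and \<sigma> :: "complex \<Rightarrow> complex" and \<theta> :: complex and f :: "complex poly"
  assumes K_subring: "csubring K"
    and K_inverse: "x \<in> K \<Longrightarrow> inverse x \<in> K"
    and \<sigma>_closed: "x \<in> K \<Longrightarrow> \<sigma> x \<in> K"
    and \<sigma>_one: "\<sigma> 1 = 1"
    and \<sigma>_diff: "x \<in> K \<Longrightarrow> y \<in> K \<Longrightarrow> \<sigma> (x - y) = \<sigma> x - \<sigma> y"
    and \<sigma>_mult: "x \<in> K \<Longrightarrow> y \<in> K \<Longrightarrow> \<sigma> (x * y) = \<sigma> x * \<sigma> y"
    and \<sigma>_order: "x \<in> K \<Longrightarrow> (\<sigma> ^^ 7) x = x"
    and \<sigma>_fixed: "x \<in> K \<Longrightarrow> \<sigma> x = x \<Longrightarrow> x \<in> \<rat>"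
    and \<theta>_in: "\<theta> \<in> K"
    and \<theta>_moved: "\<sigma> \<theta> \<noteq> \<theta>"
    and K_generated: "x \<in> K \<Longrightarrow> \<exists>h. poly_over \<rat> h \<and> x = poly h \<theta>"
    and f_over: "poly_over \<int> f"
    and f_monic: "lead_coeff f = 1"
    and f_degree: "degree f = 7"
    and f_root: "poly f \<theta> = 0"
begin

abbreviation s :: "nat \<Rightarrow> complex \<Rightarrow> complex" where "s k \<equiv> \<sigma> ^^ k"

lemmas K_intros = csubring_intros[OF K_subring] csubring_sum[OF K_subring] csubring_prod[OF K_subring]
lemmas [simp, intro] = \<theta>_in K_intros

lemma s_closed [simp, intro]: "x \<in> K \<Longrightarrow> s k x \<in> K"
  by (induction k) (auto intro: \<sigma>_closed)
lemma s_one [simp]: "s k 1 = 1" by (induction k) (auto simp: \<sigma>_one)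
lemma s_diff: "x \<in> K \<Longrightarrow> y \<in> K \<Longrightarrow> s k (x - y) = s k x - s k y"
  by (induction k) (auto simp: \<sigma>_diff)
lemma s_mult: "x \<in> K \<Longrightarrow> y \<in> K \<Longrightarrow> s k (x * y) = s k x * s k y"
  by (induction k) (auto simp: \<sigma>_mult)
lemma s_zero [simp]: "s k 0 = 0" using s_diff[of 1 1 k] by simp
lemma s_uminus: "x \<in> K \<Longrightarrow> s k (- x) = - s k x" using s_diff[of 0 x k] by simp
lemma s_add: "x \<in> K \<Longrightarrow> y \<in> K \<Longrightarrow> s k (x + y) = s k x + s k y"
  using s_diff[of x "- y" k] s_uminus[of y k] K_intros by simp
lemma s_power: "x \<in> K \<Longrightarrow> s k (x ^ n) = s k x ^ n"
  by (induction n) (auto simp: s_mult intro: K_intros)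
lemma s_sum: "(\<And>i. i \<in> I \<Longrightarrow> g i \<in> K) \<Longrightarrow> s k (sum g I) = (\<Sum>i\<in>I. s k (g i))"
  by (induction I rule: infinite_finite_induct) (auto simp: s_add intro!: K_intros)
lemma s_prod: "(\<And>i. i \<in> I \<Longrightarrow> g i \<in> K) \<Longrightarrow> s k (prod g I) = (\<Prod>i\<in>I. s k (g i))"
  by (induction I rule: infinite_finite_induct) (auto simp: s_mult intro!: K_intros)
lemma s_of_nat [simp]: "s k (of_nat n) = of_nat n"
  by (induction n) (auto simp: s_add)
lemma s_of_int [simp]: "s k (of_int n) = of_int n"
  by (cases n rule: int_cases2) (auto simp: s_uminus)
lemma s_comp: "s j (s k x) = s (j + k) x" by (simp add: funpow_add)
lemma s_inverse: "x \<in> K \<Longrightarrow> s k (inverse x) = inverse (s k x)"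
proof (cases "x = 0")
  case False
  assume x: "x \<in> K"
  have "s k x * s k (inverse x) = 1" using s_mult[of x "inverse x" k] K_inverse[OF x] x False by simp
  then show ?thesis by (simp add: inverse_unique)
qed auto
lemma K_divide: "x \<in> K \<Longrightarrow> y \<in> K \<Longrightarrow> x / y \<in> K"
  using K_inverse by (simp add: divide_inverse K_intros)
lemma s_divide: "x \<in> K \<Longrightarrow> y \<in> K \<Longrightarrow> s k (x / y) = s k x / s k y"
  using K_inverse[of y] by (simp add: divide_inverse s_mult s_inverse)

lemma Rats_K: "x \<in> \<rat> \<Longrightarrow> x \<in> K"
  by (auto elim!: Rats_cases' intro!: K_divide)
lemma s_Rats: "x \<in> \<rat> \<Longrightarrow> s k x = x"
  by (auto elim!: Rats_cases' simp: s_divide)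
lemma Rats_subset: "\<rat> \<subseteq> K" using Rats_K by blast

lemma s_mult_7: "x \<in> K \<Longrightarrow> s (7 * m) x = x"
proof (induction m)
  case (Suc m)
  then show ?case using s_comp[of 7 "7 * m" x] \<sigma>_order[of x] by (simp add: add.commute)
qed auto
lemma s_mod: "x \<in> K \<Longrightarrow> s (k mod 7) x = s k x"
proof -
  assume x: "x \<in> K"
  have "s k x = s (k mod 7) (s (7 * (k div 7)) x)" by (simp add: s_comp)
  then show ?thesis using s_mult_7[OF x] by simp
qed
lemma s_cong: "x \<in> K \<Longrightarrow> j mod 7 = k mod 7 \<Longrightarrow> s j x = s k x"
  by (metis s_mod)
lemma s_inj: "x \<in> K \<Longrightarrow> y \<in> K \<Longrightarrow> s k x = s k y \<Longrightarrow> x = y"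
proof -
  assume *: "x \<in> K" "y \<in> K" "s k x = s k y"
  then have "s (6 * k) (s k x) = s (6 * k) (s k y)" by simp
  then show ?thesis using s_mult_7[OF *(1), of k] s_mult_7[OF *(2), of k] by (simp add: s_comp)
qed
lemma s_eq_0: "x \<in> K \<Longrightarrow> s k x = 0 \<longleftrightarrow> x = 0"
  using s_inj[of x 0 k] by auto

lemma s_iterate_fixed: "s k x = x \<Longrightarrow> s (k * m) x = x"
  by (induction m) (auto simp: funpow_add)

text \<open>
  Seven is prime, so every nontrivial power of \<open>\<sigma>\<close> generates the same group
  as \<open>\<sigma>\<close>.
\<close>

lemma fixed_if_s_fixed:
  assumes "x \<in> K" "0 < k" "k < 7" "s k x = x" shows "\<sigma> x = x"
proof -
  obtain m where "(k * m) mod 7 = 1" using exists_inverse_mod_7 assms by blast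
  then have "s (k * m) x = s 1 x" by (intro s_cong assms) auto
  then show ?thesis using s_iterate_fixed[OF assms(4), of m] by simp
qed

lemma conjugates_distinct:
  assumes "y \<in> K" "\<sigma> y \<noteq> y" shows "inj_on (\<lambda>i. s i y) {..<7}"
proof -
  have "s i y \<noteq> s j y" if "i < j" "j < 7" for i j
  proof
    assume "s i y = s j y"
    then have "s i y = s i (s (j - i) y)" using that by (simp add: s_comp)
    then have "s (j - i) y = y" using s_inj[of y "s (j - i) y" i] assms by simp
    then show False using fixed_if_s_fixed[of y "j - i"] assms that less_imp_diff_less[of j 7 i] by simp
  qed
  then show ?thesis by (intro linorder_inj_onI) auto
qed

lemma s_poly:
  assumes "poly_over K p" "x \<in> K"
  shows "s k (poly p x) = poly (map_poly (s k) p) (s k x)"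
proof -
  have *: "coeff p i \<in> K" for i using assms by (auto simp: poly_over_def)
  have "s k (poly p x) = (\<Sum>i\<le>degree p. s k (coeff p i) * s k x ^ i)"
    unfolding poly_altdef using * assms
    by (subst s_sum) (auto intro!: K_intros sum.cong simp: s_mult s_power csubring_power[OF K_subring])
  also have "\<dots> = (\<Sum>i\<le>degree p. coeff (map_poly (s k) p) i * s k x ^ i)"
    by (simp add: coeff_map_poly)
  also have "\<dots> = poly (map_poly (s k) p) (s k x)"
    unfolding poly_altdef
    by (intro sum.mono_neutral_right) (auto simp: coeff_eq_0 map_poly_degree_leq)
  finally show ?thesis .
qed

lemma s_poly_Rats:
  assumes "poly_over \<rat> p" "x \<in> K" shows "s k (poly p x) = poly p (s k x)"
proof -
  have "map_poly (s k) p = p"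
    using assms by (intro poly_eqI) (auto simp: coeff_map_poly s_Rats poly_over_def)
  then show ?thesis using s_poly[OF poly_over_mono[OF assms(1) Rats_subset] assms(2)] by simp
qed
lemmas s_poly_Ints = s_poly_Rats[OF poly_over_mono[OF _ Ints_subset_Rats]]

text \<open>
  A polynomial with rational coefficients that vanishes at \<open>y\<close> vanishes at its
  seven conjugates. Thus \<open>1, y, \<dots>, y\<^sup>6\<close> are linearly independent over
  \<open>\<rat>\<close>.
\<close>

lemma zero_poly_if_root:
  assumes "y \<in> K" "\<sigma> y \<noteq> y" "poly_over \<rat> h" "degree h < 7" "poly h y = 0"
  shows "h = 0"
proof (rule ccontr)
  assume h: "h \<noteq> 0"
  have "(\<lambda>i. s i y) ` {..<7} \<subseteq> {x. poly h x = 0}"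
    using s_poly_Rats[OF assms(3,1)] assms(5) by (auto simp flip: s_poly_Rats)
  then have "card ((\<lambda>i. s i y) ` {..<7}) \<le> card {x. poly h x = 0}"
    by (intro card_mono poly_roots_finite h)
  then show False using card_image[OF conjugates_distinct[OF assms(1,2)]] card_poly_roots_bound[OF h] assms(4)
    by simp
qed

definition tr :: "complex \<Rightarrow> complex" where "tr x = (\<Sum>i<7. s i x)"
definition Nm :: "complex \<Rightarrow> complex" where "Nm x = (\<Prod>i<7. s i x)"

lemma s_tr: "x \<in> K \<Longrightarrow> \<sigma> (tr x) = tr x"
proof -
  assume x: "x \<in> K"
  have "s 1 (tr x) = (\<Sum>i<7. s (Suc i) x)" unfolding tr_def using x by (subst s_sum) auto
  also have "\<dots> = (\<Sum>i<Suc 6. s i x) + s 7 x - s 0 x"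
    using sum.lessThan_Suc_shift[of "\<lambda>i. s i x" 7] by (simp add: eval_nat_numeral)
  also have "\<dots> = tr x" using \<sigma>_order[OF x] by (simp add: tr_def eval_nat_numeral)
  finally show ?thesis by simp
qed

lemma s_Nm: "x \<in> K \<Longrightarrow> \<sigma> (Nm x) = Nm x"
proof -
  assume x: "x \<in> K"
  have "s 1 (Nm x) = (\<Prod>i<7. s (Suc i) x)" unfolding Nm_def using x by (subst s_prod) auto
  also have "\<dots> = s 7 x * (\<Prod>i<6. s (Suc i) x)"
    by (simp add: eval_nat_numeral mult_ac)
  also have "\<dots> = (\<Prod>i<Suc 6. s i x)"
    using \<sigma>_order[OF x] by (subst prod.lessThan_Suc_shift) simp
  finally show ?thesis by (simp add: Nm_def)
qed

lemma tr_K [simp, intro]: "x \<in> K \<Longrightarrow> tr x \<in> K" and Nm_K [simp, intro]: "x \<in> K \<Longrightarrow> Nm x \<in> K"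
  by (auto simp: tr_def Nm_def intro!: K_intros)
lemma tr_Rats: "x \<in> K \<Longrightarrow> tr x \<in> \<rat>" and Nm_Rats: "x \<in> K \<Longrightarrow> Nm x \<in> \<rat>"
  using \<sigma>_fixed s_tr s_Nm by auto
lemma Nm_mult: "x \<in> K \<Longrightarrow> y \<in> K \<Longrightarrow> Nm (x * y) = Nm x * Nm y"
  by (simp add: Nm_def s_mult prod.distrib)
lemma Nm_eq_0: "x \<in> K \<Longrightarrow> Nm x = 0 \<longleftrightarrow> x = 0"
  unfolding Nm_def by (simp add: s_eq_0) (auto intro: exI[of _ 0])
lemma Nm_Ints: "n \<in> \<int> \<Longrightarrow> Nm n = n ^ 7"
  by (auto elim!: Ints_cases simp: Nm_def)
lemma Nm_split: "Nm x = x * (\<Prod>i=1..<7. s i x)"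
proof -
  have "Nm x = (\<Prod>i\<in>insert 0 {1..<7}. s i x)" unfolding Nm_def by (rule prod.cong) auto
  then show ?thesis by simp
qed

definition charpoly :: "complex \<Rightarrow> complex poly" where
  "charpoly y = (\<Prod>i<7. [:- s i y, 1:])"

lemma map_poly_s_mult:
  assumes "poly_over K p" "poly_over K q"
  shows "map_poly (s k) (p * q) = map_poly (s k) p * map_poly (s k) q"
  using assms by (intro poly_eqI)
    (auto simp: coeff_map_poly coeff_mult poly_over_def s_mult K_intros intro!: s_sum[THEN trans] sum.cong)

lemma map_poly_s_linear: "map_poly (s k) [:a, 1:] = [:s k a, 1:]"
  by (intro poly_eqI) (auto simp: coeff_map_poly coeff_pCons split: nat.split)

lemma map_poly_s_1: "map_poly (s k) 1 = 1"
  by (intro poly_eqI) (auto simp: coeff_map_poly)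

lemma map_poly_s_prod:
  "(\<And>i. i \<in> I \<Longrightarrow> poly_over K (g i)) \<Longrightarrow> map_poly (s k) (prod g I) = (\<Prod>i\<in>I. map_poly (s k) (g i))"
  by (induction I rule: infinite_finite_induct)
    (auto simp: map_poly_s_mult poly_over_prod[OF K_subring] map_poly_s_1)

lemma charpoly_over_K: "y \<in> K \<Longrightarrow> poly_over K (charpoly y)"
  unfolding charpoly_def
  by (intro poly_over_prod[OF K_subring] poly_over_intros[OF K_subring] K_intros) auto

lemma charpoly_over_Rats:
  assumes "y \<in> K" shows "poly_over \<rat> (charpoly y)"
proof -
  have "map_poly (s 1) (charpoly y) = (\<Prod>i<7. map_poly (s 1) [:- s i y, 1:])"
    unfolding charpoly_def using assms
    by (intro map_poly_s_prod poly_over_intros[OF K_subring]) auto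
  also have "\<dots> = (\<Prod>i<7. [:- s (Suc i) y, 1:])"
    using assms by (simp only: map_poly_s_linear s_uminus s_closed s_comp plus_1_eq_Suc)
  also have "\<dots> = [:- s 7 y, 1:] * (\<Prod>i<6. [:- s (Suc i) y, 1:])"
    by (simp add: eval_nat_numeral mult_ac del: mult_pCons_left mult_pCons_right)
  also have "\<dots> = (\<Prod>i<Suc 6. [:- s i y, 1:])"
    using \<sigma>_order[OF assms] by (subst prod.lessThan_Suc_shift) simp
  finally have *: "map_poly (s 1) (charpoly y) = charpoly y" by (simp add: charpoly_def)
  have "\<sigma> (coeff (charpoly y) i) = coeff (charpoly y) i" for i
    using arg_cong[OF *, of "\<lambda>p. coeff p i"] \<sigma>_one s_zero[of 1] by (simp add: coeff_map_poly)
  then show ?thesis using \<sigma>_fixed charpoly_over_K[OF assms] by (auto simp: poly_over_def)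
qed

lemma charpoly_root: "poly (charpoly y) y = 0"
  by (auto simp: charpoly_def poly_prod intro!: bexI[of _ 0])

lemma charpoly_degree: "degree (charpoly y) = 7"
  by (simp add: charpoly_def degree_prod_sum_eq)

lemma charpoly_monic: "lead_coeff (charpoly y) = 1"
  unfolding charpoly_def lead_coeff_prod by simp

section \<open>Integers as elements whose powers have bounded denominators\<close>

abbreviation Z\<theta> :: "complex set" where "Z\<theta> \<equiv> int_adjoin \<theta>"

lemma Z\<theta>_subring: "csubring Z\<theta>" by (rule int_adjoin_subring)

lemma poly_over_Ints_Z\<theta>: "poly_over \<int> p \<Longrightarrow> coeff p i \<in> Z\<theta>"
  using csubring_Ints[OF Z\<theta>_subring] by (auto simp: poly_over_def)

text \<open>
  Division by \<open>f\<close> leaves a remainder of degree less than seven, and such a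
  remainder can have a rational value at \<open>\<theta>\<close> only if it is constant.
\<close>

lemma Z\<theta>_Rats: assumes "x \<in> Z\<theta>" "x \<in> \<rat>" shows "x \<in> \<int>"
proof -
  obtain p where p: "x = poly p \<theta>" "poly_over \<int> p" using assms by (auto simp: int_adjoin_eq)
  obtain q r where r: "p = q * f + r" "poly_over \<int> r" "r = 0 \<or> degree r < degree f"
    using poly_over_divide_monic[OF csubring_Ints_set f_over f_monic p(2)] by blast
  define h where "h = r - [:x:]"
  have "poly_over \<rat> h" unfolding h_def
    using assms(2) by (intro poly_over_diff poly_over_pCons poly_over_0 csubring_Rats_set
        poly_over_mono[OF r(2) Ints_subset_Rats])
  moreover have "degree h < 7" using r(3) f_degree unfolding h_def
    by (auto intro!: degree_diff_less)
  moreover have "poly h \<theta> = 0" using p r f_root by (simp add: h_def)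
  ultimately have "h = 0" using zero_poly_if_root[OF \<theta>_in \<theta>_moved] by blast
  then have "coeff r 0 = x" by (simp add: h_def)
  then show ?thesis using r(2) by (auto simp: poly_over_def)
qed

lemma K_denominator:
  assumes "x \<in> K" obtains D :: int where "D > 0" "of_int D * x \<in> Z\<theta>"
proof -
  obtain h where h: "poly_over \<rat> h" "x = poly h \<theta>" using K_generated[OF assms] by blast
  obtain D :: int where "D > 0" "poly_over \<int> (smult (of_int D) h)" using clear_denominators[OF h(1)] .
  then show ?thesis using that[of D] h(2) unfolding int_adjoin_eq by (metis (mono_tags, lifting) mem_Collect_eq poly_smult)
qed

text \<open>
  Unlike integrality, this condition is visibly stable under sums and products. It is equivalent
  to integrality for elements of the field (\<open>OK_iff\<close>), and so shows that the
  integers form a ring.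
\<close>

definition almost_integral :: "complex \<Rightarrow> bool" where
  "almost_integral x \<longleftrightarrow> (\<exists>M::int. M > 0 \<and> (\<forall>k. of_int M * x ^ k \<in> Z\<theta>))"

text \<open>
  If \<open>M (a / b)\<^sup>k\<close> is an integer for all \<open>k\<close>, then all powers of
  \<open>b\<close> divide \<open>M\<close>.
\<close>

lemma almost_integral_Rats:
  assumes "almost_integral x" "x \<in> \<rat>" shows "x \<in> \<int>"
proof -
  obtain a b :: int where ab: "b > 0" "coprime a b" "x = of_int a / of_int b"
    using assms(2) by (elim Rats_cases')
  obtain M :: int where M: "M > 0" "\<And>k. of_int M * x ^ k \<in> Z\<theta>" using assms(1) by (auto simp: almost_integral_def)
  have "b ^ k dvd M" for k
  proof -
    have "of_int M * x ^ k \<in> \<int>" using M(2)[of k] assms(2) by (intro Z\<theta>_Rats) auto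
    then obtain n where n: "of_int M * x ^ k = of_int n" by (elim Ints_cases)
    then have "(of_int (M * a ^ k) :: complex) = of_int (n * b ^ k)" using ab
      by (simp add: field_simps)
    then have "M * a ^ k = n * b ^ k" by (simp only: of_int_eq_iff)
    then have "b ^ k dvd M * a ^ k" by simp
    then show ?thesis using ab(2) by (simp add: coprime_dvd_mult_left_iff coprime_commute)
  qed
  then have "b ^ nat M \<le> M" using zdvd_imp_le M(1) by blast
  moreover have "M < 2 ^ nat M" using M(1) by (metis int_nat_eq less_le_not_le of_nat_less_two_power)
  moreover have "2 ^ nat M \<le> b ^ nat M" if "b \<noteq> 1" using that ab(1) by (intro power_mono) auto
  ultimately have "b = 1" by linarith
  then show ?thesis using ab by simp
qed

lemma almost_integral_add_mult:
  assumes "almost_integral x" "almost_integral y"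
  shows "almost_integral (x + y)" "almost_integral (x * y)"
proof -
  obtain M :: int where M: "M > 0" "\<And>k. of_int M * x ^ k \<in> Z\<theta>" using assms by (auto simp: almost_integral_def)
  obtain L :: int where L: "L > 0" "\<And>k. of_int L * y ^ k \<in> Z\<theta>" using assms by (auto simp: almost_integral_def)
  have *: "of_int (M * L) * (x ^ i * y ^ j) \<in> Z\<theta>" for i j
    using csubring_mult[OF Z\<theta>_subring M(2)[of i] L(2)[of j]] by (simp add: mult_ac)
  have "of_int (M * L) * (x + y) ^ k \<in> Z\<theta>" for k
  proof -
    have "of_int (M * L) * (x + y) ^ k = (\<Sum>i\<le>k. of_nat (k choose i) * (of_int (M * L) * (x ^ i * y ^ (k - i))))"
      unfolding binomial_ring sum_distrib_left
      by (rule sum.cong[OF refl]) (simp only: mult.assoc mult.left_commute)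
    also have "\<dots> \<in> Z\<theta>" 
      by (rule csubring_sum[OF Z\<theta>_subring]) (rule csubring_mult[OF Z\<theta>_subring csubring_of_nat[OF Z\<theta>_subring] *])
    finally show ?thesis .
  qed
  moreover have "of_int (M * L) * (x * y) ^ k \<in> Z\<theta>" for k using *[of k k] by (simp add: power_mult_distrib)
  ultimately show "almost_integral (x + y)" "almost_integral (x * y)"
    using M(1) L(1) unfolding almost_integral_def by (intro exI[of _ "M * L"]; simp)+
qed

lemma almost_integral_Ints: "n \<in> \<int> \<Longrightarrow> almost_integral n"
  unfolding almost_integral_def by (intro exI[of _ 1]) (auto intro!: csubring_Ints[OF Z\<theta>_subring])

lemma almost_integral_subring: "csubring {x \<in> K. almost_integral x}"
proof -
  have "almost_integral (x - y)" if "almost_integral x" "almost_integral y" for x y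
    using almost_integral_add_mult(1)[OF that(1) almost_integral_add_mult(2)[of "-1" y]] that(2)
      almost_integral_Ints[of "-1"] by simp
  then show ?thesis
    using almost_integral_add_mult(2) almost_integral_Ints[of 1] unfolding csubring_def by auto
qed

text \<open>
  Modulo a monic integral equation of \<open>x\<close> every power of \<open>x\<close> is an
  integral combination of finitely many of them, and these have a common denominator.
\<close>

lemma algebraic_int_imp_almost_integral:
  assumes x: "x \<in> K" and "algebraic_int x" shows "almost_integral x"
proof -
  obtain g where g: "lead_coeff g = 1" "poly_over \<int> g" "poly g x = 0"
    using assms(2) by (auto simp: algebraic_int_poly_over)
  obtain D :: int where D: "D > 0" "of_int D * x \<in> Z\<theta>" using K_denominator[OF x] .
  define M where "M = D ^ degree g"
  have "of_int M * poly r x \<in> Z\<theta>" if r: "poly_over \<int> r" "r = 0 \<or> degree r < degree g" for r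
  proof -
    have "of_int M * (coeff r i * x ^ i) \<in> Z\<theta>" if "i \<le> degree r" for i
    proof (cases "r = 0")
      case False
      then have "i \<le> degree g" using r that by simp
      then have "M = D ^ (degree g - i) * D ^ i" unfolding M_def by (simp flip: power_add)
      then have "of_int M * (coeff r i * x ^ i) = of_int (D ^ (degree g - i)) * coeff r i * (of_int D * x) ^ i"
        by (simp add: power_mult_distrib)
      also have "\<dots> \<in> Z\<theta>"
        by (intro csubring_mult[OF Z\<theta>_subring] csubring_power[OF Z\<theta>_subring]
            csubring_of_int[OF Z\<theta>_subring] poly_over_Ints_Z\<theta> r(1) D(2))
      finally show ?thesis .
    qed (simp add: csubring_zero[OF Z\<theta>_subring])
    then show ?thesis by (auto simp: poly_altdef sum_distrib_left intro!: csubring_sum[OF Z\<theta>_subring])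
  qed
  moreover have "\<exists>r. poly_over \<int> r \<and> (r = 0 \<or> degree r < degree g) \<and> x ^ k = poly r x" for k
  proof -
    have "poly_over \<int> (monom 1 k :: complex poly)" by (simp add: poly_over_monom[OF csubring_Ints_set])
    from poly_over_divide_monic[OF csubring_Ints_set g(2,1) this]
    obtain q r where r: "monom 1 k = q * g + r" "poly_over \<int> r" "r = 0 \<or> degree r < degree g" by blast
    have "x ^ k = poly (monom 1 k) x" by (simp add: poly_monom)
    also have "\<dots> = poly r x" using r(1) g(3) by simp
    finally show ?thesis using r by blast
  qed
  ultimately have "of_int M * x ^ k \<in> Z\<theta>" for k by metis
  then show ?thesis using D(1) unfolding almost_integral_def M_def by (intro exI[of _ "D ^ degree g"]) simp
qed

lemma algebraic_int_s: "x \<in> K \<Longrightarrow> algebraic_int x \<Longrightarrow> algebraic_int (s k x)"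
  unfolding algebraic_int_poly_over 
  by (metis s_poly_Ints s_zero)

lemma \<theta>_algebraic_int: "algebraic_int \<theta>"
  using f_over f_monic f_root by (auto simp: algebraic_int_poly_over)

lemma almost_integral_s:
  assumes x: "x \<in> K" and "almost_integral x" shows "almost_integral (s k x)"
proof -
  obtain M :: int where M: "M > 0" "\<And>k. of_int M * x ^ k \<in> Z\<theta>" using assms by (auto simp: almost_integral_def)
  have "almost_integral (s k \<theta>)"
    using algebraic_int_imp_almost_integral algebraic_int_s \<theta>_algebraic_int by auto
  then obtain L :: int where L: "L > 0" "\<And>j. of_int L * s k \<theta> ^ j \<in> Z\<theta>" by (auto simp: almost_integral_def)
  have "of_int (M * L) * s k x ^ n \<in> Z\<theta>" for n
  proof -
    obtain p where p: "of_int M * x ^ n = poly p \<theta>" "poly_over \<int> p" using M(2)[of n] by (auto simp: int_adjoin_eq)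
    have "of_int M * s k x ^ n = s k (of_int M * x ^ n)" using x by (simp add: s_mult s_power)
    also have "\<dots> = poly p (s k \<theta>)" using p by (simp add: s_poly_Ints)
    finally have "of_int (M * L) * s k x ^ n = of_int L * poly p (s k \<theta>)" by simp
    also have "\<dots> = (\<Sum>i\<le>degree p. coeff p i * (of_int L * s k \<theta> ^ i))"
      by (simp add: poly_altdef sum_distrib_left mult_ac)
    also have "\<dots> \<in> Z\<theta>"
      by (intro csubring_sum[OF Z\<theta>_subring] csubring_mult[OF Z\<theta>_subring] poly_over_Ints_Z\<theta> p(2) L(2))
    finally show ?thesis .
  qed
  then show ?thesis using M(1) L(1) unfolding almost_integral_def by (intro exI[of _ "M * L"]) simp
qed

text \<open>
  The coefficients are sums of products of conjugates of \<open>x\<close>, hence almost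
  integral, and they are rational.
\<close>

lemma almost_integral_imp_charpoly_Ints:
  assumes x: "x \<in> K" and "almost_integral x" shows "poly_over \<int> (charpoly x)"
proof -
  have "poly_over {x \<in> K. almost_integral x} (charpoly x)"
    unfolding charpoly_def using assms almost_integral_s
    by (intro poly_over_prod poly_over_intros almost_integral_subring csubring_uminus[OF almost_integral_subring]
          csubring_one[OF almost_integral_subring]) auto
  then show ?thesis using charpoly_over_Rats[OF x] almost_integral_Rats by (auto simp: poly_over_def)
qed

abbreviation OK :: "complex set" where "OK \<equiv> ring_of_integers K"

lemma OK_iff: "x \<in> OK \<longleftrightarrow> x \<in> K \<and> almost_integral x"
proof -
  have "algebraic_int x" if "x \<in> K" "almost_integral x"
    unfolding algebraic_int_poly_over
    using almost_integral_imp_charpoly_Ints[OF that] charpoly_monic charpoly_root by blast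
  then show ?thesis
    unfolding ring_of_integers_def using algebraic_int_imp_almost_integral by blast
qed

lemma OK_subring: "csubring OK"
proof -
  have "OK = {x \<in> K. almost_integral x}" using OK_iff by blast
  then show ?thesis using almost_integral_subring by simp
qed

section \<open>Orders generated by one element\<close>

lemmas OK_intros [simp] = csubring_intros[OF OK_subring] csubring_sum[OF OK_subring] csubring_prod[OF OK_subring]

lemma OK_s [simp]: "x \<in> OK \<Longrightarrow> s k x \<in> OK" unfolding OK_iff using almost_integral_s by simp
lemma OK_Rats: "x \<in> OK \<Longrightarrow> x \<in> \<rat> \<Longrightarrow> x \<in> \<int>" using almost_integral_Rats by (simp add: OK_iff)
lemma OK_K [simp]: "x \<in> OK \<Longrightarrow> x \<in> K" by (simp add: OK_iff)
lemma Ints_OK: "x \<in> \<int> \<Longrightarrow> x \<in> OK" by (rule csubring_Ints[OF OK_subring])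
lemma OK_tr [simp]: "x \<in> OK \<Longrightarrow> tr x \<in> OK" and OK_Nm [simp]: "x \<in> OK \<Longrightarrow> Nm x \<in> OK"
  by (auto simp: tr_def Nm_def)
lemma tr_Ints: "x \<in> OK \<Longrightarrow> tr x \<in> \<int>" and Nm_in_Ints: "x \<in> OK \<Longrightarrow> Nm x \<in> \<int>"
  using OK_Rats[OF OK_tr tr_Rats] OK_Rats[OF OK_Nm Nm_Rats] by simp_all
lemma \<theta>_OK [simp]: "\<theta> \<in> OK"
  using \<theta>_algebraic_int unfolding ring_of_integers_def by simp
lemma charpoly_over_Ints: "y \<in> OK \<Longrightarrow> poly_over \<int> (charpoly y)"
  using almost_integral_imp_charpoly_Ints by (blast dest: OK_iff[THEN iffD1])
lemma poly_over_OK: "poly_over \<int> p \<Longrightarrow> poly_over OK p"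
  using Ints_OK by (auto simp: poly_over_def)
lemma int_adjoin_OK: "y \<in> OK \<Longrightarrow> int_adjoin y \<subseteq> OK"
  unfolding int_adjoin_eq using poly_over_value[OF OK_subring poly_over_OK] by blast

lemma int_adjoin_reduce:
  assumes "y \<in> OK" "z \<in> int_adjoin y"
  obtains p where "poly_over \<int> p" "degree p < 7" "z = poly p y"
proof -
  obtain p where p: "z = poly p y" "poly_over \<int> p" using assms by (auto simp: int_adjoin_eq)
  obtain q r where r: "p = q * charpoly y + r" "poly_over \<int> r" "r = 0 \<or> degree r < degree (charpoly y)"
    using poly_over_divide_monic[OF csubring_Ints_set charpoly_over_Ints[OF assms(1)] charpoly_monic p(2)] by blast
  have "degree r < 7" using r(3) by (auto simp: charpoly_degree)
  then show ?thesis using that[of r] r p charpoly_root[of y] by simp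
qed

text \<open>
  Lagrange interpolation expresses \<open>x\<close> as the value at \<open>y\<close> of the
  polynomial that maps each conjugate of \<open>y\<close> to the corresponding conjugate of
  \<open>x\<close>. Its coefficients are traces, and the only denominator is the norm of
  \<open>\<delta> = \<Prod>\<^sub>k (y - \<sigma>\<^sup>k y)\<close>, the discriminant of
  \<open>y\<close> up to sign.
\<close>

lemma int_adjoin_denominator:
  assumes y: "y \<in> OK" "\<sigma> y \<noteq> y"
  obtains d :: int where "d > 0" "\<And>x. x \<in> OK \<Longrightarrow> of_int d * x \<in> int_adjoin y"
proof -
  define \<delta> where "\<delta> = (\<Prod>k=1..<7. y - s k y)"
  have \<delta>: "\<delta> \<in> OK" unfolding \<delta>_def using y by auto
  have "y \<noteq> s k y" if "k \<in> {1..<7}" for k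
    using fixed_if_s_fixed[of y k] y that by auto
  then have "\<delta> \<noteq> 0" by (auto simp: \<delta>_def)
  then have "Nm \<delta> \<noteq> 0" using \<delta> by (simp add: Nm_eq_0)
  moreover obtain e where e: "Nm \<delta> = of_int e" using Nm_in_Ints[OF \<delta>] by (elim Ints_cases)
  ultimately have e0: "e \<noteq> 0" by auto
  have main: "of_int e * x \<in> int_adjoin y" if x: "x \<in> OK" for x
  proof -
    define c where "c = (\<Prod>i=1..<7. s i \<delta>)"
    have c: "c \<in> OK" "\<delta> * c = of_int e" using \<delta> e Nm_split[of \<delta>] by (auto simp: c_def)
    \<comment> \<open>The first summand of the interpolation polynomial \<open>L\<close>: its value is \<open>Nm
        \<delta> * x\<close> at \<open>y\<close> and zero at the other conjugates. Applying
        \<open>\<sigma>\<close> to the coefficients gives the other summands.\<close>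
    define G where "G = smult (x * c) (\<Prod>k=1..<7. [:- s k y, 1:])"
    have G: "poly_over OK G" unfolding G_def using x c y
      by (intro poly_over_intros[OF OK_subring] poly_over_prod[OF OK_subring]) auto
    then have GK: "poly_over K G" by (auto simp: poly_over_def)
    have Gy: "poly G y = of_int e * x"
      using c by (simp add: G_def poly_prod \<delta>_def mult_ac)
    have Gs: "poly G (s k y) = 0" if "k \<in> {1..<7}" for k
      using that by (auto simp: G_def poly_prod intro!: bexI[of _ k])
    define L where "L = (\<Sum>i<7. map_poly (s i) G)"
    have "coeff L j = tr (coeff G j)" for j
      by (simp add: L_def coeff_sum coeff_map_poly tr_def)
    then have L: "poly_over \<int> L" using G tr_Ints by (simp add: poly_over_def)
    have val: "poly (map_poly (s i) G) y = (if i = 0 then of_int e * x else 0)" if "i < 7" for i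
    proof -
      have "poly (map_poly (s i) G) y = s i (poly G (s (7 - i) y))"
        using s_poly[OF GK, of "s (7 - i) y" i] y that s_comp[of i "7 - i" y] \<sigma>_order[of y] by simp
      also have "\<dots> = (if i = 0 then of_int e * x else 0)"
        using Gs[of "7 - i"] Gy that \<sigma>_order[of y] y by auto
      finally show ?thesis .
    qed
    have "poly L y = (\<Sum>i<7::nat. if i = 0 then of_int e * x else 0)"
      unfolding L_def poly_sum by (intro sum.cong) (auto simp: val)
    then have "poly L y = of_int e * x" by (simp add: sum.delta)
    then have "of_int e * x = poly L y" ..
    then show ?thesis using L unfolding int_adjoin_eq by blast
  qed
  have "of_int (e ^ 2) * x \<in> int_adjoin y" if "x \<in> OK" for x
    using main[of "of_int e * x"] that by (simp add: mult.assoc power2_eq_square)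
  then show ?thesis using that[of "e ^ 2"] e0 by simp
qed

lemma OK_denominator:
  assumes "x \<in> K" obtains D :: int where "D > 0" "of_int D * x \<in> OK"
  using K_denominator[OF assms] int_adjoin_OK[OF \<theta>_OK] by blast

text \<open>
  The ring of integers has bounded denominators with respect to \<open>\<int>[\<theta>]\<close>,
  so it may replace \<open>\<int>[\<theta>]\<close> in the definition of almost integrality.
\<close>

lemma OK_if_bounded_denominators:
  assumes x: "x \<in> K" and M: "M > 0" "\<And>k. of_int M * x ^ k \<in> OK"
  shows "x \<in> OK"
proof -
  obtain d :: int where d: "d > 0" "\<And>x. x \<in> OK \<Longrightarrow> of_int d * x \<in> int_adjoin \<theta>"
    using int_adjoin_denominator[OF \<theta>_OK \<theta>_moved] by blast
  have "of_int (d * M) * x ^ k \<in> int_adjoin \<theta>" for k using d(2)[OF M(2)[of k]] by (simp add: mult.assoc)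
  then show ?thesis using x d(1) M(1) 
    unfolding OK_iff almost_integral_def by (intro conjI exI[of _ "d * M"]) auto
qed

lemma rat_adjoin_eq_K:
  assumes y: "y \<in> OK" "\<sigma> y \<noteq> y" shows "rat_adjoin y = K"
proof
  interpret cring "complex_ring :: complex ring" by (rule cring_from_type_algebra)
  interpret field "complex_ring :: complex ring" by (rule field_from_type_algebra)
  have neg: "\<ominus>\<^bsub>complex_ring\<^esub> x = - x" for x :: complex
    by (rule minus_equality) (auto simp: ring_of_type_algebra_def)
  have inv: "inv\<^bsub>complex_ring\<^esub> x = inverse x" if "x \<noteq> 0" for x :: complex
    using that by (intro comm_inv_char) (auto simp: ring_of_type_algebra_def)
  show "rat_adjoin y \<subseteq> K"
  proof
    fix x assume "x \<in> rat_adjoin y"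
    then have "x \<in> generate_field complex_ring {y}" by (simp add: rat_adjoin_def)
    then show "x \<in> K"
    proof induction
      case (a_inv h)
      show ?case unfolding neg using a_inv.IH by simp
    next
      case (m_inv h)
      then have "h \<noteq> 0" by (simp add: ring_of_type_algebra_def)
      then show ?case using inv K_inverse m_inv.IH by simp
    next
      case (eng_add h1 h2)
      then show ?case by (simp add: ring_of_type_algebra_def)
    next
      case (eng_mult h1 h2)
      then show ?case by (simp add: ring_of_type_algebra_def)
    next
      case (incl h)
      then show ?case using y by simp
    next
      case one
      then show ?case by (simp add: ring_of_type_algebra_def)
    qed
  qed
  have S: "csubring (rat_adjoin y)"
    unfolding csubring_def rat_adjoin_def
  proof (intro conjI ballI)
    show "1 \<in> generate_field complex_ring {y}"
      using generate_field.one[of "complex_ring :: complex ring" "{y}"] by (simp add: ring_of_type_algebra_def)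
  next
    fix a b assume ab: "a \<in> generate_field complex_ring {y}" "b \<in> generate_field complex_ring {y}"
    show "a - b \<in> generate_field complex_ring {y}"
      using generate_field.eng_add[OF ab(1) generate_field.a_inv[OF ab(2)]]
      unfolding neg by (simp add: ring_of_type_algebra_def)
    show "a * b \<in> generate_field complex_ring {y}"
      using generate_field.eng_mult[OF ab] by (simp add: ring_of_type_algebra_def)
  qed
  have I: "inverse x \<in> rat_adjoin y" if "x \<in> rat_adjoin y" "x \<noteq> 0" for x
    using generate_field.m_inv[of x "complex_ring :: complex ring" "{y}"] that inv[OF that(2)]
    by (simp add: rat_adjoin_def ring_of_type_algebra_def)
  have y': "y \<in> rat_adjoin y" unfolding rat_adjoin_def by (rule generate_field.incl) simp
  have Z: "int_adjoin y \<subseteq> rat_adjoin y"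
    unfolding int_adjoin_eq using poly_over_value[OF S _ y'] poly_over_mono csubring_Ints[OF S] by blast
  show "K \<subseteq> rat_adjoin y"
  proof
    fix x assume x: "x \<in> K"
    obtain D :: int where D: "D > 0" "of_int D * x \<in> OK" using OK_denominator[OF x] .
    obtain d :: int where d: "d > 0" "\<And>x. x \<in> OK \<Longrightarrow> of_int d * x \<in> int_adjoin y"
      using int_adjoin_denominator[OF y] by blast
    have "of_int d * (of_int D * x) \<in> rat_adjoin y" using d(2)[OF D(2)] Z by blast
    moreover have "inverse (of_int (d * D)) \<in> rat_adjoin y"
      using d(1) D(1) by (intro I csubring_of_int[OF S]) auto
    ultimately have "inverse (of_int (d * D)) * (of_int d * (of_int D * x)) \<in> rat_adjoin y"
      by (rule csubring_mult[OF S, rotated])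
    then show "x \<in> rat_adjoin y" using d(1) D(1) by (simp add: field_simps)
  qed
qed

text \<open>
  Up to a common denominator \<open>d\<close> the integers have coordinates in
  \<open>\<int>\<^sup>7\<close> with respect to the powers of \<open>\<theta>\<close>, and two
  elements whose coordinates agree modulo \<open>n d\<close> are congruent modulo
  \<open>n\<close>.
\<close>

lemma finite_residues:
  assumes n: "n > (0::int)"
  obtains S where "finite S" "S \<subseteq> OK" "\<And>x. x \<in> OK \<Longrightarrow> \<exists>r\<in>S. \<exists>z\<in>OK. x - r = of_int n * z"
proof -
  obtain d :: int where d: "d > 0" "\<And>x. x \<in> OK \<Longrightarrow> of_int d * x \<in> int_adjoin \<theta>"
    using int_adjoin_denominator[OF \<theta>_OK \<theta>_moved] by blast
  have "\<forall>x\<in>OK. \<exists>c::nat \<Rightarrow> int. of_int d * x = (\<Sum>j<7. of_int (c j) * \<theta> ^ j)"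
  proof
    fix x assume "x \<in> OK"
    then obtain p where p: "poly_over \<int> p" "degree p < 7" "of_int d * x = poly p \<theta>"
      using int_adjoin_reduce[OF \<theta>_OK d(2)] by metis
    have "\<forall>i. \<exists>m. coeff p i = of_int m" using p(1) by (auto simp: poly_over_def elim: Ints_cases)
    then obtain c where c: "\<And>i. coeff p i = of_int (c i)" by metis
    have "poly p \<theta> = (\<Sum>j<7. coeff p j * \<theta> ^ j)"
      unfolding poly_altdef using p(2) by (intro sum.mono_neutral_left) (auto simp: coeff_eq_0)
    then show "\<exists>c::nat \<Rightarrow> int. of_int d * x = (\<Sum>j<7. of_int (c j) * \<theta> ^ j)" using p(3) c by auto
  qed
  then obtain c :: "complex \<Rightarrow> nat \<Rightarrow> int" where c: "\<And>x. x \<in> OK \<Longrightarrow> of_int d * x = (\<Sum>j<7. of_int (c x j) * \<theta> ^ j)"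
    by metis
  define F where "F x = (\<lambda>j\<in>{..<7::nat}. c x j mod (n * d))" for x
  have "F ` OK \<subseteq> PiE {..<7} (\<lambda>_. {0..<n * d})" using n d(1) by (auto simp: F_def PiE_def extensional_def)
  then have fin: "finite (F ` OK)" by (rule finite_subset) (auto intro: finite_PiE)
  define S where "S = (\<lambda>v. SOME x. x \<in> OK \<and> F x = v) ` (F ` OK)"
  have S: "(SOME z. z \<in> OK \<and> F z = F x) \<in> OK \<and> F (SOME z. z \<in> OK \<and> F z = F x) = F x" if "x \<in> OK" for x
    using that by (intro someI[of "\<lambda>z. z \<in> OK \<and> F z = F x" x]) auto
  have "\<exists>r\<in>S. \<exists>z\<in>OK. x - r = of_int n * z" if x: "x \<in> OK" for x
  proof -
    define r where "r = (SOME z. z \<in> OK \<and> F z = F x)"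
    have r: "r \<in> S" "r \<in> OK" "F r = F x" using S[OF x] x by (auto simp: r_def S_def)
    have "(n * d) dvd (c x j - c r j)" if "j < 7" for j
      using fun_cong[OF r(3), of j] that by (simp add: F_def mod_eq_dvd_iff dvd_diff_commute)
    then have "\<forall>j. \<exists>e. j < 7 \<longrightarrow> c x j - c r j = n * d * e" by (auto elim: dvdE)
    then obtain e where e: "\<And>j. j < 7 \<Longrightarrow> c x j - c r j = n * d * e j" by metis
    define z where "z = (\<Sum>j<7. of_int (e j) * \<theta> ^ j)"
    have "of_int d * (x - r) = (\<Sum>j<7. of_int (c x j - c r j) * \<theta> ^ j)"
      using c[OF x] c[OF r(2)] by (simp add: algebra_simps sum_subtractf)
    also have "\<dots> = of_int d * (of_int n * z)"
      unfolding z_def sum_distrib_left by (intro sum.cong) (auto simp: e)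
    finally have "x - r = of_int n * z" using d(1) by simp
    moreover have "z \<in> OK" unfolding z_def by auto
    ultimately show ?thesis using r(1) by blast
  qed
  moreover have "S \<subseteq> OK" using S by (auto simp: S_def)
  moreover have "finite S" using fin by (simp add: S_def)
  ultimately show ?thesis using that by blast
qed

lemma prime_not_unit:
  assumes "prime p" "z \<in> OK" shows "of_nat p * z \<noteq> 1"
proof
  assume 1: "of_nat p * z = 1"
  have p0: "of_nat p \<noteq> (0::complex)" using prime_gt_0_nat[OF assms(1)] by simp
  then have "z = 1 / of_nat p" using 1 by (simp add: field_simps)
  then have "z \<in> \<int>" using OK_Rats[OF assms(2)] by simp
  then obtain m where "z = of_int m" by (elim Ints_cases)
  then have "(of_int (int p * m) :: complex) = of_int 1" using 1 by simp
  then have "int p * m = 1" unfolding of_int_eq_iff .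
  then have "int p dvd 1" by (metis dvd_triv_left)
  then show False using assms(1) by (simp add: not_prime_unit)
qed

text \<open>
  The classes of \<open>1, y, \<dots>, y\<^sup>6\<close> modulo \<open>p\<close> are linearly
  independent over the field with \<open>p\<close> elements.
\<close>

definition independent_mod :: "nat \<Rightarrow> complex \<Rightarrow> bool" where
  "independent_mod p y \<longleftrightarrow> (\<forall>q. poly_over \<int> q \<longrightarrow> degree q < 7 \<longrightarrow>
     (\<exists>z\<in>OK. poly q y = of_nat p * z) \<longrightarrow> (\<forall>i. \<exists>m\<in>\<int>. coeff q i = of_nat p * m))"

lemma independent_mod_moved:
  assumes p: "prime p" and y: "y \<in> OK" and ind: "independent_mod p y" shows "\<sigma> y \<noteq> y"
proof
  assume "\<sigma> y = y"
  then have "y \<in> \<int>" using OK_Rats[OF y \<sigma>_fixed[OF OK_K[OF y]]] by simp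
  then have "poly_over \<int> [:- y, 1:]"
    by (intro poly_over_intros[OF csubring_Ints_set]) auto
  moreover have "\<exists>z\<in>OK. poly [:- y, 1:] y = of_nat p * z"
    by (rule bexI[of _ 0]) (simp_all add: csubring_zero[OF OK_subring])
  moreover have "degree [:- y, 1:] < 7" by simp
  ultimately have "\<exists>m\<in>\<int>. coeff [:- y, 1:] 1 = of_nat p * m"
    using ind unfolding independent_mod_def by blast
  then show False using prime_not_unit[OF p] Ints_OK by fastforce
qed

text \<open>
  If \<open>p\<close> divided the index, Cauchy's theorem would provide an integer
  \<open>a\<close> outside \<open>\<int>[y]\<close> with \<open>p a = q(y)\<close>. Independence
  modulo \<open>p\<close> makes all coefficients of \<open>q\<close> divisible by
  \<open>p\<close>, and then \<open>a\<close> lies in \<open>\<int>[y]\<close>.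
\<close>

lemma index_not_divisible:
  assumes p: "prime p" and y: "y \<in> OK" and ind: "independent_mod p y"
  shows "\<not> p dvd index_of_element K y"
proof
  assume *: "p dvd index_of_element K y"
  obtain d :: int where d: "d > 0" "\<And>x. x \<in> OK \<Longrightarrow> of_int d * x \<in> int_adjoin y"
    using int_adjoin_denominator[OF y independent_mod_moved[OF p y ind]] by blast
  obtain S where S: "finite S" "S \<subseteq> OK" "\<And>x. x \<in> OK \<Longrightarrow> \<exists>r\<in>S. \<exists>z\<in>OK. x - r = of_int d * z"
    using finite_residues[OF d(1)] by blast
  have coset: "H +>\<^bsub>complex_ring\<lparr>carrier := OK\<rparr>\<^esub> a = (\<lambda>h. h + a) ` H" for H and a :: complex
    by (auto simp: a_r_coset_def r_coset_def ring_of_type_algebra_def)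
  have "a_rcosets\<^bsub>complex_ring\<lparr>carrier := OK\<rparr>\<^esub> (int_adjoin y)
      \<subseteq> (\<lambda>a. (\<lambda>h. h + a) ` int_adjoin y) ` S"
  proof
    fix C assume "C \<in> a_rcosets\<^bsub>complex_ring\<lparr>carrier := OK\<rparr>\<^esub> (int_adjoin y)"
    then obtain x where x: "x \<in> OK" "C = (\<lambda>h. h + x) ` int_adjoin y"
      by (auto simp: A_RCOSETS_def RCOSETS_def r_coset_def ring_of_type_algebra_def image_def)
    obtain r z where r: "r \<in> S" "z \<in> OK" "x - r = of_int d * z" using S(3)[OF x(1)] by blast
    then have xr: "x - r \<in> int_adjoin y" using d(2) by simp
    have "(\<lambda>h. h + x) ` int_adjoin y = (\<lambda>h. h + r) ` int_adjoin y"
    proof (intro subset_antisym image_subsetI)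
      fix h assume h: "h \<in> int_adjoin y"
      show "h + x \<in> (\<lambda>h. h + r) ` int_adjoin y"
        using csubring_add[OF int_adjoin_subring h xr] by (intro image_eqI[of _ _ "h + (x - r)"]) auto
      show "h + r \<in> (\<lambda>h. h + x) ` int_adjoin y"
        using csubring_diff[OF int_adjoin_subring h xr] by (intro image_eqI[of _ _ "h - (x - r)"]) auto
    qed
    then show "C \<in> (\<lambda>a. (\<lambda>h. h + a) ` int_adjoin y) ` S" using x r by blast
  qed
  then have "finite (a_rcosets\<^bsub>complex_ring\<lparr>carrier := OK\<rparr>\<^esub> (int_adjoin y))"
    using S(1) finite_subset by blast
  then obtain a where a: "a \<in> OK" "a \<notin> int_adjoin y" "of_nat p * a \<in> int_adjoin y"
    using prime_dvd_card_cosets[OF OK_subring int_adjoin_subring int_adjoin_OK[OF y] _ p(1)] *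
    unfolding index_of_element_def by blast
  obtain q where q: "poly_over \<int> q" "degree q < 7" "of_nat p * a = poly q y"
    using int_adjoin_reduce[OF y a(3)] by metis
  then have "\<forall>i. \<exists>m\<in>\<int>. coeff q i = of_nat p * m" using ind a(1) unfolding independent_mod_def by metis
  then have "poly_over \<int> (smult (1 / of_nat p) q)"
    using prime_gt_0_nat[OF p] unfolding poly_over_def by (metis coeff_smult of_nat_eq_0_iff less_irrefl
        nonzero_mult_div_cancel_left times_divide_eq_left mult_1)
  moreover have "poly (smult (1 / of_nat p) q) y = a" using q(3) prime_gt_0_nat[OF p] by (simp flip: q(3))
  ultimately show False using a(2) unfolding int_adjoin_eq by blast
qed

section \<open>Ideals of the ring of integers\<close>

definition ideal_of_OK :: "complex set \<Rightarrow> bool" where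
  "ideal_of_OK J \<longleftrightarrow> J \<subseteq> OK \<and> 0 \<in> J \<and> (\<forall>a\<in>J. \<forall>b\<in>J. a + b \<in> J) \<and> (\<forall>a\<in>J. \<forall>x\<in>OK. x * a \<in> J)"

lemma ideal_of_OK_principal: "a \<in> OK \<Longrightarrow> ideal_of_OK ((*) a ` OK)"
  unfolding ideal_of_OK_def
  by (auto simp: mult.left_commute simp flip: distrib_left intro: image_eqI[of _ _ 0])

context
  fixes J :: "complex set"
  assumes J: "ideal_of_OK J"
begin

lemma ideal_OK: "x \<in> J \<Longrightarrow> x \<in> OK"
  and ideal_zero: "0 \<in> J"
  and ideal_add: "x \<in> J \<Longrightarrow> y \<in> J \<Longrightarrow> x + y \<in> J"
  and ideal_mult: "x \<in> J \<Longrightarrow> z \<in> OK \<Longrightarrow> z * x \<in> J"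
  using J unfolding ideal_of_OK_def by blast+

lemma ideal_mult_right: "x \<in> J \<Longrightarrow> z \<in> OK \<Longrightarrow> x * z \<in> J"
  using ideal_mult[of x z] by (simp add: mult.commute)
lemma ideal_uminus: "x \<in> J \<Longrightarrow> - x \<in> J" using ideal_mult[of x "-1"] by simp
lemma ideal_diff: "x \<in> J \<Longrightarrow> y \<in> J \<Longrightarrow> x - y \<in> J"
  using ideal_add[of x "- y"] ideal_uminus[of y] by simp
lemma ideal_sum: "(\<And>i. i \<in> I \<Longrightarrow> g i \<in> J) \<Longrightarrow> sum g I \<in> J"
  by (induction I rule: infinite_finite_induct) (auto intro: ideal_zero ideal_add)

lemma ideal_prod_cong:
  assumes "\<And>i. i \<in> I \<Longrightarrow> g i \<in> OK" "\<And>i. i \<in> I \<Longrightarrow> h i \<in> OK" "\<And>i. i \<in> I \<Longrightarrow> g i - h i \<in> J"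
  shows "prod g I - prod h I \<in> J"
  using assms
proof (induction I rule: infinite_finite_induct)
  case (insert i I)
  have "prod g (insert i I) - prod h (insert i I) = (g i - h i) * prod g I + h i * (prod g I - prod h I)"
    using insert by (simp add: algebra_simps)
  also have "\<dots> \<in> J" using insert by (intro ideal_add ideal_mult ideal_mult_right) auto
  finally show ?case .
qed (auto intro: ideal_zero)

lemma ideal_power_cong: "a \<in> OK \<Longrightarrow> b \<in> OK \<Longrightarrow> a - b \<in> J \<Longrightarrow> a ^ n - b ^ n \<in> J"
  using ideal_prod_cong[of "{..<n}" "\<lambda>_. a" "\<lambda>_. b"] by simp

lemma ideal_poly_cong:
  assumes "poly_over OK q" "a \<in> OK" "b \<in> OK" "a - b \<in> J" shows "poly q a - poly q b \<in> J"
proof -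
  have "poly q a - poly q b = (\<Sum>i\<le>degree q. coeff q i * (a ^ i - b ^ i))"
    by (simp add: poly_altdef sum_subtractf right_diff_distrib)
  also have "\<dots> \<in> J"
    using assms by (intro ideal_sum ideal_mult ideal_power_cong) (auto simp: poly_over_def)
  finally show ?thesis .
qed

context
  assumes trivial_action: "\<And>y. y \<in> OK \<Longrightarrow> y - \<sigma> y \<in> J"
begin

text \<open>
  When \<open>\<sigma>\<close> acts trivially modulo an ideal, trace and norm become
  multiplication by seven and the seventh power. This is used for totally ramified primes and
  for the ideal generated by \<open>\<beta> - \<sigma> \<beta>\<close> in a ring
  \<open>\<int>[\<beta>]\<close>.
\<close>

lemma s_cong_ideal: "y \<in> OK \<Longrightarrow> s k y - y \<in> J"
proof (induction k)
  case (Suc k)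
  have "s (Suc k) y - y = (s k y - y) - (s k y - \<sigma> (s k y))" by simp
  also have "\<dots> \<in> J" using Suc by (intro ideal_diff[OF Suc.IH trivial_action]) auto
  finally show ?case .
qed (simp add: ideal_zero)

lemma Nm_cong_power: "y \<in> OK \<Longrightarrow> Nm y - y ^ 7 \<in> J"
  using ideal_prod_cong[of "{..<7}" "\<lambda>i. s i y" "\<lambda>_. y"] s_cong_ideal by (simp add: Nm_def)

lemma tr_cong: "y \<in> OK \<Longrightarrow> tr y - 7 * y \<in> J"
  using ideal_sum[of "{..<7}" "\<lambda>i. s i y - y"] s_cong_ideal by (simp add: tr_def sum_subtractf)

end
end

text \<open>
  Maximality is stated as invertibility modulo \<open>P\<close> of every integer outside
  \<open>P\<close>.
\<close>

definition maximal_over :: "nat \<Rightarrow> complex set \<Rightarrow> bool" where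
  "maximal_over p P \<longleftrightarrow> ideal_of_OK P \<and> of_nat p \<in> P \<and> 1 \<notin> P \<and> (\<forall>x\<in>OK - P. \<exists>z\<in>OK. 1 - x * z \<in> P)"

text \<open>
  Zorn's lemma for the proper ideals that contain \<open>p\<close>. The ideal generated by
  \<open>p\<close> is proper because \<open>1 / p\<close> is rational but not an integer.
\<close>

lemma maximal_over_exists:
  assumes "prime p" obtains P where "maximal_over p P"
proof -
  define I where "I P \<longleftrightarrow> ideal_of_OK P \<and> of_nat p \<in> P \<and> 1 \<notin> P" for P
  define P0 where "P0 = (\<lambda>z. of_nat p * z) ` OK"
  have "ideal_of_OK P0" unfolding P0_def by (rule ideal_of_OK_principal) simp
  moreover have "of_nat p \<in> P0" unfolding P0_def by (rule image_eqI[of _ _ 1]) auto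
  moreover have "1 \<notin> P0" using prime_not_unit[OF assms] by (auto simp: P0_def)
  ultimately have "I P0" by (simp add: I_def)
  have "\<exists>M\<in>Collect I. \<forall>V\<in>Collect I. M \<subseteq> V \<longrightarrow> V = M"
  proof (rule subset_Zorn_nonempty)
    show "(Collect I) \<noteq> {}" using \<open>I P0\<close> by blast
    fix C assume C: "C \<noteq> {}" "subset.chain (Collect I) C"
    then have IC: "\<And>U. U \<in> C \<Longrightarrow> I U" and ch: "\<And>U V. U \<in> C \<Longrightarrow> V \<in> C \<Longrightarrow> U \<subseteq> V \<or> V \<subseteq> U"
      by (auto simp: subset_chain_def)
    have IC': "\<And>U. U \<in> C \<Longrightarrow> U \<subseteq> OK \<and> 0 \<in> U \<and> (\<forall>a\<in>U. \<forall>b\<in>U. a + b \<in> U) \<and> (\<forall>a\<in>U. \<forall>x\<in>OK. x * a \<in> U)"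
      using IC unfolding I_def ideal_of_OK_def by blast
    have "I (\<Union>C)"
      unfolding I_def ideal_of_OK_def
    proof (intro conjI ballI)
      show "0 \<in> \<Union>C" using C(1) IC' by blast
      show "\<Union>C \<subseteq> OK" using IC' by blast
      show "x * a \<in> \<Union>C" if "a \<in> \<Union>C" "x \<in> OK" for a x using IC' that by blast
      show "of_nat p \<in> \<Union>C" using C(1) IC unfolding I_def by blast
      show "1 \<notin> \<Union>C" using IC unfolding I_def by blast
      fix a b assume "a \<in> \<Union>C" "b \<in> \<Union>C"
      then obtain U V where "U \<in> C" "V \<in> C" "a \<in> U" "b \<in> V" by blast
      then obtain Z where "Z \<in> C" "a \<in> Z" "b \<in> Z" using ch by blast
      then show "a + b \<in> \<Union>C" using IC' by blast
    qed
    then show "\<Union>C \<in> (Collect I)" by simp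
  qed
  then obtain P where P: "I P" "\<And>U. I U \<Longrightarrow> P \<subseteq> U \<Longrightarrow> U = P" by blast
  note PI = P(1)[unfolded I_def ideal_of_OK_def]
  have "\<exists>z\<in>OK. 1 - x * z \<in> P" if x: "x \<in> OK - P" for x
  proof (rule ccontr)
    assume no: "\<not> ?thesis"
    define U where "U = {a + x * z | a z. a \<in> P \<and> z \<in> OK}"
    have P0: "0 \<in> P" using PI by blast
    have "P \<subseteq> U" unfolding U_def
      by (rule subsetI, rule CollectI) (metis add_0_right csubring_zero[OF OK_subring] mult_zero_right)
    have "x \<in> U" unfolding U_def
      by (rule CollectI) (metis P0 add_0 csubring_one[OF OK_subring] mult_1_right)
    have "I U"
      unfolding I_def ideal_of_OK_def
    proof (intro conjI ballI)
      show "0 \<in> U" using P0 \<open>P \<subseteq> U\<close> by blast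
      show "U \<subseteq> OK" using PI x by (auto simp: U_def subset_iff)
      show "a + b \<in> U" if ab: "a \<in> U" "b \<in> U" for a b
      proof -
        obtain a1 z1 b1 z2 where "a = a1 + x * z1" "b = b1 + x * z2" "a1 \<in> P" "b1 \<in> P" "z1 \<in> OK" "z2 \<in> OK"
          using ab by (auto simp: U_def)
        then show ?thesis unfolding U_def using PI
          by (intro CollectI exI[of _ "a1 + b1"] exI[of _ "z1 + z2"]) (auto simp: algebra_simps)
      qed
      show "w * a \<in> U" if aw: "a \<in> U" "w \<in> OK" for a w
      proof -
        obtain a1 z1 where "a = a1 + x * z1" "a1 \<in> P" "z1 \<in> OK" using aw by (auto simp: U_def)
        then show ?thesis unfolding U_def using PI aw
          by (intro CollectI exI[of _ "w * a1"] exI[of _ "w * z1"]) (auto simp: algebra_simps)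
      qed
      show "of_nat p \<in> U" using PI \<open>P \<subseteq> U\<close> by blast
      show "1 \<notin> U"
      proof
        assume "1 \<in> U"
        then obtain a z where az: "1 = a + x * z" "a \<in> P" "z \<in> OK" by (auto simp: U_def)
        then have "1 - x * z = a" by (simp add: algebra_simps)
        then have "1 - x * z \<in> P" using az(2) by simp
        then show False using no az by blast
      qed
    qed
    then have "U = P" using P(2) \<open>P \<subseteq> U\<close> by blast
    then show False using \<open>x \<in> U\<close> x by blast
  qed
  then have "maximal_over p P" using P(1) unfolding maximal_over_def I_def by blast
  then show ?thesis using that by blast
qed

section \<open>Split and inert primes\<close>

context
  fixes p :: nat and P :: "complex set"
  assumes p: "prime p" and P: "maximal_over p P"
begin

lemma P_ideal: "ideal_of_OK P"
  and P_p [simp]: "of_nat p \<in> P"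
  and P_one [simp]: "1 \<notin> P"
  and P_unit: "x \<in> OK \<Longrightarrow> x \<notin> P \<Longrightarrow> \<exists>z\<in>OK. 1 - x * z \<in> P"
  using P unfolding maximal_over_def by blast+

lemmas P_OK [simp] = ideal_OK[OF P_ideal]
lemmas P_zero [simp] = ideal_zero[OF P_ideal]
lemmas P_add [simp] = ideal_add[OF P_ideal]
lemmas P_mult [simp] = ideal_mult[OF P_ideal]
lemmas P_mult_right [simp] = ideal_mult_right[OF P_ideal]
lemmas P_uminus [simp] = ideal_uminus[OF P_ideal]
lemmas P_diff [simp] = ideal_diff[OF P_ideal]
lemmas P_sum = ideal_sum[OF P_ideal]

lemma P_prime: assumes "x \<in> OK" "y \<in> OK" "x * y \<in> P" shows "x \<in> P \<or> y \<in> P"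
proof (rule disjCI)
  assume "y \<notin> P"
  then obtain z where z: "z \<in> OK" "1 - y * z \<in> P" using P_unit assms by blast
  have "x = x * (1 - y * z) + z * (x * y)" by (simp add: algebra_simps)
  also have "\<dots> \<in> P" using z assms by simp
  finally show "x \<in> P" .
qed

lemma P_prime_prod: "finite I \<Longrightarrow> (\<And>i. i \<in> I \<Longrightarrow> g i \<in> OK) \<Longrightarrow> prod g I \<in> P \<Longrightarrow> \<exists>i\<in>I. g i \<in> P"
proof (induction I rule: finite_induct)
  case (insert i I)
  then have "g i \<in> P \<or> prod g I \<in> P" using P_prime[of "g i" "prod g I"] by simp
  then show ?case using insert by auto
qed auto

lemma P_prime_power: "x \<in> OK \<Longrightarrow> x ^ n \<in> P \<Longrightarrow> x \<in> P"
  using P_prime_prod[of "{..<n}" "\<lambda>_. x"] by auto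

lemma P_of_int: "of_int n \<in> P \<longleftrightarrow> int p dvd n"
proof
  assume "int p dvd n"
  then show "of_int n \<in> P" by (auto elim!: dvdE)
next
  assume n: "of_int n \<in> P"
  show "int p dvd n"
  proof (rule ccontr)
    assume "\<not> int p dvd n"
    then have "coprime (int p) n" using p by (simp add: prime_imp_coprime)
    then obtain a b where "a * int p + b * n = 1" by (metis coprime_imp_gcd_eq_1 bezout_int)
    then have "1 = of_int a * of_nat p + of_int b * (of_int n :: complex)"
      by (metis of_int_1 of_int_add of_int_mult of_int_of_nat_eq)
    also have "\<dots> \<in> P" using n by simp
    finally show False by simp
  qed
qed

text \<open>
  Modulo \<open>P\<close> there is a field, over which a polynomial of degree less than
  \<open>n\<close> with \<open>n\<close> different roots is zero.
\<close>

lemma coeffs_in_P: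
  assumes "poly_over OK q" "degree q < n" "\<And>i. i < n \<Longrightarrow> r i \<in> OK"
    "\<And>i j. i < n \<Longrightarrow> j < n \<Longrightarrow> i \<noteq> j \<Longrightarrow> r i - r j \<notin> P" "\<And>i. i < n \<Longrightarrow> poly q (r i) \<in> P"
  shows "coeff q k \<in> P"
  using assms
proof (induction n arbitrary: q k)
  case (Suc n)
  let ?l = "[:- r n, 1:]"
  have l: "poly_over OK ?l" using Suc.prems(3)[of n] by (intro poly_over_intros[OF OK_subring]) auto
  obtain q1 t where t: "q = q1 * ?l + t" "poly_over OK q1" "poly_over OK t" "t = 0 \<or> degree t < degree ?l"
    using poly_over_divide_monic[OF OK_subring l _ Suc.prems(1)] by auto
  then have "degree t = 0" by auto
  then obtain c where c: "t = [:c:]" by (auto elim: degree_eq_zeroE)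
  then have cP: "c \<in> P" using Suc.prems(5)[of n] t(1) by simp
  have q1: "coeff q1 i \<in> P" for i
  proof (cases "q1 = 0")
    case False
    have dl: "degree (q1 * ?l) = degree q1 + 1" using False by (subst degree_mult_eq) auto
    then have "degree q = degree q1 + 1"
      unfolding t(1) c by (subst degree_add_eq_left) (simp_all del: mult_pCons_right)
    then have "degree q1 < n" using Suc.prems(2) by simp
    moreover have "poly q1 (r i) \<in> P" if i: "i < n" for i
    proof -
      have "poly q (r i) - c = poly q1 (r i) * (r i - r n)" unfolding t(1) c by (simp add: algebra_simps)
      then have "poly q1 (r i) * (r i - r n) \<in> P" using Suc.prems(5)[of i] cP i by (metis P_diff less_SucI)
      moreover have "poly q1 (r i) \<in> OK" "r i - r n \<in> OK"
        using poly_over_value[OF OK_subring t(2)] Suc.prems(3)[of i] Suc.prems(3)[of n] i by simp_all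
      ultimately show ?thesis using P_prime Suc.prems(4)[of i n] i by auto
    qed
    ultimately show ?thesis using Suc.IH[OF t(2)] Suc.prems(3,4) by simp
  qed simp
  have "coeff q k = (\<Sum>j\<le>k. coeff q1 j * coeff ?l (k - j)) + coeff t k"
    by (simp add: t(1) coeff_mult del: mult_pCons_right)
  also have "\<dots> \<in> P"
    using q1 l cP by (intro P_add P_sum P_mult_right) (auto simp: poly_over_def c coeff_pCons split: nat.split)
  finally show ?case .
qed auto

lemma independent_mod_if_conjugates_incongruent:
  assumes y: "y \<in> OK" and "\<And>i j. i < j \<Longrightarrow> j < 7 \<Longrightarrow> s i y - s j y \<notin> P"
  shows "independent_mod p y"
  unfolding independent_mod_def
proof (intro allI impI)
  fix q :: "complex poly" and k
  assume q: "poly_over \<int> q" "degree q < 7" "\<exists>z\<in>OK. poly q y = of_nat p * z"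
  then obtain z where z: "z \<in> OK" "poly q y = of_nat p * z" by blast
  have "coeff q k \<in> P"
  proof (rule coeffs_in_P[OF poly_over_OK[OF q(1)] q(2), of "\<lambda>i. s i y"])
    show "poly q (s i y) \<in> P" if "i < 7" for i
      using z y by (simp flip: s_poly_Ints[OF q(1)] add: s_mult)
    show "s i y - s j y \<notin> P" if "i < 7" "j < 7" "i \<noteq> j" for i j
      using assms(2)[of i j] assms(2)[of j i] that P_uminus[of "s i y - s j y"] by (cases "i < j") auto
  qed (use y in auto)
  moreover obtain n where n: "coeff q k = of_int n" using q(1) by (auto simp: poly_over_def elim: Ints_cases)
  ultimately have "int p dvd n" by (simp add: P_of_int)
  then show "\<exists>m\<in>\<int>. coeff q k = of_nat p * m" using n by (auto elim!: dvdE)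
qed

text \<open>
  If \<open>P\<close> contains none of its other conjugates, then elements of these that lie
  outside \<open>P\<close>, multiplied together and normalised, give an element congruent to
  \<open>1\<close> modulo \<open>P\<close> and to \<open>0\<close> modulo the other six
  conjugates.
\<close>

lemma split_idempotent:
  assumes "\<forall>k\<in>{1..<7}. \<exists>a\<in>OK. s k a \<in> P \<and> a \<notin> P"
  obtains e where "e \<in> OK" "1 - e \<in> P" "\<And>k. 0 < k \<Longrightarrow> k < 7 \<Longrightarrow> s k e \<in> P"
proof -
  obtain a where a: "\<And>k. k \<in> {1..<7} \<Longrightarrow> a k \<in> OK \<and> s k (a k) \<in> P \<and> a k \<notin> P"
    using assms by metis
  define b where "b = (\<Prod>k=1..<7. a k)"
  have bOK: "b \<in> OK" unfolding b_def using a by (intro csubring_prod[OF OK_subring]) blast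
  have "b \<notin> P" using P_prime_prod[of "{1..<7}" a] a by (auto simp: b_def)
  then obtain z where z: "z \<in> OK" "1 - b * z \<in> P" using P_unit bOK by blast
  have "s k (b * z) \<in> P" if k: "0 < k" "k < 7" for k
  proof -
    have "b = a k * (\<Prod>j\<in>{1..<7} - {k}. a j)" unfolding b_def using k by (intro prod.remove) auto
    moreover have r: "(\<Prod>j\<in>{1..<7} - {k}. a j) \<in> OK" using a by (intro csubring_prod[OF OK_subring]) blast
    moreover have ak: "a k \<in> OK" "s k (a k) \<in> P" using a k by auto
    ultimately have "s k (b * z) = s k (a k) * (s k (\<Prod>j\<in>{1..<7} - {k}. a j) * s k z)"
      using z by (simp add: s_mult mult.assoc)
    also have "\<dots> \<in> P" using r ak z by simp
    finally show ?thesis .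
  qed
  then show ?thesis using that[of "b * z"] z bOK by simp
qed

text \<open>
  Modulo the seven conjugates of \<open>P\<close> the element \<open>\<Sum>\<^sub>k k
  \<sigma>\<^sup>k e\<close> takes the residues \<open>0, \<dots>, 6\<close>. They are different
  if \<open>p \<ge> 7\<close>.
\<close>

lemma independent_mod_split:
  assumes e: "e \<in> OK" "1 - e \<in> P" "\<And>k. 0 < k \<Longrightarrow> k < 7 \<Longrightarrow> s k e \<in> P" and p7: "p \<ge> 7"
  shows "\<exists>y\<in>OK. independent_mod p y"
proof -
  define y where "y = (\<Sum>k<7. of_nat k * s k e)"
  define d :: "nat \<Rightarrow> complex" where "d m = (if m mod 7 = 0 then 1 else 0)" for m
  have d: "s m e - d m \<in> P" for m
  proof (cases "m mod 7 = 0")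
    case True
    then have "s m e = e" using s_cong[of e m 0] e by simp
    then show ?thesis using True P_uminus[OF e(2)] by (simp add: d_def)
  next
    case False
    then show ?thesis using e(3)[of "m mod 7"] e(1) by (simp add: d_def s_mod)
  qed
  have y: "y \<in> OK" using e by (simp add: y_def)
  define c :: "nat \<Rightarrow> int" where "c m = (if m = 0 then 0 else 7 - int m)" for m
  have val: "s m y - of_int (c m) \<in> P" if m: "m < 7" for m
  proof -
    have *: "{..<7::nat} = {0,1,2,3,4,5,6}" by auto
    have "m \<in> {0,1,2,3,4,5,6}" using m by auto
    then have cm: "(\<Sum>k<7. of_nat k * d (m + k)) = of_int (c m)"
      unfolding * by (elim insertE) (simp_all add: d_def c_def)
    have "s m y = (\<Sum>k<7. of_nat k * s (m + k) e)"
      unfolding y_def using e by (subst s_sum) (auto simp: s_mult s_comp)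
    then have "s m y - of_int (c m) = (\<Sum>k<7. of_nat k * (s (m + k) e - d (m + k)))"
      unfolding cm[symmetric] by (simp add: sum_subtractf right_diff_distrib)
    also have "\<dots> \<in> P" using d by (intro P_sum P_mult) auto
    finally show ?thesis .
  qed
  have "s i y - s j y \<notin> P" if ij: "i < j" "j < 7" for i j
  proof
    assume "s i y - s j y \<in> P"
    moreover have "of_int (c i - c j) =
       (s i y - s j y) - (s i y - of_int (c i)) + (s j y - of_int (c j))"
      by simp
    ultimately have "of_int (c i - c j) \<in> P"
      using val[of i] val[of j] ij by (metis P_add P_diff less_trans)
    then have *: "int p dvd c i - c j" by (simp only: P_of_int)
    have "c i - c j \<noteq> 0" using ij by (auto simp: c_def)
    moreover have "\<bar>c i - c j\<bar> < 7" using ij by (auto simp: c_def abs_if)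
    ultimately show False using dvd_imp_le_int[OF _ *] p7 by simp
  qed
  then show ?thesis using independent_mod_if_conjugates_incongruent[OF y] y by blast
qed

text \<open>
  Every integer \<open>x\<close> is congruent modulo \<open>P\<close> to the rational integer
  \<open>tr (x e)\<close>. For \<open>x = \<theta>\<close> this is a root of \<open>f\<close>
  modulo \<open>p\<close>.
\<close>

lemma root_mod_split:
  assumes e: "e \<in> OK" "1 - e \<in> P" "\<And>k. 0 < k \<Longrightarrow> k < 7 \<Longrightarrow> s k e \<in> P"
  shows "\<exists>c n::int. poly f (of_int c) = of_int n \<and> int p dvd n"
proof -
  obtain c where c: "tr (\<theta> * e) = of_int c" using tr_Ints[of "\<theta> * e"] e by (auto elim: Ints_cases)
  have "{..<7::nat} = insert 0 {1..<7}" by auto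
  then have "tr (\<theta> * e) - \<theta> = \<theta> * e - \<theta> + (\<Sum>k=1..<7. s k \<theta> * s k e)"
    using e by (simp add: tr_def s_mult)
  also have "\<dots> = - (\<theta> * (1 - e)) + (\<Sum>k=1..<7. s k \<theta> * s k e)" by (simp add: algebra_simps)
  also have "\<dots> \<in> P" using e by (intro P_add P_sum P_mult P_uminus) auto
  finally have "poly f (of_int c) - poly f \<theta> \<in> P"
    unfolding c by (intro ideal_poly_cong[OF P_ideal] poly_over_OK[OF f_over]) auto
  moreover obtain n where n: "poly f (of_int c) = of_int n"
    using poly_over_value[OF csubring_Ints_set f_over, of "of_int c"] by (auto elim: Ints_cases)
  ultimately show ?thesis using f_root P_of_int by auto
qed

text \<open>
  If \<open>P\<close> contains one of its other conjugates, then \<open>P\<close> is stable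
  under a nontrivial power of \<open>\<sigma>\<close>, hence under \<open>\<sigma>\<close>.
\<close>

lemma stable_if_not_split:
  assumes "\<not> (\<forall>k\<in>{1..<7}. \<exists>a\<in>OK. s k a \<in> P \<and> a \<notin> P)" "a \<in> P"
  shows "s j a \<in> P"
proof -
  obtain k where k: "k \<in> {1..<7}" "\<And>a. a \<in> OK \<Longrightarrow> s k a \<in> P \<Longrightarrow> a \<in> P" using assms by blast
  have 1: "s (7 - k) a \<in> P" if "a \<in> P" for a
    using k(2)[of "s (7 - k) a"] that k(1) \<sigma>_order[of a] by (simp add: s_comp)
  have 2: "s ((7 - k) * m) a \<in> P" for m
  proof (induction m)
    case (Suc m)
    then show ?case using 1[OF Suc] by (simp add: s_comp)
  qed (use assms in simp)
  obtain m where m: "((7 - k) * m) mod 7 = 1" using exists_inverse_mod_7[of "7 - k"] k(1) by auto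
  have "((7 - k) * (m * j)) mod 7 = j mod 7"
    using mod_mult_left_eq[of "(7 - k) * m" 7 j] m by (simp add: mult.assoc)
  then have "s ((7 - k) * (m * j)) a = s j a" using assms(2) by (intro s_cong) auto
  then show ?thesis using 2[of "m * j"] by simp
qed

text \<open>
  Here \<open>\<sigma>\<close> acts on \<open>O / P\<close>. A residue class fixed by a
  nontrivial power of \<open>\<sigma>\<close> is fixed by \<open>\<sigma>\<close>, so the
  conjugates of \<open>y\<close> are pairwise incongruent as soon as \<open>y\<close> and
  \<open>\<sigma> y\<close> are.
\<close>

lemma independent_mod_inert:
  assumes st: "\<And>a j. a \<in> P \<Longrightarrow> s j a \<in> P" and y: "y \<in> OK" "y - \<sigma> y \<notin> P"
  shows "independent_mod p y"
proof (rule independent_mod_if_conjugates_incongruent[OF y(1)])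
  fix i j :: nat assume ij: "i < j" "j < 7"
  show "s i y - s j y \<notin> P"
  proof
    assume "s i y - s j y \<in> P"
    then have "s (7 - i) (s i y - s j y) \<in> P" by (rule st)
    moreover have "s (7 - i) (s i y) = y" using ij y \<sigma>_order[of y] by (simp add: s_comp)
    moreover have "s (7 - i) (s j y) = s (j - i) y"
      using ij y by (simp add: s_comp) (intro s_cong; simp add: mod_if)
    ultimately have d: "y - s (j - i) y \<in> P" using y by (simp add: s_diff)
    have *: "y - s ((j - i) * m) y \<in> P" for m
    proof (induction m)
      case (Suc m)
      have "s ((j - i) * m) (y - s (j - i) y) = s ((j - i) * m) y - s ((j - i) * Suc m) y"
        using y s_diff[of y "s (j - i) y" "(j - i) * m"] by (simp add: s_comp add.commute)
      then have "y - s ((j - i) * Suc m) y = (y - s ((j - i) * m) y) + s ((j - i) * m) (y - s (j - i) y)"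
        by simp
      also have "\<dots> \<in> P" by (rule P_add[OF Suc st[OF d]])
      finally show ?case .
    qed simp
    obtain m where "((j - i) * m) mod 7 = 1" using exists_inverse_mod_7[of "j - i"] ij by (meson less_imp_diff_less zero_less_diff)
    then have "s ((j - i) * m) y = s 1 y" using y by (intro s_cong) auto
    then show False using *[of m] y by simp
  qed
qed

section \<open>Totally ramified primes\<close>

context
  assumes stable: "\<And>a j. a \<in> P \<Longrightarrow> s j a \<in> P"
    and ramified: "\<And>y. y \<in> OK \<Longrightarrow> y - \<sigma> y \<in> P"
begin

lemma Nm_in_P: "x \<in> OK \<Longrightarrow> Nm x \<in> P \<longleftrightarrow> x \<in> P"
proof
  assume "x \<in> OK" "Nm x \<in> P"
  then have "Nm x - (Nm x - x ^ 7) \<in> P" using P_diff[OF _ Nm_cong_power[OF P_ideal ramified]] by blast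
  then show "x \<in> P" using P_prime_power[of x 7] \<open>x \<in> OK\<close> by simp
next
  assume "x \<in> OK" "x \<in> P"
  then show "Nm x \<in> P" by (subst Nm_split) (intro P_mult_right; simp)
qed

text \<open>
  If \<open>p \<noteq> 7\<close>, then \<open>7 y\<close> is congruent to the trace of
  \<open>y\<close> and \<open>7\<close> is invertible. If \<open>p = 7\<close>, then
  \<open>y\<^sup>7\<close> is congruent to the norm \<open>c\<close> of \<open>y\<close>, and
  \<open>(y - c)\<^sup>7 \<equiv> y\<^sup>7 - c\<^sup>7 \<equiv> 0\<close>.
\<close>

lemma residue_field_prime:
  assumes y: "y \<in> OK" obtains c :: int where "y - of_int c \<in> P"
proof (cases "p = 7")
  case True
  obtain c where c: "Nm y = of_int c" using Nm_in_Ints[OF y] by (elim Ints_cases)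
  let ?c = "of_int c :: complex"
  obtain k where "c ^ 7 - c = 7 * k" using power_7_mod_7[of c] by (elim dvdE)
  then have k: "?c ^ 7 - ?c = 7 * of_int k" by (metis of_int_diff of_int_mult of_int_numeral of_int_power)
  define W where "W = - ?c * y ^ 6 + 3 * ?c ^ 2 * y ^ 5 - 5 * ?c ^ 3 * y ^ 4 + 5 * ?c ^ 4 * y ^ 3 - 3 * ?c ^ 5 * y ^ 2 + ?c ^ 6 * y"
  have num: "numeral n \<in> OK" for n using csubring_of_nat[OF OK_subring, of "numeral n"] by simp
  have W: "W \<in> OK" unfolding W_def using y num by simp
  have 7: "7 \<in> P" using P_p True by simp
  have "(y - ?c) ^ 7 = y ^ 7 - ?c ^ 7 + 7 * W"
    unfolding W_def by (simp add: eval_nat_numeral algebra_simps)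
  also have "\<dots> = - (Nm y - y ^ 7) - 7 * of_int k + 7 * W" using c k by (simp add: algebra_simps)
  also have "\<dots> \<in> P" using W 7
    by (intro P_add P_diff[OF P_uminus[OF Nm_cong_power[OF P_ideal ramified y]]] P_mult_right) auto
  finally have "y - ?c \<in> P" using P_prime_power[of "y - ?c" 7] y by simp
  then show ?thesis using that by blast
next
  case False
  have "coprime (7::int) (int p)"
  proof -
    have "prime (7::nat)" by simp
    then have "coprime 7 p" using False p primes_coprime by metis
    then show ?thesis by (metis coprime_int_iff of_nat_numeral)
  qed
  then obtain a b where ab: "a * 7 + b * int p = 1" by (metis coprime_imp_gcd_eq_1 bezout_int)
  obtain n where n: "tr y = of_int n" using tr_Ints[OF y] by (elim Ints_cases)
  have 1: "of_int n - 7 * y \<in> P" using tr_cong[OF P_ideal ramified y] n by simp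
  have "of_int (a * 7 + b * int p) = (1::complex)" using ab by simp
  then have e: "of_int a * 7 + of_int b * of_nat p = (1::complex)" by simp
  have "y - of_int (a * n) = y * (of_int a * 7 + of_int b * of_nat p) - of_int a * of_int n" unfolding e by simp
  also have "\<dots> = of_int b * y * of_nat p - of_int a * (of_int n - 7 * y)" by (simp add: algebra_simps)
  also have "\<dots> \<in> P" using y by (intro P_diff[OF P_mult[OF P_p] P_mult[OF 1]]) auto
  finally show ?thesis using that by blast
qed

definition nint :: "complex \<Rightarrow> int" where "nint x = \<lfloor>Re (Nm x)\<rfloor>"
text \<open>
  For an inert prime this is seven times the normalised \<open>P\<close>-adic valuation, in the
  totally ramified case the normalised valuation itself; that it takes the value
  \<open>1\<close> there has to be proved.
\<close>

definition v :: "complex \<Rightarrow> nat" where "v x = multiplicity (int p) (nint x)"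

lemma of_int_nint: "x \<in> OK \<Longrightarrow> of_int (nint x) = Nm x"
  using Nm_in_Ints[of x] by (auto elim!: Ints_cases simp: nint_def)

lemma nint_eq_0: "x \<in> OK \<Longrightarrow> nint x = 0 \<longleftrightarrow> x = 0"
  using of_int_nint[of x] Nm_eq_0[of x] by (metis OK_K of_int_0 of_int_eq_iff)

lemma v_mult: assumes "x \<in> OK" "y \<in> OK" "x \<noteq> 0" "y \<noteq> 0" shows "v (x * y) = v x + v y"
proof -
  have "(of_int (nint (x * y)) :: complex) = of_int (nint x * nint y)"
    using assms of_int_nint by (simp add: Nm_mult)
  then have "nint (x * y) = nint x * nint y" by (simp only: of_int_eq_iff)
  then show ?thesis unfolding v_def using assms nint_eq_0 p
    by (simp add: prime_elem_multiplicity_mult_distrib prime_imp_prime_elem)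
qed

lemma v_power: assumes "x \<in> OK" "x \<noteq> 0" shows "v (x ^ n) = n * v x"
proof (induction n)
  case 0
  have "v 1 = 0" using v_mult[of 1 1] by simp
  then show ?case by simp
qed (use assms v_mult[of x "x ^ _"] in simp)

lemma v_p: "v (of_nat p) = 7"
proof -
  have "(of_int (nint (of_nat p)) :: complex) = of_int (int p ^ 7)"
    using of_int_nint[of "of_nat p"] by (simp add: Nm_Ints)
  then have "nint (of_nat p) = int p ^ 7" by (simp only: of_int_eq_iff)
  then show ?thesis unfolding v_def using p by (simp add: multiplicity_same_power prime_gt_1_nat not_prime_unit)
qed

lemma v_pos_iff: assumes "x \<in> OK" "x \<noteq> 0" shows "v x > 0 \<longleftrightarrow> x \<in> P"
proof -
  have "x \<in> P \<longleftrightarrow> int p dvd nint x" using Nm_in_P[OF assms(1)] of_int_nint[OF assms(1)] P_of_int by metis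
  moreover have "v x > 0 \<longleftrightarrow> int p dvd nint x"
    unfolding v_def using assms nint_eq_0 p multiplicity_eq_zero_iff[of "nint x" "int p"] prime_gt_1_nat[OF p] by auto
  ultimately show ?thesis by simp
qed

text \<open>
  An element \<open>u\<close> outside \<open>P\<close> is a unit modulo \<open>p\<close>,
  because it divides its norm, which is prime to \<open>p\<close>.
\<close>

lemma cancel_unit_mod_p:
  assumes "x \<in> OK" "u \<in> OK" "u \<notin> P" "z \<in> OK" "u * x = of_nat p * z"
  shows "\<exists>z'\<in>OK. x = of_nat p * z'"
proof -
  define u' where "u' = (\<Prod>i=1..<7. s i u)"
  have u': "u' \<in> OK" "u' * u = of_int (nint u)"
    using assms Nm_split[of u] of_int_nint[of u] by (simp_all add: u'_def mult.commute)
  have "of_int (nint u) \<notin> P" using Nm_in_P assms of_int_nint by metis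
  then have "coprime (int p) (nint u)" using p by (simp add: P_of_int prime_imp_coprime)
  then obtain a b where "a * int p + b * nint u = 1" by (metis coprime_imp_gcd_eq_1 bezout_int)
  then have "of_int (a * int p + b * nint u) = (1::complex)" by simp
  then have e: "of_int a * of_nat p + of_int b * (u' * u) = (1::complex)" by (simp add: u')
  have "x = x * (of_int a * of_nat p + of_int b * (u' * u))" unfolding e by simp
  also have "\<dots> = of_nat p * (of_int a * x) + of_int b * u' * (u * x)" by (simp add: algebra_simps)
  also have "\<dots> = of_nat p * (of_int a * x + of_int b * u' * z)" unfolding assms(5) by (simp add: algebra_simps)
  finally show ?thesis using assms u' by (intro bexI[of _ "of_int a * x + of_int b * u' * z"]) auto
qed

text \<open>
  An element \<open>c\<close> of the finite ring \<open>O / p O\<close> that generates a nonzero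
  ideal of smallest size is annihilated by \<open>P\<close>: if \<open>c x\<close> with
  \<open>x\<close> in \<open>P\<close> were nonzero, it would generate the same ideal, and
  \<open>c (1 - x z)\<close> would vanish for some \<open>z\<close> although \<open>1 - x
  z\<close> is a unit.
\<close>

lemma socle_mod_p:
  obtains c where "c \<in> OK" "\<And>z. z \<in> OK \<Longrightarrow> c \<noteq> of_nat p * z"
    "\<And>x. x \<in> P \<Longrightarrow> \<exists>z\<in>OK. c * x = of_nat p * z"
proof -
  have p0: "int p > 0" using prime_gt_0_nat[OF p] by simp
  obtain S where S: "finite S" "S \<subseteq> OK" "\<And>x. x \<in> OK \<Longrightarrow> \<exists>r\<in>S. \<exists>z\<in>OK. x - r = of_int (int p) * z"
    using finite_residues[OF p0] by blast
  define R where "R c = {r \<in> S. \<exists>z\<in>OK. \<exists>w\<in>OK. r - c * z = of_nat p * w}" for c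
  define good where "good c \<longleftrightarrow> c \<in> OK \<and> (\<forall>z\<in>OK. c \<noteq> of_nat p * z)" for c
  have "good 1" unfolding good_def using prime_not_unit[OF p] by (metis csubring_one[OF OK_subring])
  then obtain c where c: "good c" "\<And>c'. good c' \<Longrightarrow> card (R c) \<le> card (R c')"
    using ex_has_least_nat[of good 1 "\<lambda>c. card (R c)"] by blast
  have cOK: "c \<in> OK" using c(1) by (simp add: good_def)
  have "\<exists>z\<in>OK. c * x = of_nat p * z" if x: "x \<in> P" for x
  proof (rule ccontr)
    assume "\<not> ?thesis"
    then have g: "good (c * x)" using x cOK by (auto simp: good_def)
    have sub: "R (c * x) \<subseteq> R c"
    proof
      fix r assume "r \<in> R (c * x)"
      then obtain z w where "r \<in> S" "z \<in> OK" "w \<in> OK" "r - c * (x * z) = of_nat p * w"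
        by (auto simp: R_def mult.assoc)
      then show "r \<in> R c" unfolding R_def using x by (intro CollectI conjI bexI[of _ "x * z"] bexI[of _ w]) auto
    qed
    have "finite (R c)" using S(1) by (simp add: R_def)
    then have eq: "R (c * x) = R c" using card_subset_eq[OF _ sub] card_mono[OF _ sub] c(2)[OF g] by simp
    obtain r w where r: "r \<in> S" "w \<in> OK" "c - r = of_nat p * w" using S(3)[OF cOK] by auto
    then have "r - c * 1 = of_nat p * (- w)" by (simp add: algebra_simps)
    then have "r \<in> R c" unfolding R_def using r by (intro CollectI conjI bexI[of _ 1] bexI[of _ "- w"]) auto
    then obtain z w' where z: "z \<in> OK" "w' \<in> OK" "r - c * x * z = of_nat p * w'"
      unfolding eq[symmetric] unfolding R_def by blast
    have "(1 - x * z) * c = (c - r) + (r - c * x * z)" by (simp add: algebra_simps)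
    also have "\<dots> = of_nat p * (w + w')" unfolding r(3) z(3) by (rule distrib_left[symmetric])
    finally have *: "(1 - x * z) * c = of_nat p * (w + w')" .
    have "1 - x * z \<notin> P"
    proof
      assume "1 - x * z \<in> P"
      then have "(1 - x * z) + x * z \<in> P" using x z by (intro P_add P_mult_right) auto
      then show False by simp
    qed
    then show False using cancel_unit_mod_p[OF cOK _ _ _ *] x z r c(1) by (auto simp: good_def)
  qed
  then show ?thesis using that c(1) by (auto simp: good_def)
qed

text \<open>
  This is the usual proof that \<open>P\<close> is invertible. With \<open>c\<close> from the
  preceding lemma, \<open>\<gamma> = c / p\<close> is not an integer but maps \<open>P\<close>
  into the integers. If it mapped \<open>P\<close> into itself, its powers would have bounded
  denominators and \<open>\<gamma>\<close> would be an integer. So \<open>\<gamma> \<pi>\<close>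
  is a unit at \<open>P\<close> for some \<open>\<pi>\<close> in \<open>P\<close>, and
  \<open>\<pi>\<close> generates \<open>P\<close> locally.
\<close>

lemma local_uniformizer:
  obtains \<pi> w where "\<pi> \<in> P" "w \<in> OK" "w \<notin> P" "\<And>x. x \<in> P \<Longrightarrow> \<exists>z\<in>OK. w * x = \<pi> * z"
proof -
  have p0: "of_nat p \<noteq> (0::complex)" using prime_gt_0_nat[OF p] by simp
  obtain c where c: "c \<in> OK" "\<And>z. z \<in> OK \<Longrightarrow> c \<noteq> of_nat p * z"
    "\<And>x. x \<in> P \<Longrightarrow> \<exists>z\<in>OK. c * x = of_nat p * z"
    using socle_mod_p by metis
  define \<gamma> where "\<gamma> = c / of_nat p"
  have \<gamma>K: "\<gamma> \<in> K" unfolding \<gamma>_def using c by (intro K_divide) auto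
  have \<gamma>P: "\<gamma> * x \<in> OK" if x: "x \<in> P" for x
  proof -
    obtain z where "z \<in> OK" "c * x = of_nat p * z" using c(3)[OF x] by blast
    then have "\<gamma> * x = z" using p0 by (simp add: \<gamma>_def field_simps)
    then show ?thesis using \<open>z \<in> OK\<close> by simp
  qed
  have "\<exists>\<pi>\<in>P. \<gamma> * \<pi> \<notin> P"
  proof (rule ccontr)
    assume no: "\<not> ?thesis"
    have "\<gamma> ^ k * of_nat p \<in> P" for k
    proof (induction k)
      case (Suc k)
      then show ?case using no by (auto simp: mult.assoc)
    qed simp
    then have "of_int (int p) * \<gamma> ^ k \<in> OK" for k using P_OK[of "\<gamma> ^ k * of_nat p"] by (simp add: mult.commute)
    then have "\<gamma> \<in> OK"
      by (rule OK_if_bounded_denominators[OF \<gamma>K, rotated]) (use prime_gt_0_nat[OF p] in simp)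
    moreover have "c = of_nat p * \<gamma>" using p0 by (simp add: \<gamma>_def)
    ultimately show False using c(2) by blast
  qed
  then obtain \<pi> where \<pi>: "\<pi> \<in> P" "\<gamma> * \<pi> \<notin> P" by blast
  have "\<exists>z\<in>OK. (\<gamma> * \<pi>) * x = \<pi> * z" if "x \<in> P" for x
    using \<gamma>P[OF that] by (intro bexI[of _ "\<gamma> * x"]) (auto simp: mult_ac)
  then show ?thesis using that[of \<pi> "\<gamma> * \<pi>"] \<pi> \<gamma>P by blast
qed

text \<open>
  Otherwise every integer is \<open>c + p z\<close>, and \<open>y - \<sigma> y = p (z - \<sigma>
  z)\<close> could be divided by \<open>p\<close> again and again.
\<close>

lemma not_congruent_to_Ints_mod_p: "\<exists>y\<in>OK. \<forall>c::int. \<forall>z\<in>OK. y - of_int c \<noteq> of_nat p * z"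
proof (rule ccontr)
  assume no: "\<not> ?thesis"
  define good where "good y \<longleftrightarrow> y \<in> OK \<and> \<sigma> y \<noteq> y" for y
  have "good \<theta>" using \<theta>_moved by (simp add: good_def)
  then obtain y where y: "good y" "\<And>y'. good y' \<Longrightarrow> v (y - \<sigma> y) \<le> v (y' - \<sigma> y')"
    using ex_has_least_nat[of good \<theta> "\<lambda>y. v (y - \<sigma> y)"] by blast
  obtain c z where z: "z \<in> OK" "y - of_int c = of_nat p * z" using no y(1) by (auto simp: good_def)
  have yz: "y = of_int c + of_nat p * z" using z(2) by (simp add: algebra_simps)
  have "s 1 y = of_int c + of_nat p * s 1 z" unfolding yz using z(1) by (subst s_add) (auto simp: s_mult simp del: funpow.simps)
  then have d: "y - \<sigma> y = of_nat p * (z - \<sigma> z)" using yz by (simp add: algebra_simps)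
  have zn: "z - \<sigma> z \<noteq> 0" using d y(1) by (auto simp: good_def)
  then have "good z" using z by (auto simp: good_def)
  moreover have "v (y - \<sigma> y) = 7 + v (z - \<sigma> z)"
    unfolding d using z(1) zn v_p OK_s[of z 1] prime_gt_0_nat[OF p] by (subst v_mult) auto
  ultimately show False using y(2)[of z] by simp
qed

text \<open>
  By local divisibility every value of \<open>v\<close> is a multiple of \<open>v \<pi>\<close>,
  and \<open>v p = 7\<close>. If \<open>v \<pi> = 7\<close>, then \<open>P\<close> is generated
  by \<open>p\<close> and every integer is congruent to a rational one modulo \<open>p\<close>,
  which is impossible. So \<open>v \<pi> = 1\<close>. A relation between \<open>1, \<pi>,
  \<dots>, \<pi>\<^sup>6\<close> modulo \<open>p\<close> whose first coefficient prime to
  \<open>p\<close> is that of \<open>\<pi>\<^sup>j\<close> would imply that \<open>p\<close>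
  divides \<open>\<pi>\<^sup>j\<close>, although \<open>v (\<pi>\<^sup>j) = j < 7\<close>.
\<close>

lemma independent_mod_ramified: "\<exists>y\<in>OK. independent_mod p y"
proof -
  obtain \<pi> w where \<pi>: "\<pi> \<in> P" and w: "w \<in> OK" "w \<notin> P" and div: "\<And>x. x \<in> P \<Longrightarrow> \<exists>z\<in>OK. w * x = \<pi> * z"
    using local_uniformizer by blast
  have p0: "of_nat p \<noteq> (0::complex)" using prime_gt_0_nat[OF p] by simp
  have w0: "w \<noteq> 0" using w by auto
  have vw: "v w = 0" using v_pos_iff[OF w(1) w0] w by simp
  have \<pi>0: "\<pi> \<noteq> 0"
  proof
    assume "\<pi> = 0"
    then have "w * of_nat p = 0" using div[OF P_p] by auto
    then show False using w0 p0 by simp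
  qed
  have v_step: "\<exists>z\<in>OK. z \<noteq> 0 \<and> v x = v \<pi> + v z \<and> w * x = \<pi> * z" if x: "x \<in> P" "x \<noteq> 0" for x
  proof -
    obtain z where z: "z \<in> OK" "w * x = \<pi> * z" using div[OF x(1)] by blast
    then have "z \<noteq> 0" using x w0 by auto
    moreover have "v w + v x = v \<pi> + v z"
      using v_mult[of w x] v_mult[of \<pi> z] z x w w0 \<pi> \<pi>0 \<open>z \<noteq> 0\<close> by simp
    ultimately show ?thesis using vw z by auto
  qed
  have v\<pi>: "v \<pi> > 0" using v_pos_iff[of \<pi>] \<pi> \<pi>0 by simp
  have v_dvd: "v \<pi> dvd v x" if "x \<in> OK" "x \<noteq> 0" for x
    using that
  proof (induction "v x" arbitrary: x rule: less_induct)
    case less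
    show ?case
    proof (cases "x \<in> P")
      case True
      then obtain z where z: "z \<in> OK" "z \<noteq> 0" "v x = v \<pi> + v z" using v_step less.prems by blast
      then have "v \<pi> dvd v z" using less.hyps[of z] v\<pi> by simp
      then show ?thesis using z by simp
    next
      case False
      then show ?thesis using v_pos_iff[of x] less.prems by simp
    qed
  qed
  have "v \<pi> dvd 7" using v_dvd[of "of_nat p"] v_p p0 by simp
  moreover have "prime (7::nat)" by simp
  ultimately have "v \<pi> = 1 \<or> v \<pi> = 7" by (metis prime_nat_iff)
  moreover have "v \<pi> \<noteq> 7"
  proof
    assume 7: "v \<pi> = 7"
    obtain z where z: "z \<in> OK" "z \<noteq> 0" "7 = 7 + v z" "w * of_nat p = \<pi> * z"
      using v_step[OF P_p p0] v_p 7 by auto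
    then have zP: "z \<notin> P" using v_pos_iff[of z] by simp
    have P_eq: "\<exists>u\<in>OK. x = of_nat p * u" if x: "x \<in> P" for x
    proof -
      obtain y where y: "y \<in> OK" "w * x = \<pi> * y" using div[OF x] by blast
      have "w * (z * x) = w * (of_nat p * y)" using y(2) z(4) by (metis mult.assoc mult.commute)
      then have "z * x = of_nat p * y" using w0 by simp
      then show ?thesis using cancel_unit_mod_p[of x z y] x z y zP by simp
    qed
    obtain y where y: "y \<in> OK" "\<And>c::int. \<And>z. z \<in> OK \<Longrightarrow> y - of_int c \<noteq> of_nat p * z"
      using not_congruent_to_Ints_mod_p by blast
    obtain c :: int where "y - of_int c \<in> P" using residue_field_prime[OF y(1)] .
    then show False using P_eq y(2) by blast
  qed
  ultimately have v1: "v \<pi> = 1" by blast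
  have "independent_mod p \<pi>"
    unfolding independent_mod_def
  proof (intro allI impI)
    fix q :: "complex poly" and k
    assume q: "poly_over \<int> q" "degree q < 7" "\<exists>z\<in>OK. poly q \<pi> = of_nat p * z"
    have "\<forall>i. \<exists>m. coeff q i = of_int m" using q(1) by (auto simp: poly_over_def elim: Ints_cases)
    then obtain c where c: "\<And>i. coeff q i = of_int (c i)" by metis
    have val: "poly q \<pi> = (\<Sum>i<7. of_int (c i) * \<pi> ^ i)"
      unfolding poly_altdef c using q(2) by (intro sum.mono_neutral_left) (auto simp: coeff_eq_0 simp flip: c)
    have "int p dvd c k"
    proof (rule ccontr)
      assume "\<not> int p dvd c k"
      define j where "j = (LEAST i. \<not> int p dvd c i)"
      have j: "\<not> int p dvd c j" "\<And>i. i < j \<Longrightarrow> int p dvd c i"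
        using LeastI[of "\<lambda>i. \<not> int p dvd c i", OF \<open>\<not> int p dvd c k\<close>] not_less_Least
        unfolding j_def by blast+
      have "c j \<noteq> 0" using j(1) by auto
      then have j7: "j < 7" using q(2) c[of j] le_degree[of q j] by auto
      define u where "u = (\<Sum>i=j..<7. of_int (c i) * \<pi> ^ (i - j))"
      have "\<forall>i. \<exists>e. i < j \<longrightarrow> c i = int p * e" using j(2) by (auto elim: dvdE)
      then obtain e where e: "\<And>i. i < j \<Longrightarrow> c i = int p * e i" by metis
      have split: "{..<7} = {..<j} \<union> {j..<7}" using j7 by auto
      have "poly q \<pi> = (\<Sum>i<j. of_int (c i) * \<pi> ^ i) + (\<Sum>i=j..<7. of_int (c i) * \<pi> ^ i)"
        unfolding val split by (rule sum.union_disjoint) auto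
      also have "(\<Sum>i<j. of_int (c i) * \<pi> ^ i) = of_nat p * (\<Sum>i<j. of_int (e i) * \<pi> ^ i)"
        unfolding sum_distrib_left by (intro sum.cong) (auto simp: e)
      also have "(\<Sum>i=j..<7. of_int (c i) * \<pi> ^ i) = \<pi> ^ j * u"
        unfolding u_def sum_distrib_left by (intro sum.cong) (auto simp flip: power_add)
      finally have pu: "poly q \<pi> = of_nat p * (\<Sum>i<j. of_int (e i) * \<pi> ^ i) + \<pi> ^ j * u" .
      obtain z where z: "z \<in> OK" "poly q \<pi> = of_nat p * z" using q(3) by blast
      define t where "t = z - (\<Sum>i<j. of_int (e i) * \<pi> ^ i)"
      have t: "t \<in> OK" "u * \<pi> ^ j = of_nat p * t"
        using z pu \<pi> by (auto simp: t_def algebra_simps)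
      have uOK: "u \<in> OK" using \<pi> by (simp add: u_def)
      have "{j..<7} = insert j {Suc j..<7}" using j7 by auto
      then have "u - of_int (c j) = (\<Sum>i=Suc j..<7. of_int (c i) * \<pi> ^ (i - j))" by (simp add: u_def)
      also have "\<dots> \<in> P"
      proof (intro P_sum P_mult)
        fix i assume "i \<in> {Suc j..<7}"
        then have "i - j = Suc (i - j - 1)" by auto
        then have "\<pi> ^ (i - j) = \<pi> ^ (i - j - 1) * \<pi>" using power_Suc2[of \<pi> "i - j - 1"] by simp
        then show "\<pi> ^ (i - j) \<in> P" using \<pi> by simp
      qed simp
      finally have "u - of_int (c j) \<in> P" .
      then have "u \<notin> P" using P_diff[of u "u - of_int (c j)"] j(1) P_of_int[of "c j"] by auto
      then obtain t' where t': "t' \<in> OK" "\<pi> ^ j = of_nat p * t'"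
        using cancel_unit_mod_p[OF _ uOK _ t(1) t(2)] \<pi> by auto
      have "t' \<noteq> 0" using t' \<pi>0 by auto
      then have "j * v \<pi> = 7 + v t'"
        using v_power[of \<pi> j] v_mult[of "of_nat p" t'] v_p t' \<pi> \<pi>0 p0 by simp
      then show False using v1 j7 by simp
    qed
    then show "\<exists>m\<in>\<int>. coeff q k = of_nat p * m" unfolding c by (auto elim!: dvdE)
  qed
  then show ?thesis using \<pi> by auto
qed

end
end

section \<open>The index of a cyclic septic field\<close>

lemma exists_independent_mod:
  assumes p: "prime p" and "p \<ge> 7 \<or> (\<forall>c n::int. poly f (of_int c) = of_int n \<longrightarrow> \<not> int p dvd n)"
  shows "\<exists>y\<in>OK. independent_mod p y"
proof -
  obtain P where P: "maximal_over p P" using maximal_over_exists[OF p] .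
  show ?thesis
  proof (cases "\<forall>k\<in>{1..<7}. \<exists>a\<in>OK. s k a \<in> P \<and> a \<notin> P")
    case True
    then obtain e where "e \<in> OK" "1 - e \<in> P" "\<And>k. 0 < k \<Longrightarrow> k < 7 \<Longrightarrow> s k e \<in> P"
      using split_idempotent[OF p P] by metis
    then show ?thesis
      using independent_mod_split[OF p P, of e] root_mod_split[OF p P, of e] assms(2) by blast
  next
    case False
    then have st: "\<And>a j. a \<in> P \<Longrightarrow> s j a \<in> P" using stable_if_not_split[OF p P] by blast
    show ?thesis
    proof (cases "\<exists>y\<in>OK. y - \<sigma> y \<notin> P")
      case True
      then show ?thesis using independent_mod_inert[OF p P st] by blast
    next
      case False
      then show ?thesis using independent_mod_ramified[OF p P st] by blast
    qed
  qed
qed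

text \<open>
  Elements \<open>y\<close> independent modulo \<open>p\<close> exist for every prime
  \<open>p\<close>, the small ones being handled by the absence of roots of \<open>f\<close>. So
  no prime divides all the indices.
\<close>

lemma field_index_eq_1:
  assumes "\<And>p c n. p \<in> {2, 3, 5} \<Longrightarrow> poly f (of_int c) = of_int n \<Longrightarrow> \<not> int p dvd n"
  shows "field_index K = 1"
proof (rule ccontr)
  assume "field_index K \<noteq> 1"
  then obtain p where p: "prime p" "p dvd field_index K" using prime_factor_nat by blast
  have "p \<ge> 7 \<or> p \<in> {2, 3, 5}"
  proof (rule ccontr)
    assume "\<not> ?thesis"
    then have "p \<in> {0, 1, 4, 6}" by auto
    then show False using p(1) by (auto simp: prime_nat_iff dest: spec[of _ 2])
  qed
  then obtain y where y: "y \<in> OK" "independent_mod p y"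
    using exists_independent_mod[OF p(1)] assms by blast
  have "rat_adjoin y = K" using rat_adjoin_eq_K y independent_mod_moved[OF p(1)] by blast
  then have "field_index K dvd index_of_element K y"
    unfolding field_index_def using y(1) by (intro Gcd_dvd) blast
  then show False using index_not_divisible[OF p(1) y] p(2) dvd_trans by blast
qed

section \<open>No power integral basis\<close>

lemma Nm_unit:
  assumes "x \<in> OK" "z \<in> OK" "x * z = 1" shows "Nm x = 1 \<or> Nm x = -1"
proof -
  obtain a b where ab: "Nm x = of_int a" "Nm z = of_int b" using Nm_in_Ints assms by (metis Ints_cases)
  have "Nm x * Nm z = 1" using Nm_mult[of x z] assms by (simp add: Nm_Ints)
  then have "(of_int (a * b) :: complex) = of_int 1" using ab by simp
  then have "a * b = 1" by (simp only: of_int_eq_iff)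
  then have "a = 1 \<or> a = -1" by (simp add: zmult_eq_1_iff) blast
  then show ?thesis using ab by auto
qed

context
  fixes \<beta> :: complex
  assumes OK_eq: "OK = int_adjoin \<beta>"
begin

lemma \<beta>_OK [simp]: "\<beta> \<in> OK"
  unfolding OK_eq int_adjoin_eq
  by (rule CollectI, rule exI[of _ "[:0, 1:]"]) (auto intro!: poly_over_intros[OF csubring_Ints_set])

lemma \<beta>_moved: "\<sigma> \<beta> \<noteq> \<beta>"
proof
  assume *: "\<sigma> \<beta> = \<beta>"
  obtain q where q: "\<theta> = poly q \<beta>" "poly_over \<int> q" using \<theta>_OK unfolding OK_eq int_adjoin_eq by blast
  have "s 1 \<theta> = poly q (s 1 \<beta>)" unfolding q(1) by (rule s_poly_Ints[OF q(2)]) simp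
  then show False using * q(1) \<theta>_moved by simp
qed

text \<open>
  Every integer is a polynomial in \<open>\<beta>\<close>, and \<open>a - b\<close> divides
  \<open>q(a) - q(b)\<close>.
\<close>

lemma s_cong_difference:
  assumes "x \<in> OK" shows "x - s k x \<in> (*) (\<beta> - s k \<beta>) ` OK"
proof -
  obtain q where q: "x = poly q \<beta>" "poly_over \<int> q" using assms unfolding OK_eq int_adjoin_eq by blast
  have "poly q \<beta> - poly q (s k \<beta>) \<in> (*) (\<beta> - s k \<beta>) ` OK"
    by (rule ideal_poly_cong[OF ideal_of_OK_principal poly_over_OK[OF q(2)]])
      (simp_all add: image_eqI[of _ _ 1])
  then show ?thesis using s_poly_Ints[OF q(2), of \<beta> k] q(1) by simp
qed

text \<open>
  The element \<open>\<beta> - \<sigma>\<^sup>k \<beta>\<close> is divisible by \<open>\<beta> -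
  \<sigma> \<beta>\<close>. Since \<open>\<sigma>\<close> is a power of
  \<open>\<sigma>\<^sup>k\<close>, the converse holds by the same argument.
\<close>

lemma differences_associated:
  assumes k: "0 < k" "k < 7"
  obtains e e' where "e \<in> OK" "e' \<in> OK" "e * e' = 1" "\<beta> - s k \<beta> = (\<beta> - \<sigma> \<beta>) * e"
proof -
  let ?J = "(*) (\<beta> - s k \<beta>) ` OK"
  have J: "ideal_of_OK ?J" by (rule ideal_of_OK_principal) simp
  have "\<beta> - s (k * m) \<beta> \<in> ?J" for m
  proof (induction m)
    case (Suc m)
    have "\<beta> - s (k * Suc m) \<beta> = (\<beta> - s (k * m) \<beta>) + (s (k * m) \<beta> - s k (s (k * m) \<beta>))"
      by (simp add: s_comp)
    also have "\<dots> \<in> ?J" by (intro ideal_add[OF J] Suc s_cong_difference) simp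
    finally show ?case .
  qed (simp add: ideal_zero[OF J])
  moreover obtain m where "(k * m) mod 7 = 1" using exists_inverse_mod_7[OF k] by blast
  ultimately have "\<beta> - s 1 \<beta> \<in> ?J" using s_cong[of \<beta> "k * m" 1] by (metis OK_K \<beta>_OK mod_less numeral_less_iff one_less_numeral_iff semiring_norm(77))
  then obtain e' where e': "e' \<in> OK" "\<beta> - \<sigma> \<beta> = (\<beta> - s k \<beta>) * e'" by auto
  let ?J1 = "(*) (\<beta> - \<sigma> \<beta>) ` OK"
  have J1: "ideal_of_OK ?J1" using OK_s[of \<beta> 1] by (intro ideal_of_OK_principal) simp
  have "s k \<beta> - \<beta> \<in> ?J1"
    using s_cong_difference[of _ 1] by (intro s_cong_ideal[OF J1]) auto
  then obtain e where e: "e \<in> OK" "s k \<beta> - \<beta> = (\<beta> - \<sigma> \<beta>) * e" by auto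
  then have eq: "\<beta> - s k \<beta> = (\<beta> - \<sigma> \<beta>) * (- e)" by (simp add: algebra_simps)
  have "(\<beta> - \<sigma> \<beta>) * (- e * e') = (\<beta> - \<sigma> \<beta>) * 1"
    unfolding mult.assoc[symmetric] eq[symmetric] e'(2)[symmetric] by simp
  then have "- e * e' = 1" using \<beta>_moved by (metis mult_cancel_left right_minus_eq)
  then show ?thesis using that[of "- e" e'] e(1) e'(1) eq by simp
qed

text \<open>
  Let \<open>J\<close> be the ideal generated by \<open>\<alpha> = \<beta> - \<sigma>
  \<beta>\<close>, modulo which \<open>\<sigma>\<close> acts trivially. Write
  \<open>\<sigma>\<^sup>j \<alpha> = \<alpha> w\<^sub>j\<close> with \<open>w\<^sub>j \<equiv>
  u\<^sup>j\<close>. Telescoping shows that \<open>w\<^sub>0 + \<dots> +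
  w\<^sub>k\<^sub>-\<^sub>1\<close> is a unit for \<open>0 < k < 7\<close> and zero for \<open>k
  = 7\<close>. Taking norms of these units turns them into the congruences that force
  \<open>2\<close>, and then \<open>1\<close>, into \<open>J\<close>.
\<close>

lemma differences_are_units:
  assumes k: "0 < k" "k < 7" shows "\<exists>w\<in>OK. (\<beta> - s k \<beta>) * w = 1"
proof -
  define \<alpha> where "\<alpha> = \<beta> - \<sigma> \<beta>"
  have \<alpha>: "\<alpha> \<in> OK" "\<alpha> \<noteq> 0" using OK_s[of \<beta> 1] \<beta>_moved by (auto simp: \<alpha>_def)
  define J where "J = (*) \<alpha> ` OK"
  have J: "ideal_of_OK J" unfolding J_def by (rule ideal_of_OK_principal[OF \<alpha>(1)])
  have triv: "y - \<sigma> y \<in> J" if "y \<in> OK" for y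
    using s_cong_difference[OF that, of 1] by (simp add: J_def \<alpha>_def)
  have Nm7: "Nm y - y ^ 7 \<in> J" if "y \<in> OK" for y using Nm_cong_power[OF J] triv that by blast
  have tr7: "tr y - 7 * y \<in> J" if "y \<in> OK" for y using tr_cong[OF J] triv that by blast
  have \<alpha>J: "\<alpha> \<in> J" unfolding J_def by (rule image_eqI[of _ _ 1]) auto
  have "\<sigma> \<alpha> \<in> J" using ideal_diff[OF J \<alpha>J triv[OF \<alpha>(1)]] by simp
  then obtain u where u: "u \<in> OK" "\<sigma> \<alpha> = \<alpha> * u" by (auto simp: J_def)
  have uj: "\<exists>w\<in>OK. s j \<alpha> = \<alpha> * w \<and> w - u ^ j \<in> J" for j
  proof (induction j)
    case 0
    then show ?case using ideal_zero[OF J] by (intro bexI[of _ 1]) auto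
  next
    case (Suc j)
    then obtain w where w: "w \<in> OK" "s j \<alpha> = \<alpha> * w" "w - u ^ j \<in> J" by blast
    have "s (Suc j) \<alpha> = s 1 (\<alpha> * w)" using w(2) by simp
    also have "\<dots> = \<alpha> * (u * \<sigma> w)" using w(1) \<alpha>(1) u(2) by (subst s_mult) auto
    finally have 1: "s (Suc j) \<alpha> = \<alpha> * (u * \<sigma> w)" .
    have "u * \<sigma> w - u ^ Suc j = u * ((w - u ^ j) - (w - \<sigma> w))" by (simp add: algebra_simps)
    also have "\<dots> \<in> J" by (intro ideal_mult[OF J] ideal_diff[OF J] w(3) triv w(1) u(1))
    finally show ?case using 1 u(1) w(1) OK_s[OF w(1), of 1] by (intro bexI[of _ "u * \<sigma> w"]) auto
  qed
  then obtain w where w: "\<And>j. w j \<in> OK" "\<And>j. s j \<alpha> = \<alpha> * w j" "\<And>j. w j - u ^ j \<in> J" by metis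
  have tel: "\<beta> - s k \<beta> = \<alpha> * (\<Sum>j<k. w j)" for k
  proof (induction k)
    case (Suc k)
    have "\<beta> - s (Suc k) \<beta> = (\<beta> - s k \<beta>) + s k \<alpha>"
      using OK_s[of \<beta> 1] by (simp add: \<alpha>_def s_diff funpow_swap1)
    then show ?case using Suc w(2) by (simp add: algebra_simps)
  qed simp
  have sum_cong: "(\<Sum>j<k. w j) - (\<Sum>j<k. u ^ j) \<in> J" for k
    using w(3) by (simp flip: sum_subtractf add: ideal_sum[OF J])
  have unit: "\<exists>c\<in>{1,-1}. (\<Sum>j<k. u ^ j) ^ 7 - c \<in> J" if k: "0 < k" "k < 7" for k
  proof -
    obtain e e' where e: "e \<in> OK" "e' \<in> OK" "e * e' = 1" "\<beta> - s k \<beta> = (\<beta> - \<sigma> \<beta>) * e"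
      using differences_associated[OF k] .
    then have "e = (\<Sum>j<k. w j)" using tel[of k] \<alpha>(2) by (simp add: \<alpha>_def)
    then have "e - (\<Sum>j<k. u ^ j) \<in> J" using sum_cong by simp
    then have "e ^ 7 - (\<Sum>j<k. u ^ j) ^ 7 \<in> J" using e(1) u(1) by (intro ideal_power_cong[OF J]) auto
    then have "- (Nm e - e ^ 7) - (e ^ 7 - (\<Sum>j<k. u ^ j) ^ 7) \<in> J"
      by (rule ideal_diff[OF J ideal_uminus[OF J Nm7[OF e(1)]]])
    then have "(\<Sum>j<k. u ^ j) ^ 7 - Nm e \<in> J" by simp
    then show ?thesis using Nm_unit[OF e(1-3)] by auto
  qed
  have "\<beta> - s 7 \<beta> = 0" using \<sigma>_order[of \<beta>] by simp
  then have "(\<Sum>j<7. w j) = 0" using tel[of 7] \<alpha>(2) by simp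
  then have phi: "(\<Sum>j<7. u ^ j) \<in> J" using sum_cong[of 7] ideal_uminus[OF J] by fastforce
  have sums: "(\<Sum>j<2. u ^ j) = 1 + u" "(\<Sum>j<3. u ^ j) = 1 + u + u^2"
    "(\<Sum>j<7. u ^ j) = 1 + u + u^2 + u^3 + u^4 + u^5 + u^6"
    by (simp_all add: eval_nat_numeral)
  have two: "2 \<in> J"
  proof -
    have "\<exists>c\<in>{1,-1}. (1 + u) ^ 7 - c \<in> J" by (rule unit[of 2, unfolded sums]) simp_all
    moreover have "\<exists>c\<in>{1,-1}. (1 + u + u^2) ^ 7 - c \<in> J" by (rule unit[of 3, unfolded sums]) simp_all
    ultimately obtain s1 s2 where s12: "s1 \<in> {1,-1}" "s2 \<in> {1,-1}"
      "(1 + u) ^ 7 - s1 \<in> J" "(1 + u + u^2) ^ 7 - s2 \<in> J" by blast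
    obtain A B C where ABC: "poly_over \<int> A" "poly_over \<int> B" "poly_over \<int> C"
      "poly A u * ((1 + u) ^ 7 - s1) + poly B u * ((1 + u + u^2) ^ 7 - s2)
        + poly C u * (1 + u + u^2 + u^3 + u^4 + u^5 + u^6) = 2"
      using cyclotomic_7_certificate[of s1 s2 u] s12(1,2) by blast
    have val: "poly q u \<in> OK" if "poly_over \<int> q" for q
      using poly_over_value[OF OK_subring poly_over_OK[OF that] u(1)] .
    show ?thesis unfolding ABC(4)[symmetric]
      by (intro ideal_add[OF J ideal_add[OF J ideal_mult[OF J s12(3)] ideal_mult[OF J s12(4)]]
            ideal_mult[OF J phi[unfolded sums]]] val ABC(1-3))
  qed
  have "1 \<in> J"
  proof -
    obtain T where T: "tr u = of_int T" using tr_Ints[OF u(1)] by (elim Ints_cases)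
    define r where "r = T mod 2"
    have r: "r = 0 \<or> r = 1" by (auto simp: r_def)
    have Tr: "T = 2 * (T div 2) + r" by (simp add: r_def)
    \<comment> \<open>Modulo \<open>2\<close> the trace \<open>T \<equiv> 7 u\<close> is congruent to
        \<open>u\<close>. Hence \<open>u\<close> is congruent to \<open>0\<close> or
        \<open>1\<close>, and \<open>1 + u + \<dots> + u\<^sup>6\<close> to \<open>1\<close>
        or \<open>7\<close>.\<close>
    have "u - of_int r = 2 * (of_int (T div 2) - 3 * u) - (tr u - 7 * u)"
      unfolding T by (subst (2) Tr) (simp add: algebra_simps)
    also have "\<dots> \<in> J"
      using u(1) csubring_of_nat[OF OK_subring, of 3]
      by (intro ideal_diff[OF J] tr7 u(1) ideal_mult_right[OF J two]) auto
    finally have "u - of_int r \<in> J" .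
    then have "u ^ j - of_int r ^ j \<in> J" for j using u(1) by (intro ideal_power_cong[OF J]) auto
    then have "(\<Sum>j<7. u ^ j - of_int r ^ j) \<in> J" by (intro ideal_sum[OF J])
    then have "(\<Sum>j<7. of_int r ^ j) \<in> J"
      using ideal_diff[OF J phi] by (fastforce simp: sum_subtractf)
    then have "1 \<in> J \<or> 7 \<in> J" using r by (auto simp: power_0_left sum.delta)
    moreover have "7 - 2 * 3 \<in> J" if "7 \<in> J"
      using csubring_of_nat[OF OK_subring, of 3] by (intro ideal_diff[OF J] that ideal_mult_right[OF J two]) auto
    ultimately show ?thesis by auto
  qed
  then obtain a where a: "a \<in> OK" "1 = \<alpha> * a" by (auto simp: J_def)
  obtain e e' where e: "e \<in> OK" "e' \<in> OK" "e * e' = 1" "\<beta> - s k \<beta> = (\<beta> - \<sigma> \<beta>) * e"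
    using differences_associated[OF k] .
  have "(\<beta> - s k \<beta>) * (a * e') = (\<alpha> * a) * (e * e')" unfolding e(4) \<alpha>_def by (simp add: mult_ac)
  then have "(\<beta> - s k \<beta>) * (a * e') = 1" using a(2) e(3) by simp
  then show ?thesis using a(1) e(2) by (intro bexI[of _ "a * e'"]) auto
qed

text \<open>
  The coefficients \<open>b\<^sub>j\<close> of the Lagrange polynomial that is \<open>1\<close>
  at \<open>\<beta>\<close> and \<open>0\<close> at its other conjugates are integers, because
  the differences of conjugates are units.
\<close>

lemma dual_basis:
  obtains b where "\<And>j. b j \<in> OK"
    "\<And>m i. m < 7 \<Longrightarrow> i < 7 \<Longrightarrow> (\<Sum>j<7. s m \<beta> ^ j * s i (b j)) = (if m = i then 1 else 0)"
proof -
  have "\<forall>k. \<exists>w. 0 < k \<longrightarrow> k < 7 \<longrightarrow> w \<in> OK \<and> (\<beta> - s k \<beta>) * w = 1"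
    using differences_are_units by blast
  then obtain w where w: "\<And>k. 0 < k \<Longrightarrow> k < 7 \<Longrightarrow> w k \<in> OK \<and> (\<beta> - s k \<beta>) * w k = 1" by metis
  define G where "G = (\<Prod>k=1..<7. smult (w k) [:- s k \<beta>, 1:])"
  have G: "poly_over OK G" unfolding G_def using w
    by (intro poly_over_prod[OF OK_subring] poly_over_smult[OF OK_subring] poly_over_intros[OF OK_subring]) auto
  have "degree G \<le> (\<Sum>k=1..<7. degree (smult (w k) [:- s k \<beta>, 1:]))"
    unfolding G_def using degree_prod_sum_le[of "{1..<7}" "\<lambda>k. smult (w k) [:- s k \<beta>, 1:]"] by (simp add: o_def)
  also have "\<dots> \<le> (\<Sum>k=1..<7::nat. 1)" by (intro sum_mono) (simp add: degree_smult_le[THEN order_trans])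
  finally have deg: "degree G < 7" by simp
  have "poly G \<beta> = (\<Prod>k=1..<7::nat. 1)"
    unfolding G_def poly_prod using w by (intro prod.cong) (auto simp: algebra_simps)
  then have G1: "poly G \<beta> = 1" by simp
  have G0: "poly G (s k \<beta>) = 0" if "0 < k" "k < 7" for k
    unfolding G_def poly_prod using that by (auto intro!: prod_zero bexI[of _ k])
  have "(\<Sum>j<7. s m \<beta> ^ j * s i (coeff G j)) = (if m = i then 1 else 0)" if mi: "m < 7" "i < 7" for m i
  proof -
    define n where "n = (m + 7 - i) mod 7"
    have n: "n < 7" "n = 0 \<longleftrightarrow> m = i" "(i + n) mod 7 = m"
      using mi by (auto simp: n_def mod_if split: if_splits)
    have co: "coeff G j \<in> OK" for j using G by (simp add: poly_over_def)
    have "(\<Sum>j<7. s m \<beta> ^ j * s i (coeff G j)) = (\<Sum>j<7. s i (s n \<beta> ^ j * coeff G j))"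
      using n(3) s_mod[of \<beta> "i + n"] co by (intro sum.cong) (simp_all add: s_mult s_power s_comp)
    also have "\<dots> = s i (\<Sum>j<7. s n \<beta> ^ j * coeff G j)" using co by (subst s_sum) auto
    also have "(\<Sum>j<7. s n \<beta> ^ j * coeff G j) = poly G (s n \<beta>)"
      unfolding poly_altdef using deg by (intro sum.mono_neutral_cong_right) (auto simp: coeff_eq_0 mult.commute)
    also have "s i \<dots> = (if m = i then 1 else 0)" using G1 G0[of n] n by auto
    finally show ?thesis .
  qed
  then show ?thesis using that[of "coeff G"] G by (auto simp: poly_over_def)
qed

text \<open>
  The matrix \<open>A\<close> of the conjugates of the powers of \<open>\<beta>\<close> has as
  inverse the matrix \<open>B\<close> of the conjugates of the dual basis. The determinant of
  \<open>B\<close> is an integer of the field, and \<open>\<sigma>\<close> permutes the columns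
  of \<open>B\<close>, so its square is a positive rational integer. The lattice of the integers
  in \<open>\<real>\<^sup>7\<close> therefore has covolume at most one and contains a short
  vector. Its norm would be less than one in absolute value by the inequality \<open>y \<le> exp
  (y - 1)\<close>.
\<close>

lemma no_real_power_basis:
  assumes real: "K \<subseteq> \<real>" shows False
proof -
  obtain b where b: "\<And>j. b j \<in> OK"
    "\<And>m i. m < 7 \<Longrightarrow> i < 7 \<Longrightarrow> (\<Sum>j<7. s m \<beta> ^ j * s i (b j)) = (if m = i then 1 else 0)"
    using dual_basis by metis
  obtain g :: "7 \<Rightarrow> nat" where g: "bij_betw g UNIV {..<7}"
    using ex_bij_betw_finite_nat[of "UNIV :: 7 set"] by (auto simp: atLeast0LessThan)
  have g7: "g i < 7" for i using g by (auto simp: bij_betw_def)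
  have g_inj: "g i = g j \<longleftrightarrow> i = j" for i j using g by (auto simp: bij_betw_def inj_def)
  have reindex: "(\<Sum>i\<in>UNIV. h (g i)) = (\<Sum>i<7. h i)" for h :: "nat \<Rightarrow> 'b::comm_monoid_add"
    by (rule sum.reindex_bij_betw[OF g])
  have Re: "of_real (Re x) = x" if "x \<in> OK" for x using real that by (intro of_real_Re) auto
  define A :: "real ^ 7 ^ 7" where "A = (\<chi> m j. Re (s (g m) \<beta> ^ g j))"
  define B :: "real ^ 7 ^ 7" where "B = (\<chi> j i. Re (s (g i) (b (g j))))"
  define Bc :: "complex ^ 7 ^ 7" where "Bc = (\<chi> j i. s (g i) (b (g j)))"
  have AB: "A ** B = mat 1"
  proof -
    have "(A ** B) $ m $ i = (mat 1 :: real ^ 7 ^ 7) $ m $ i" for m i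
    proof -
      have "of_real ((A ** B) $ m $ i) = (\<Sum>j\<in>UNIV. s (g m) \<beta> ^ g j * s (g i) (b (g j)))"
        using b(1) by (simp add: matrix_matrix_mult_def A_def B_def Re)
      also have "\<dots> = (\<Sum>j<7. s (g m) \<beta> ^ j * s (g i) (b j))"
        by (rule reindex[of "\<lambda>j. s (g m) \<beta> ^ j * s (g i) (b j)"])
      also have "\<dots> = of_real ((mat 1 :: real ^ 7 ^ 7) $ m $ i)"
        using b(2)[of "g m" "g i"] g7 by (simp add: g_inj mat_def)
      finally show ?thesis by (simp only: of_real_eq_iff)
    qed
    then show ?thesis by (simp add: vec_eq_iff)
  qed
  have det_Bc: "det Bc = of_real (det B)"
    using b(1) by (simp add: det_def Bc_def B_def Re)
  have Bc_OK: "det Bc \<in> OK"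
    unfolding det_def Bc_def using b(1) by (intro csubring_sum[OF OK_subring]) simp
  have "det A * det B = 1" using AB det_mul[of A B] by simp
  then have B0: "det B \<noteq> 0" by auto
  \<comment> \<open>The cyclic permutation of the seven indices that corresponds to an application of
      \<open>\<sigma>\<close>.\<close>
  define \<tau> where "\<tau> = (\<lambda>i. inv_into UNIV g ((g i + 1) mod 7))"
  have g_\<tau>: "g (\<tau> i) = (g i + 1) mod 7" for i
    unfolding \<tau>_def using g by (intro f_inv_into_f) (auto simp: bij_betw_def)
  have "inj \<tau>"
  proof (rule injI)
    fix i j assume "\<tau> i = \<tau> j"
    then have "(g i + 1) mod 7 = (g j + 1) mod 7" using g_\<tau> by metis
    then have "g i = g j" using g7[of i] g7[of j] by (auto simp: mod_if split: if_splits)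
    then show "i = j" by (simp add: g_inj)
  qed
  then have \<tau>: "\<tau> permutes UNIV"
    by (simp add: permutes_univ) (metis finite_UNIV_inj_surj finite injD surj_def)
  have shift: "s 1 (Bc $ i $ j) = Bc $ i $ \<tau> j" for i j
  proof -
    have "s 1 (s (g j) (b (g i))) = s (g (\<tau> j)) (b (g i))"
      unfolding s_comp g_\<tau> using b(1) by (intro s_cong) auto
    then show ?thesis by (simp add: Bc_def)
  qed
  have "s 1 (det Bc) = (\<Sum>p\<in>{p. p permutes UNIV}. of_int (sign p) * (\<Prod>i\<in>UNIV. s 1 (Bc $ i $ p i)))"
    unfolding det_def using b(1) by (subst s_sum) (simp_all add: Bc_def s_mult s_prod del: funpow.simps)
  also have "\<dots> = det (\<chi> i j. Bc $ i $ \<tau> j)" unfolding shift by (simp add: det_def)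
  also have "\<dots> = of_int (sign \<tau>) * det Bc" by (rule det_permute_columns[OF \<tau>])
  finally have "\<sigma> (det Bc) = of_int (sign \<tau>) * det Bc" by simp
  moreover have "of_int (sign \<tau>) * of_int (sign \<tau>) = (1::complex)" by (simp add: sign_def)
  ultimately have "\<sigma> (det Bc) * \<sigma> (det Bc) = det Bc * det Bc" by (metis mult.assoc mult.left_commute mult_1)
  then have "\<sigma> (det Bc * det Bc) = det Bc * det Bc" using \<sigma>_mult[of "det Bc" "det Bc"] Bc_OK by simp
  then have "det Bc * det Bc \<in> \<int>" using OK_Rats[OF _ \<sigma>_fixed, of "det Bc * det Bc"] Bc_OK by simp
  then obtain n where "det Bc * det Bc = of_int n" by (elim Ints_cases)
  then have "(of_real (det B * det B) :: complex) = of_real (of_int n)" by (simp add: det_Bc)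
  then have n: "det B * det B = of_int n" by (simp only: of_real_eq_iff)
  moreover have "det B * det B > 0" using B0 by (metis linorder_neqE_linordered_idom mult_neg_neg mult_pos_pos)
  ultimately have "n \<ge> 1" by simp
  then have "1 \<le> det B * det B" using n by simp
  then have "1 \<le> \<bar>det B\<bar>"
    using abs_square_le_1[of "det B"] abs_square_less_1[of "det B"] by (simp add: power2_eq_square not_less[symmetric])
  then obtain z where z: "z \<noteq> 0" "\<And>i. z $ i \<in> \<int>" "norm (A *v z) < 2"
    using short_lattice_vector[OF AB] unit_ball_vol_7 by auto
  define x where "x = (\<Sum>j\<in>UNIV. of_real (z $ j) * \<beta> ^ g j)"
  have zOK: "of_real (z $ j) \<in> OK" for j using z(2)[of j] by (auto elim!: Ints_cases)
  then have x: "x \<in> OK" by (simp add: x_def)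
  have zs: "s k (of_real (z $ j)) = of_real (z $ j)" for j k using z(2)[of j] by (auto elim!: Ints_cases)
  have Az: "of_real ((A *v z) $ m) = s (g m) x" for m
  proof -
    have "s (g m) x = (\<Sum>j\<in>UNIV. of_real (z $ j) * s (g m) \<beta> ^ g j)"
      unfolding x_def using zOK zs by (subst s_sum) (auto simp: s_mult s_power)
    then show ?thesis by (simp add: matrix_vector_mult_def A_def Re mult.commute)
  qed
  have x0: "x \<noteq> 0"
  proof
    assume "x = 0"
    then have "(A *v z) $ m = 0" for m using Az[of m] by simp
    then have "A *v z = 0" by (simp add: vec_eq_iff)
    moreover have "B ** A = mat 1" using AB matrix_left_right_inverse by blast
    ultimately have "z = 0" by (metis matrix_vector_mul_assoc matrix_vector_mul_lid matrix_vector_mult_0_right)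
    then show False using z(1) by simp
  qed
  have "(norm (A *v z))\<^sup>2 = (\<Sum>m\<in>UNIV. ((A *v z) $ m)\<^sup>2)"
    by (simp add: norm_vec_def L2_set_def sum_nonneg)
  also have "\<dots> = (\<Sum>m\<in>UNIV. (Re (s (g m) x))\<^sup>2)" by (simp flip: Az)
  also have "\<dots> = (\<Sum>i<7. (Re (s i x))\<^sup>2)" by (rule reindex)
  finally have "(\<Sum>i<7. (Re (s i x))\<^sup>2) < 2\<^sup>2" using z(3) by (metis norm_ge_zero pos2 power_strict_mono)
  then have sum: "(\<Sum>i<7. (Re (s i x))\<^sup>2) < 4" by simp
  obtain N where N: "Nm x = of_int N" using Nm_in_Ints[OF x] by (elim Ints_cases)
  have "Nm x = of_real (\<Prod>i<7. Re (s i x))" unfolding Nm_def using x by (simp add: Re)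
  then have "of_int N = (\<Prod>i<7. Re (s i x))" using N by (metis of_real_eq_iff of_real_of_int_eq)
  then have prod: "(\<Prod>i<7. (Re (s i x))\<^sup>2) = (of_int N)\<^sup>2" by (simp add: prod_power_distrib)
  have "N \<noteq> 0" using N Nm_eq_0[of x] x x0 by auto
  then have "N\<^sup>2 \<ge> 1" by (simp add: int_one_le_iff_zero_less)
  then have "(of_int N)\<^sup>2 \<ge> (1::real)" by (metis of_int_1_le_iff of_int_power)
  then have "1 \<le> (\<Prod>i<7. (Re (s i x))\<^sup>2)" using prod by simp
  also have "\<dots> \<le> (\<Prod>i<7. exp ((Re (s i x))\<^sup>2 - 1))"
    using exp_ge_add_one_self[of "(Re (s _ x))\<^sup>2 - 1"] by (intro prod_mono) auto
  also have "\<dots> = exp (\<Sum>i<7. (Re (s i x))\<^sup>2 - 1)" by (rule exp_sum[symmetric]) simp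
  also have "\<dots> = exp ((\<Sum>i<7. (Re (s i x))\<^sup>2) - 7)" by (simp add: sum_subtractf)
  also have "\<dots> < 1" using sum by simp
  finally show False by simp
qed

end

lemma not_monogenic: "K \<subseteq> \<real> \<Longrightarrow> \<not> monogenic K"
  using no_real_power_basis unfolding monogenic_def by blast

end

section \<open>The conjugation of the generic Hashimoto--Hoshi polynomial\<close>

text \<open>
  The family of Hashimoto--Hoshi polynomials as one polynomial in two variables: the
  coefficients are polynomials in \<open>t\<close>.
\<close>

definition hh_generic :: "int poly poly" where
  "hh_generic = [:[:0, 0, 0, 0, 0, 0, 0, 1:], [:0, 0, 0, 0, -4, 0, -8, -4, -1:], [:0, 0, -8, 8, 2, 14, 19, 7, 2:],
    [:0, 16, 20, -2, 6, -24, -12, -5, -1:], [:-8, -36, -22, -15, -5, 9, 1, 1:], [:12, 24, 9, 9:],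
    [:-6, -5, -1, -1:], [:1:]:]"

text \<open>
  Each of the six nontrivial automorphisms sends a root \<open>x\<close> to a quotient of two
  polynomials in \<open>x\<close> of degree at most three. For the automorphism chosen here it
  is \<open>conj_num / conj_den\<close>, whose coefficients are comparatively small polynomials
  in \<open>t\<close>.
\<close>

definition conj_num :: "int poly poly" where
  "conj_num = [:0, [:0, 2, 2, 1, 1:], [:0, -3, -1, -1:], [:0, 1:]:]"

definition conj_den :: "int poly poly" where
  "conj_den = [:[:0, 0, -1:], [:0, 4, 2, 1:], [:-2, -5, -1, -1:], [:1, 1:]:]"

text \<open>
  The value of \<open>hh_generic\<close> at \<open>conj_num / conj_den\<close>, multiplied by
  the seventh power of \<open>conj_den\<close> and arranged as in Horner's scheme.
\<close>

definition conjugate_numerator :: "int poly poly" where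
  "conjugate_numerator =
    ((((((conj_num + smult [:-6, -5, -1, -1:] conj_den) * conj_num
     + smult [:12, 24, 9, 9:] (conj_den * conj_den)) * conj_num
     + smult [:-8, -36, -22, -15, -5, 9, 1, 1:] (conj_den * conj_den * conj_den)) * conj_num
     + smult [:0, 16, 20, -2, 6, -24, -12, -5, -1:] (conj_den * conj_den * conj_den * conj_den)) * conj_num
     + smult [:0, 0, -8, 8, 2, 14, 19, 7, 2:] (conj_den * conj_den * conj_den * conj_den * conj_den)) * conj_num
     + smult [:0, 0, 0, 0, -4, 0, -8, -4, -1:] (conj_den * conj_den * conj_den * conj_den * conj_den * conj_den)) * conj_num
     + smult [:0, 0, 0, 0, 0, 0, 0, 1:] (conj_den * conj_den * conj_den * conj_den * conj_den * conj_den * conj_den)"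

text \<open>
  Division of polynomials in the outer variable gives the cofactor explicitly.
\<close>

lemma hh_generic_dvd_conjugate_numerator: "hh_generic dvd conjugate_numerator"
proof -
  define cofactor :: "int poly poly" where "cofactor =
    [:[:0, 0, 0, 0, 0, 0, 0, 0, 0, 0, 0, 0, 0, 0, -1:], [:0, 0, 0, 0, 0, 0, 0, 0, 0, 0, -8, -12, -20,
    -8, -8, -8, -5, -1:], [:0, 0, 0, 0, 0, 0, 0, 0, -16, 32, 76, 154, 132, 74, 69, 35, 9, -10, -6,
    -2:], [:0, 0, 0, 0, 0, 0, 0, 112, 112, -4, -178, -310, 33, 77, 186, 189, 214, 129, 56, 10, 0,
    -1:], [:0, 0, 0, 0, 0, 0, -288, -864, -1032, -1372, -1043, -1938, -2339, -2300, -1960, -1456,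
    -919, -359, -77, 32, 26, 11, 2:], [:0, 0, 0, 0, 0, 320, 1856, 3320, 5164, 6099, 7013, 8824,
    7718, 6604, 4014, 2349, 423, -292, -583, -356, -186, -53, -14, -1:], [:0, 0, 0, 0, -128, -1664,
    -4720, -7528, -11265, -11270, -13932, -11462, -8357, -3192, 502, 3342, 4196, 3640, 2353, 1211,
    479, 154, 33, 6:], [:0, 0, 0, 0, 512, 3232, 5888, 9403, 10192, 8719, 7288, -789, -5806, -12747,
    -13914, -14473, -10901, -7552, -3937, -1885, -660, -219, -47, -10, -1:], [:0, 0, 0, 0, -832,
    -2976, -3698, -5656, -1070, 613, 9283, 15374, 21660, 23181, 21917, 17390, 11891, 6799, 3330,
    1332, 468, 122, 32, 4, 1:], [:0, 0, 0, 0, 704, 1236, 932, 456, -4789, -6276, -15281, -16004,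
    -20749, -17273, -15806, -10059, -6599, -2973, -1406, -410, -144, -21, -6:], [:0, 0, 0, 0, -328,
    -48, 128, 1412, 3774, 5060, 9098, 8075, 9929, 6880, 6089, 3071, 1913, 622, 277, 45, 15:], [:0,
    0, 0, 0, 80, -140, -126, -847, -1304, -2006, -2777, -2295, -2622, -1537, -1279, -478, -273, -50,
    -20:], [:0, 0, 0, 0, -8, 44, 26, 212, 237, 431, 452, 366, 386, 182, 138, 30, 15:], [:0, 0, 0, 0,
    0, -4, -2, -24, -23, -47, -36, -30, -30, -9, -6:], [:0, 0, 0, 0, 0, 0, 0, 1, 1, 2, 1, 1, 1:]:]"
  have "conjugate_numerator = hh_generic * cofactor"
    unfolding conjugate_numerator_def hh_generic_def conj_num_def conj_den_def cofactor_def by simp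
  then show ?thesis by (rule dvdI)
qed
definition bieval :: "int \<Rightarrow> complex \<Rightarrow> int poly poly \<Rightarrow> complex" where
  "bieval t x P = poly (map_poly (\<lambda>q. of_int (poly q t)) P) x"

lemma bieval_add: "bieval t x (P + Q) = bieval t x P + bieval t x Q"
proof -
  have "map_poly (\<lambda>q. of_int (poly q t)) (P + Q) = map_poly (\<lambda>q. of_int (poly q t)) P + map_poly (\<lambda>q. of_int (poly q t) :: complex) Q"
    by (rule poly_eqI) (simp add: coeff_map_poly)
  then show ?thesis by (simp add: bieval_def)
qed

lemma bieval_mult: "bieval t x (P * Q) = bieval t x P * bieval t x Q"
proof -
  have "map_poly (\<lambda>q. of_int (poly q t)) (P * Q) = map_poly (\<lambda>q. of_int (poly q t)) P * map_poly (\<lambda>q. of_int (poly q t) :: complex) Q"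
    by (rule poly_eqI) (simp add: coeff_map_poly coeff_mult poly_sum)
  then show ?thesis by (simp add: bieval_def)
qed

lemma bieval_smult: "bieval t x (smult c P) = of_int (poly c t) * bieval t x P"
proof -
  have "map_poly (\<lambda>q. of_int (poly q t)) (smult c P) = smult (of_int (poly c t)) (map_poly (\<lambda>q. of_int (poly q t) :: complex) P)"
    by (rule poly_eqI) (simp add: coeff_map_poly)
  then show ?thesis by (simp add: bieval_def)
qed

lemma hh_generic_specialise: "map_poly (\<lambda>q. poly q t) hh_generic = hashimoto_hoshi_poly t"
  by (simp add: hh_generic_def hashimoto_hoshi_poly_def map_poly_pCons) (simp add: algebra_simps eval_nat_numeral)

lemma bieval_hh_generic: "bieval t x hh_generic = poly (map_poly of_int (hashimoto_hoshi_poly t)) x"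
proof -
  have "map_poly (\<lambda>q. of_int (poly q t) :: complex) hh_generic = map_poly of_int (map_poly (\<lambda>q. poly q t) hh_generic)"
    by (rule poly_eqI) (simp add: coeff_map_poly)
  then show ?thesis by (simp add: bieval_def hh_generic_specialise)
qed

lemma conjugate_root:
  assumes root: "bieval t x hh_generic = 0" and den: "bieval t x conj_den \<noteq> 0"
  shows "bieval t (bieval t x conj_num / bieval t x conj_den) hh_generic = 0"
proof -
  define b y where "b = bieval t x conj_den" and "y = bieval t x conj_num / b"
  have a: "bieval t x conj_num = y * b" using den by (simp add: y_def b_def)
  obtain q where q: "conjugate_numerator = hh_generic * q"
    using hh_generic_dvd_conjugate_numerator by (elim dvdE)
  define c where "c k = (of_int (poly (coeff hh_generic k) t) :: complex)" for k
  have c: "of_int (poly [:-6, -5, -1, -1:] t) = c 6" "of_int (poly [:12, 24, 9, 9:] t) = c 5"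
    "of_int (poly [:-8, -36, -22, -15, -5, 9, 1, 1:] t) = c 4"
    "of_int (poly [:0, 16, 20, -2, 6, -24, -12, -5, -1:] t) = c 3"
    "of_int (poly [:0, 0, -8, 8, 2, 14, 19, 7, 2:] t) = c 2"
    "of_int (poly [:0, 0, 0, 0, -4, 0, -8, -4, -1:] t) = c 1"
    "of_int (poly [:0, 0, 0, 0, 0, 0, 0, 1:] t) = c 0"
    unfolding c_def hh_generic_def by (simp_all add: eval_nat_numeral)
  have "bieval t x (hh_generic * q) = 0" using root by (simp add: bieval_mult)
  then have *: "((((((y * b + c 6 * b) * (y * b) + c 5 * (b * b)) * (y * b) + c 4 * (b * b * b)) * (y * b)
      + c 3 * (b * b * b * b)) * (y * b) + c 2 * (b * b * b * b * b)) * (y * b)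
      + c 1 * (b * b * b * b * b * b)) * (y * b) + c 0 * (b * b * b * b * b * b * b) = 0"
    unfolding q[symmetric] conjugate_numerator_def bieval_add bieval_mult bieval_smult c a b_def[symmetric] .
  have "bieval t y hh_generic = c 0 + y * (c 1 + y * (c 2 + y * (c 3 + y * (c 4 + y * (c 5 + y * (c 6 + y))))))"
    unfolding bieval_def c[symmetric] hh_generic_def by (simp add: map_poly_pCons)
  then have "b ^ 7 * bieval t y hh_generic = 0"
    using * by (simp add: algebra_simps eval_nat_numeral)
  then show ?thesis using den by (simp add: y_def b_def)
qed

section \<open>Orbit lengths and irreducibility\<close>

text \<open>
  The orbits partition \<open>R\<close> into sets with \<open>r\<close> elements each.
\<close>

lemma orbit_length_dvd_card:
  assumes fin: "finite R" and maps: "\<And>z. z \<in> R \<Longrightarrow> \<tau> z \<in> R" and r: "r > 0"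
    and per: "\<And>z. z \<in> R \<Longrightarrow> (\<tau> ^^ r) z = z"
    and free: "\<And>z i. z \<in> R \<Longrightarrow> 0 < i \<Longrightarrow> i < r \<Longrightarrow> (\<tau> ^^ i) z \<noteq> z"
  shows "r dvd card R"
proof -
  define orb where "orb z = (\<lambda>i. (\<tau> ^^ i) z) ` {..<r}" for z
  have maps': "(\<tau> ^^ i) z \<in> R" if "z \<in> R" for i z using that maps by (induction i) auto
  have per': "(\<tau> ^^ (i mod r)) z = (\<tau> ^^ i) z" if "z \<in> R" for i z
  proof -
    have *: "(\<tau> ^^ (r * m)) z = z" for m
      by (induction m) (simp_all add: funpow_add per[OF that])
    have "(\<tau> ^^ (i mod r + r * (i div r))) z = (\<tau> ^^ (i mod r)) z" unfolding funpow_add by (simp add: *)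
    then show ?thesis by simp
  qed
  have inj: "inj_on (\<lambda>i. (\<tau> ^^ i) z) {..<r}" if z: "z \<in> R" for z
  proof (rule linorder_inj_onI)
    fix i j assume ij: "i < j" "i \<in> {..<r}" "j \<in> {..<r}"
    show "(\<tau> ^^ i) z \<noteq> (\<tau> ^^ j) z"
    proof
      assume "(\<tau> ^^ i) z = (\<tau> ^^ j) z"
      moreover have "(\<tau> ^^ (j - i)) ((\<tau> ^^ i) z) = (\<tau> ^^ (j - i + i)) z" by (simp add: funpow_add)
      ultimately have "(\<tau> ^^ (j - i)) ((\<tau> ^^ i) z) = (\<tau> ^^ i) z" using ij by simp
      then show False using free[OF maps'[OF z], of "j - i" i] ij less_imp_diff_less[of j r i] by simp
    qed
  qed auto
  have orb_eq: "orb w = orb z" if z: "z \<in> R" and w: "w \<in> orb z" for z w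
  proof -
    have *: "orb ((\<tau> ^^ i) z) \<subseteq> orb z" if "z \<in> R" for i z
    proof
      fix v assume "v \<in> orb ((\<tau> ^^ i) z)"
      then obtain j where "v = (\<tau> ^^ (j + i)) z" by (auto simp: orb_def funpow_add)
      then have "v = (\<tau> ^^ ((j + i) mod r)) z" using per'[OF that] by simp
      then show "v \<in> orb z" using r by (auto simp: orb_def)
    qed
    obtain i where i: "i < r" "w = (\<tau> ^^ i) z" using w by (auto simp: orb_def)
    have "(\<tau> ^^ (r - i)) w = (\<tau> ^^ (r - i + i)) z" by (simp only: i(2) funpow_add o_apply)
    then have "(\<tau> ^^ (r - i)) w = z" using i per[OF z] by simp
    then show ?thesis using *[OF z, of i] *[of w "r - i"] maps'[OF z, of i] i by auto
  qed
  have self: "z \<in> orb z" for z using r by (force simp: orb_def)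
  have "r * card (orb ` R) = card (\<Union>(orb ` R))"
  proof (rule card_partition)
    show "finite (\<Union>(orb ` R))" using fin by (auto simp: orb_def)
    show "card c = r" if "c \<in> orb ` R" for c using that inj by (auto simp: orb_def card_image)
    show "c1 \<inter> c2 = {}" if c: "c1 \<in> orb ` R" "c2 \<in> orb ` R" "c1 \<noteq> c2" for c1 c2
    proof (rule ccontr)
      assume "c1 \<inter> c2 \<noteq> {}"
      then obtain w where "w \<in> c1" "w \<in> c2" by blast
      then have "c1 = orb w" "c2 = orb w" using orb_eq c by auto
      then show False using c(3) by simp
    qed
  qed (use fin in simp)
  moreover have "\<Union>(orb ` R) = R" using self maps' by (auto simp: orb_def)
  ultimately show ?thesis by (metis dvd_triv_left)
qed

lemma map_poly_of_int_mult:
  "(map_poly of_int (p * q) :: 'a::comm_ring_1 poly) = map_poly of_int p * map_poly of_int q"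
  by (rule poly_eqI) (simp add: coeff_map_poly coeff_mult)

lemma map_poly_of_int_add:
  "(map_poly of_int (p + q) :: 'a::comm_ring_1 poly) = map_poly of_int p + map_poly of_int q"
  by (rule poly_eqI) (simp add: coeff_map_poly)

text \<open>
  A factor has no root in the field with two elements, which leaves the unit and three
  polynomials of degree two or three. Division by each of these has a nonzero remainder.
\<close>

lemma no_small_factor_mod_2:
  fixes a b :: "bit poly"
  assumes ab: "a * b = [:1,1,0,0,1,0,1,1:]" and deg: "degree a \<le> 3"
  shows "degree a = 0"
proof -
  define a0 a1 a2 a3 where "a0 = coeff a 0" "a1 = coeff a 1" "a2 = coeff a 2" "a3 = coeff a 3"
  have a: "a = [:a0, a1, a2, a3:]"
  proof (rule poly_eqI)
    fix n
    show "coeff a n = coeff [:a0, a1, a2, a3:] n"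
    proof (cases "n \<le> 3")
      case True
      then have "n = 0 \<or> n = 1 \<or> n = 2 \<or> n = 3" by auto
      then show ?thesis by (auto simp: a0_a1_a2_a3_def eval_nat_numeral)
    next
      case False
      then have "coeff a n = 0" "coeff [:a0, a1, a2, a3:] n = 0" using deg by (auto simp: coeff_eq_0 intro!: coeff_eq_0)
      then show ?thesis by simp
    qed
  qed
  have "poly a 0 * poly b 0 = poly [:1,1,0,0,1,0,1,1:] 0" unfolding ab[symmetric] by simp
  then have "a0 = 1" using a by (cases a0) auto
  have "poly a 1 * poly b 1 = poly [:1,1,0,0,1,0,1,1:] 1" unfolding ab[symmetric] by simp
  then have "a0 + a1 + a2 + a3 \<noteq> 0" using a by (auto simp: add.assoc)
  then have "a \<in> {[:1:], [:1,1,1:], [:1,1,0,1:], [:1,0,1,1:]}"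
    using \<open>a0 = 1\<close> a by (cases a1; cases a2; cases a3) auto
  moreover have no: False if "a * c + r = [:1,1,0,0,1,0,1,1:]" "r \<noteq> 0" "degree r < degree a" for c r
  proof -
    have "r = a * (b - c)" using that(1) ab by (simp add: algebra_simps)
    then have "a dvd r" by simp
    then show False using dvd_imp_degree_le[OF _ that(2)] that(3) by fastforce
  qed
  ultimately show ?thesis
    using no[of "[:1,1,0,1,0,1:]" "[:0,1:]"] no[of "[:0,1,1,1,1:]" "[:1:]"] no[of "[:0,0,0,0,1:]" "[:1,1:]"]
    by auto
qed

lemma irreducible_mod_2:
  fixes a b :: "bit poly"
  assumes "a * b = [:1,1,0,0,1,0,1,1:]" shows "degree a = 0 \<or> degree b = 0"
proof -
  have "a \<noteq> 0" "b \<noteq> 0" using assms by auto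
  then have "degree a + degree b = degree [:1,1,0,0,1,0,1,1::bit:]" using assms degree_mult_eq[of a b] by simp
  then have "degree a \<le> 3 \<or> degree b \<le> 3" by auto
  then show ?thesis using no_small_factor_mod_2[of a b] no_small_factor_mod_2[of b a] assms
    by (auto simp: mult.commute)
qed

text \<open>
  Gauss's lemma: a primitive integer polynomial of least degree that vanishes at
  \<open>z\<close> divides the monic polynomial \<open>f\<close> over the integers, and its
  degree survives the reduction modulo \<open>2\<close>, where \<open>f\<close> is irreducible.
\<close>

lemma integer_annihilator_degree:
  fixes f m :: "int poly" and z :: complex
  assumes f: "lead_coeff f = 1" "map_poly of_int f = ([:1,1,0,0,1,0,1,1:] :: bit poly)"
    and fz: "poly (map_poly of_int f) z = 0"
    and mz: "poly (map_poly of_int m) z = 0" and m0: "m \<noteq> 0"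
  shows "degree f \<le> degree m"
proof -
  define good where "good m \<longleftrightarrow> m \<noteq> 0 \<and> poly (map_poly of_int m) z = 0" for m :: "int poly"
  have "good m" using mz m0 by (simp add: good_def)
  then obtain g where g: "good g" "\<And>g'. good g' \<Longrightarrow> degree g \<le> degree g'"
    using ex_has_least_nat[of good m degree] by blast
  have g0: "g \<noteq> 0" using g(1) by (simp add: good_def)
  define h where "h = primitive_part g"
  have gh: "g = smult (Polynomial.content g) h" by (simp add: h_def)
  have ev: "poly (map_poly of_int (smult c q)) z = of_int c * poly (map_poly of_int q) z" for c and q :: "int poly"
  proof -
    have "map_poly of_int (smult c q) = smult (of_int c) (map_poly of_int q :: complex poly)"
      by (rule poly_eqI) (simp add: coeff_map_poly)
    then show ?thesis by simp
  qed
  have "Polynomial.content g \<noteq> 0" using g0 by simp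
  then have h: "poly (map_poly of_int h) z = 0" using g(1) ev[of "Polynomial.content g" h] gh by (simp add: good_def)
  have h0: "h \<noteq> 0" using g0 by (simp add: h_def)
  have dh: "degree h = degree g" by (simp add: h_def)
  obtain q r where qr: "pseudo_divmod f h = (q, r)" by (cases "pseudo_divmod f h")
  define c where "c = lead_coeff h ^ (Suc (degree f) - degree h)"
  have c0: "c \<noteq> 0" using h0 by (simp add: c_def)
  have div: "smult c f = h * q + r" "r = 0 \<or> degree r < degree h"
    using pseudo_divmod[OF h0 qr] by (simp_all add: c_def)
  have "poly (map_poly of_int (smult c f)) z = poly (map_poly of_int r) z"
    unfolding div(1) by (simp add: map_poly_of_int_add map_poly_of_int_mult h)
  then have "poly (map_poly of_int r) z = 0" using ev[of c f] fz by simp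
  then have "r = 0" using g(2)[of r] div(2) dh unfolding good_def by (metis not_less)
  then have cf: "smult c f = h * q" using div(1) by simp
  have "Polynomial.content f dvd 1" using content_dvd_coeff[of f "degree f"] f(1) by simp
  then have cont_f: "Polynomial.content f = 1" by (metis is_unit_normalize normalize_content)
  have cont_h: "Polynomial.content h = 1" using g0 by (simp add: h_def)
  have "Polynomial.content (smult c f) = Polynomial.content (h * q)" using cf by simp
  then have cq: "Polynomial.content q = \<bar>c\<bar>" using cont_f cont_h by (simp add: content_mult)
  then have absc: "smult c f = smult \<bar>c\<bar> (h * primitive_part q)"
    using cf by (metis content_times_primitive_part mult_smult_right)
  then have "\<exists>k. f = h * k"
  proof (cases "c > 0")
    case True
    then have "smult c f = smult c (h * primitive_part q)" using absc by simp
    then show ?thesis using c0 by (metis smult_cancel)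
  next
    case False
    then have "smult c f = smult c (- (h * primitive_part q))" using absc by simp
    then have "f = h * (- primitive_part q)" using c0 by (metis mult_minus_right smult_cancel)
    then show ?thesis by blast
  qed
  then obtain k where k: "f = h * k" by blast
  have lc: "lead_coeff h * lead_coeff k = 1" using f(1) k by (simp add: lead_coeff_mult)
  have bit: "degree (map_poly of_int w :: bit poly) = degree w" if "lead_coeff w dvd 1" for w :: "int poly"
  proof -
    have "\<bar>lead_coeff w\<bar> = 1" using that by simp
    then have "lead_coeff w = 1 \<or> lead_coeff w = -1" by linarith
    then have "(of_int (lead_coeff w) :: bit) \<noteq> 0" by auto
    then show ?thesis by (intro antisym map_poly_degree_leq le_degree) (simp add: coeff_map_poly)
  qed
  have "lead_coeff h dvd 1" "lead_coeff k dvd 1" using lc by (metis dvd_triv_left, metis dvd_triv_right)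
  moreover have "(map_poly of_int h :: bit poly) * map_poly of_int k = [:1,1,0,0,1,0,1,1:]"
    using f(2) k by (simp add: map_poly_of_int_mult)
  ultimately have "degree h = 0 \<or> degree k = 0" using irreducible_mod_2 bit by metis
  moreover have "degree h \<noteq> 0"
  proof
    assume "degree h = 0"
    then obtain w where w: "h = [:w:]" by (auto elim: degree_eq_zeroE)
    then have "of_int w = (0::complex)" using h by (simp add: map_poly_pCons)
    then show False using w h0 by simp
  qed
  moreover have "k \<noteq> 0" using lc by auto
  ultimately have "degree f = degree h" using k h0 by (simp add: degree_mult_eq)
  then show ?thesis using g(2)[of m] \<open>good m\<close> dh by simp
qed

section \<open>The Hashimoto--Hoshi field\<close>

locale hashimoto_hoshi =
  fixes t :: int
  assumes t_odd: "odd t"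
begin

definition F :: "complex poly" where "F = map_poly of_int (hashimoto_hoshi_poly t)"

lemma hh_monic: "lead_coeff (hashimoto_hoshi_poly t) = 1" and hh_degree: "degree (hashimoto_hoshi_poly t) = 7"
  by (simp_all add: hashimoto_hoshi_poly_def)

lemma hh_mod_2: "map_poly of_int (hashimoto_hoshi_poly t) = ([:1,1,0,0,1,0,1,1:] :: bit poly)"
proof -
  have t: "(of_int t :: bit) = 1" using t_odd by (auto elim!: oddE)
  show ?thesis
    unfolding hashimoto_hoshi_poly_def by (simp add: map_poly_pCons t)
qed

lemma F_over: "poly_over \<int> F" by (simp add: F_def poly_over_def coeff_map_poly)
lemma F_degree: "degree F = 7" unfolding F_def by (subst degree_map_poly) (simp_all add: hh_degree)
lemma F_monic: "lead_coeff F = 1"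
  using hh_monic by (simp add: F_degree hh_degree) (simp add: F_def coeff_map_poly)
lemma F_over_Rats: "poly_over \<rat> F" using poly_over_mono[OF F_over Ints_subset_Rats] .

lemma zero_if_vanishing:
  assumes z: "poly F z = 0" and h: "poly_over \<rat> h" "degree h < 7" "poly h z = 0" shows "h = 0"
proof (rule ccontr)
  assume h0: "h \<noteq> 0"
  obtain D :: int where D: "D > 0" "poly_over \<int> (smult (of_int D) h)" using clear_denominators[OF h(1)] .
  define m where "m = map_poly (\<lambda>x. \<lfloor>Re x\<rfloor>) (smult (of_int D) h)"
  have m: "smult (of_int D) h = map_poly of_int m"
  proof (rule poly_eqI)
    fix n
    have "coeff (smult (of_int D) h) n \<in> \<int>" using D(2) unfolding poly_over_def by blast
    then obtain k where "coeff (smult (of_int D) h) n = of_int k" by (elim Ints_cases)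
    then show "coeff (smult (of_int D) h) n = coeff (map_poly of_int m) n"
      unfolding m_def by (simp add: coeff_map_poly)
  qed
  have "m \<noteq> 0" using m h0 D(1) by auto
  moreover have "poly (map_poly of_int m) z = 0" using h(3) by (simp flip: m)
  ultimately have "7 \<le> degree m"
    using integer_annihilator_degree[OF hh_monic hh_mod_2, of z m] z by (simp add: F_def hh_degree)
  moreover have "degree m = degree (smult (of_int D) h)" unfolding m by (simp add: degree_map_poly)
  ultimately show False using h(2) D(1) by simp
qed

lemma vanishes_at_all_roots:
  assumes z: "poly F z = 0" and h: "poly_over \<rat> h" "poly h z = 0" and w: "poly F w = 0" shows "poly h w = 0"
proof -
  obtain q r where r: "h = q * F + r" "poly_over \<rat> r" "r = 0 \<or> degree r < degree F"
    using poly_over_divide_monic[OF csubring_Rats_set F_over_Rats F_monic h(1)] by blast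
  have "r = 0" using zero_if_vanishing[OF z r(2)] r h(2) z F_degree by auto
  then show ?thesis using r(1) w by simp
qed

text \<open>
  The Euclidean algorithm for \<open>F\<close> and \<open>h\<close>, carried out on values at
  \<open>z\<close>.
\<close>

lemma inverse_value:
  assumes z: "poly F z = 0" and h: "poly_over \<rat> h" "h \<noteq> 0" "degree h < 7"
  shows "\<exists>g. poly_over \<rat> g \<and> poly g z * poly h z = 1"
  using h
proof (induction "degree h" arbitrary: h rule: less_induct)
  case less
  let ?l = "lead_coeff h"
  have l: "?l \<in> \<rat>" "?l \<noteq> 0" using less.prems by (auto simp: poly_over_def)
  show ?case
  proof (cases "degree h = 0")
    case True
    then have "h = [:?l:]" by (metis degree_eq_zeroE coeff_pCons_0 degree_pCons_0)
    then have "poly h z = ?l" by (metis poly_const_conv poly_pCons mult_zero_right add_0_right poly_0)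
    then show ?thesis using l
      by (intro exI[of _ "[:1 / ?l:]"]) (auto intro!: poly_over_pCons[OF csubring_Rats_set] poly_over_0[OF csubring_Rats_set])
  next
    case False
    define h' where "h' = smult (1 / ?l) h"
    have h': "poly_over \<rat> h'" "lead_coeff h' = 1" "degree h' = degree h"
      using less.prems l by (auto simp: h'_def intro!: poly_over_smult[OF csubring_Rats_set])
    obtain q r where r: "F = q * h' + r" "poly_over \<rat> q" "poly_over \<rat> r" "r = 0 \<or> degree r < degree h'"
      using poly_over_divide_monic[OF csubring_Rats_set h'(1,2) F_over_Rats] by blast
    have "r \<noteq> 0"
    proof
      assume "r = 0"
      then have F: "F = q * h'" using r(1) by simp
      then have "q \<noteq> 0" using F_degree by auto
      moreover have "h' \<noteq> 0" using h'(2) by auto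
      ultimately have "degree q + degree h' = 7" using F F_degree by (metis degree_mult_eq)
      then have "degree q < 7" using False h'(3) by simp
      then have "poly q z \<noteq> 0" "poly h' z \<noteq> 0"
        using zero_if_vanishing[OF z r(2)] zero_if_vanishing[OF z h'(1)] \<open>q \<noteq> 0\<close> \<open>h' \<noteq> 0\<close> h'(3) less.prems(3) by auto
      then show False using z F by simp
    qed
    then obtain g where g: "poly_over \<rat> g" "poly g z * poly r z = 1"
      using less.hyps[of r] r(3,4) h'(3) less.prems(3) by fastforce
    have "poly r z = - poly q z * (poly h z / ?l)" using arg_cong[OF r(1), of "\<lambda>p. poly p z"] z
      by (simp add: h'_def eq_neg_iff_add_eq_0 add.commute)
    then have "poly (smult (- 1 / ?l) (g * q)) z * poly h z = 1" using g(2) l by (simp add: field_simps)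
    moreover have "poly_over \<rat> (smult (- 1 / ?l) (g * q))"
      using l by (intro poly_over_smult[OF csubring_Rats_set] poly_over_mult[OF csubring_Rats_set] g(1) r(2)) auto
    ultimately show ?thesis by blast
  qed
qed

definition roots :: "complex set" where "roots = {z. poly F z = 0}"

lemma card_roots: "finite roots" "card roots = 7"
proof -
  have F0: "F \<noteq> 0" using F_degree by auto
  show "finite roots" unfolding roots_def by (rule poly_roots_finite[OF F0])
  have "\<not> (poly F a = 0 \<and> poly (pderiv F) a = 0)" for a
  proof
    assume a: "poly F a = 0 \<and> poly (pderiv F) a = 0"
    have "poly_over \<rat> (pderiv F)" using F_over_Rats by (auto simp: poly_over_def coeff_pderiv)
    then have "pderiv F = 0" using a zero_if_vanishing[of a "pderiv F"] by (simp add: degree_pderiv F_degree)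
    then show False by (simp add: pderiv_eq_0_iff F_degree)
  qed
  then have "rsquarefree F" by (simp add: rsquarefree_roots)
  then have "smult (lead_coeff F) (\<Prod>z\<in>roots. [:-z, 1:]) = F"
    unfolding roots_def by (rule complex_poly_decompose_rsquarefree)
  then have "degree (\<Prod>z\<in>roots. [:-z, 1:]) = 7" using F_monic F_degree by simp
  then show "card roots = 7" by (simp add: degree_prod_sum_eq)
qed

definition num :: "complex poly" where "num = map_poly (\<lambda>q. of_int (poly q t)) conj_num"
definition den :: "complex poly" where "den = map_poly (\<lambda>q. of_int (poly q t)) conj_den"

lemma num_den_over: "poly_over \<int> num" "poly_over \<int> den"
  by (simp_all add: poly_over_def num_def den_def coeff_map_poly)
lemmas num_den_over_Rats = num_den_over[THEN poly_over_mono, OF Ints_subset_Rats]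

lemma num_den_degree: "degree num \<le> 3" "degree den \<le> 3"
  unfolding num_def den_def conj_num_def conj_den_def by (rule map_poly_degree_leq[THEN order_trans], simp)+

lemma den_nonzero: assumes "z \<in> roots" shows "poly den z \<noteq> 0"
proof
  assume "poly den z = 0"
  then have "den = 0"
    using zero_if_vanishing[OF _ num_den_over_Rats(2), of z] num_den_degree assms by (auto simp: roots_def)
  then have "coeff den 0 = 0" by simp
  then show False using t_odd by (simp add: den_def coeff_map_poly conj_den_def)
qed

text \<open>
  The map that becomes the Galois action on the roots.
\<close>

definition \<tau> :: "complex \<Rightarrow> complex" where "\<tau> z = poly num z / poly den z"

lemma \<tau>_root: "z \<in> roots \<Longrightarrow> \<tau> z \<in> roots"
  using conjugate_root[of t z] den_nonzero[of z]
  unfolding roots_def F_def \<tau>_def bieval_hh_generic by (simp add: bieval_def num_def den_def)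

text \<open>
  A fixed point would be a root of \<open>num - x den\<close>, which has degree less than seven
  and is not zero: its coefficient at \<open>x\<close> is odd.
\<close>

lemma \<tau>_moves: assumes z: "z \<in> roots" shows "\<tau> z \<noteq> z"
proof
  assume "\<tau> z = z"
  define h where "h = num - [:0, 1:] * den"
  have "poly h z = 0" using \<open>\<tau> z = z\<close> den_nonzero[OF z] by (simp add: h_def \<tau>_def field_simps)
  moreover have "poly_over \<rat> h" unfolding h_def
    by (intro poly_over_diff poly_over_mult poly_over_pCons poly_over_0 csubring_Rats_set num_den_over_Rats) auto
  moreover have "degree h < 7"
  proof -
    have "degree ([:0, 1:] * den) \<le> 4" using num_den_degree(2) degree_mult_le[of "[:0, 1:]" den] by simp
    then have "degree h \<le> 4" unfolding h_def using num_den_degree(1) by (intro degree_diff_le) auto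
    then show ?thesis by simp
  qed
  ultimately have "h = 0" using z zero_if_vanishing by (auto simp: roots_def)
  then have "coeff h 1 = 0" by simp
  then have "of_int (poly [:0, 2, 2, 1, 1:] t + t ^ 2) = (0::complex)"
    by (simp add: h_def num_def den_def coeff_map_poly conj_num_def conj_den_def power2_eq_square)
  then have "t * (poly [:2, 2, 1, 1:] t + t) = 0" unfolding of_int_eq_0_iff by (simp add: algebra_simps power2_eq_square)
  moreover have "odd (t * (poly [:2, 2, 1, 1:] t + t))" using t_odd by simp
  ultimately show False by (metis even_zero)
qed

text \<open>
  The denominator has an inverse that is a polynomial with rational coefficients, and the
  relation between the two holds at all roots when it holds at one.
\<close>

lemma \<tau>_poly: obtains g where "poly_over \<rat> g" "\<And>z. z \<in> roots \<Longrightarrow> \<tau> z = poly g z"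
proof -
  obtain z0 where z0: "z0 \<in> roots" using card_roots by (metis card.empty ex_in_conv zero_neq_numeral)
  have "den \<noteq> 0" using den_nonzero[OF z0] by auto
  then obtain d where d: "poly_over \<rat> d" "poly d z0 * poly den z0 = 1"
    using inverse_value[OF _ num_den_over_Rats(2), of z0] num_den_degree z0 by (auto simp: roots_def)
  have "poly d z * poly den z = 1" if z: "z \<in> roots" for z
  proof -
    have "poly_over \<rat> (d * den - 1)"
      by (intro poly_over_diff poly_over_mult poly_over_1 csubring_Rats_set d(1) num_den_over_Rats)
    then have "poly (d * den - 1) z = 0"
      using vanishes_at_all_roots[of z0 "d * den - 1" z] d(2) z z0 by (simp add: roots_def)
    then show ?thesis by simp
  qed
  then have "\<tau> z = poly (num * d) z" if "z \<in> roots" for z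
    using den_nonzero[OF that] that by (simp add: \<tau>_def divide_eq_eq mult.assoc)
  then show ?thesis using that[of "num * d"] poly_over_mult[OF csubring_Rats_set num_den_over_Rats(1) d(1)] by blast
qed

lemma \<tau>_iterate_root: "z \<in> roots \<Longrightarrow> (\<tau> ^^ k) z \<in> roots"
  by (induction k) (auto simp: \<tau>_root)

lemma \<tau>_iterate_poly: "\<exists>g. poly_over \<rat> g \<and> (\<forall>z\<in>roots. (\<tau> ^^ k) z = poly g z)"
proof (induction k)
  case 0
  show ?case
    by (intro exI[of _ "[:0, 1:]"]) (auto intro!: poly_over_pCons poly_over_0 csubring_Rats_set)
next
  case (Suc k)
  then obtain g where g: "poly_over \<rat> g" "\<forall>z\<in>roots. (\<tau> ^^ k) z = poly g z" by blast
  obtain g1 where g1: "poly_over \<rat> g1" "\<And>z. z \<in> roots \<Longrightarrow> \<tau> z = poly g1 z" using \<tau>_poly by blast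
  have "\<forall>z\<in>roots. (\<tau> ^^ Suc k) z = poly (pcompose g1 g) z"
    using g(2) g1(2) \<tau>_iterate_root by (simp add: poly_pcompose) metis
  then show ?case using poly_over_pcompose[OF csubring_Rats_set g1(1) g(1)] by blast
qed

lemma \<tau>_fixed_point_everywhere:
  assumes "z \<in> roots" "w \<in> roots" "(\<tau> ^^ k) z = z" shows "(\<tau> ^^ k) w = w"
proof -
  obtain g where g: "poly_over \<rat> g" "\<forall>z\<in>roots. (\<tau> ^^ k) z = poly g z" using \<tau>_iterate_poly by blast
  have "poly_over \<rat> (g - [:0, 1:])"
    by (intro poly_over_diff poly_over_pCons poly_over_0 csubring_Rats_set g(1)) auto
  moreover have "poly (g - [:0, 1:]) z = 0" using assms(1,3) g(2) by simp
  ultimately have "poly (g - [:0, 1:]) w = 0"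
    using vanishes_at_all_roots[of z "g - [:0, 1:]" w] assms(1,2) by (simp add: roots_def)
  then show ?thesis using g(2) assms(2) by simp
qed

text \<open>
  Some power of \<open>\<tau>\<close> fixes a root and hence all roots. So all orbits have the
  same length \<open>r\<close>, a divisor of seven, and \<open>r \<noteq> 1\<close> because
  \<open>\<tau>\<close> moves every root.
\<close>

lemma \<tau>_order:
  assumes z: "z \<in> roots"
  shows "(\<tau> ^^ 7) z = z" "\<And>k. 0 < k \<Longrightarrow> k < 7 \<Longrightarrow> (\<tau> ^^ k) z \<noteq> z"
proof -
  have "\<not> inj_on (\<lambda>i. (\<tau> ^^ i) z) {..7}"
  proof
    assume "inj_on (\<lambda>i. (\<tau> ^^ i) z) {..7::nat}"
    then have "card {..7::nat} \<le> card roots"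
      using \<tau>_iterate_root[OF z] card_roots(1) by (intro card_inj_on_le) auto
    then show False using card_roots(2) by simp
  qed
  then obtain i j where ij: "i < j" "(\<tau> ^^ i) z = (\<tau> ^^ j) z"
    unfolding inj_on_def by (metis linorder_neqE_nat)
  have "(\<tau> ^^ (j - i)) ((\<tau> ^^ i) z) = (\<tau> ^^ (j - i + i)) z" by (simp add: funpow_add)
  then have "(\<tau> ^^ (j - i)) ((\<tau> ^^ i) z) = (\<tau> ^^ i) z" using ij by simp
  then have ex: "(\<tau> ^^ (j - i)) z = z" using \<tau>_fixed_point_everywhere \<tau>_iterate_root[OF z] z by blast
  define r where "r = (LEAST k. 0 < k \<and> (\<tau> ^^ k) z = z)"
  have r: "0 < r" "(\<tau> ^^ r) z = z"
    using LeastI[of "\<lambda>k. 0 < k \<and> (\<tau> ^^ k) z = z" "j - i"] ex ij unfolding r_def by auto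
  have least: "(\<tau> ^^ k) z \<noteq> z" if "0 < k" "k < r" for k
    using not_less_Least[of k "\<lambda>k. 0 < k \<and> (\<tau> ^^ k) z = z"] that unfolding r_def by blast
  have "r dvd card roots"
    using r least \<tau>_fixed_point_everywhere z
    by (intro orbit_length_dvd_card[of roots \<tau>] card_roots \<tau>_root) blast+
  then have "r dvd 7" using card_roots by simp
  moreover have "prime (7::nat)" by simp
  ultimately have "r = 1 \<or> r = 7" by (metis prime_nat_iff)
  then have "r = 7" using r \<tau>_moves[OF z] by auto
  then show "(\<tau> ^^ 7) z = z" "\<And>k. 0 < k \<Longrightarrow> k < 7 \<Longrightarrow> (\<tau> ^^ k) z \<noteq> z" using r least by auto
qed

lemma iterates_distinct:
  assumes w: "w \<in> roots" shows "inj_on (\<lambda>i. (\<tau> ^^ i) w) {..<7}"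
proof (rule linorder_inj_onI)
  fix i j assume ij: "i < j" "i \<in> {..<7}" "j \<in> {..<7::nat}"
  show "(\<tau> ^^ i) w \<noteq> (\<tau> ^^ j) w"
  proof
    assume "(\<tau> ^^ i) w = (\<tau> ^^ j) w"
    then have "(\<tau> ^^ (j - i)) ((\<tau> ^^ i) w) = (\<tau> ^^ i) w"
      using ij by (metis comp_apply funpow_add le_add_diff_inverse2 less_imp_le)
    then show False using \<tau>_order(2)[OF \<tau>_iterate_root[OF w], of "j - i" i] ij less_imp_diff_less[of j 7 i] by simp
  qed
qed auto

text \<open>
  Without a real root, complex conjugation would split the seven roots into pairs. From one real
  root the others are obtained as values of rational polynomials.
\<close>

lemma roots_real: "roots \<subseteq> \<real>"
proof
  fix z assume z: "z \<in> roots"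
  have cnjF: "cnj (poly F w) = poly F (cnj w)" for w
    using F_over unfolding poly_over_def by (intro poly_cnj_real) (metis Ints_cases Reals_of_int)
  have "\<exists>w\<in>roots. cnj w = w"
  proof (rule ccontr)
    assume no: "\<not> ?thesis"
    have "2 dvd card roots"
    proof (rule orbit_length_dvd_card[of roots cnj])
      show "cnj w \<in> roots" if "w \<in> roots" for w using that cnjF[of w] by (simp add: roots_def)
      show "(cnj ^^ i) w \<noteq> w" if "w \<in> roots" "0 < i" "i < 2" for w i
      proof -
        have "i = 1" using that(2,3) by simp
        then show ?thesis using no that(1) by simp
      qed
    qed (simp_all add: card_roots eval_nat_numeral)
    then show False using card_roots by simp
  qed
  then obtain w where w: "w \<in> roots" "cnj w = w" by blast
  have "inj_on (\<lambda>i. (\<tau> ^^ i) w) {..<7}" by (rule iterates_distinct[OF w(1)])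
  then have "(\<lambda>i. (\<tau> ^^ i) w) ` {..<7} = roots"
    using \<tau>_iterate_root[OF w(1)] card_roots by (intro card_subset_eq) (auto simp: card_image)
  then obtain i where i: "z = (\<tau> ^^ i) w" using z by blast
  obtain g where g: "poly_over \<rat> g" "\<forall>z\<in>roots. (\<tau> ^^ i) z = poly g z" using \<tau>_iterate_poly by blast
  have "poly_over \<real> g" by (rule poly_over_mono[OF g(1) Rats_subset_Reals])
  moreover have "csubring (\<real> :: complex set)" by (auto simp: csubring_def)
  ultimately have "poly g w \<in> \<real>" using w(2) poly_over_value by (metis Reals_cnj_iff)
  then show "z \<in> \<real>" using i g(2) w(1) by simp
qed

context
  fixes \<theta> :: complex
  assumes \<theta>: "poly F \<theta> = 0"
begin

definition K :: "complex set" where "K = {poly h \<theta> | h. poly_over \<rat> h}"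

text \<open>
  The value at \<open>\<theta>\<close> of a rational polynomial is sent to its value at
  \<open>\<tau> \<theta>\<close>. By \<open>poly_eq_at_roots\<close> the choice of the
  polynomial does not matter.
\<close>

definition \<sigma> :: "complex \<Rightarrow> complex" where
  "\<sigma> x = poly (SOME h. poly_over \<rat> h \<and> x = poly h \<theta>) (\<tau> \<theta>)"

lemma \<theta>_root: "\<theta> \<in> roots" using \<theta> by (simp add: roots_def)

lemma poly_eq_at_roots:
  assumes "poly_over \<rat> g" "poly_over \<rat> h" "z \<in> roots" "poly g z = poly h z" "w \<in> roots"
  shows "poly g w = poly h w"
  using vanishes_at_all_roots[of z "g - h" w] assms poly_over_diff[OF csubring_Rats_set assms(1,2)]
  by (simp add: roots_def)

lemma \<sigma>_poly:
  assumes h: "poly_over \<rat> h" shows "\<sigma> (poly h \<theta>) = poly h (\<tau> \<theta>)"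
proof -
  define g where "g = (SOME g. poly_over \<rat> g \<and> poly h \<theta> = poly g \<theta>)"
  have "poly_over \<rat> g \<and> poly h \<theta> = poly g \<theta>"
    unfolding g_def using h by (intro someI[of "\<lambda>g. poly_over \<rat> g \<and> poly h \<theta> = poly g \<theta>" h]) auto
  then have "poly g (\<tau> \<theta>) = poly h (\<tau> \<theta>)"
    using poly_eq_at_roots[OF _ h \<theta>_root _ \<tau>_root[OF \<theta>_root]] by simp
  then show ?thesis by (simp add: \<sigma>_def g_def)
qed

lemma \<sigma>_iterate_poly:
  assumes h: "poly_over \<rat> h" shows "(\<sigma> ^^ k) (poly h \<theta>) = poly h ((\<tau> ^^ k) \<theta>)"
proof (induction k)
  case (Suc k)
  obtain g where g: "poly_over \<rat> g" "\<And>z. z \<in> roots \<Longrightarrow> (\<tau> ^^ k) z = poly g z"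
    using \<tau>_iterate_poly by blast
  have "(\<sigma> ^^ Suc k) (poly h \<theta>) = \<sigma> (poly (pcompose h g) \<theta>)"
    using Suc g(2)[OF \<theta>_root] by (simp add: poly_pcompose)
  also have "\<dots> = poly h (poly g (\<tau> \<theta>))"
    using \<sigma>_poly[OF poly_over_pcompose[OF csubring_Rats_set h g(1)]] by (simp add: poly_pcompose)
  also have "poly g (\<tau> \<theta>) = (\<tau> ^^ Suc k) \<theta>"
    using g(2)[OF \<tau>_root[OF \<theta>_root]] by (simp add: funpow_swap1)
  finally show ?case .
qed simp

lemma K_poly: "poly_over \<rat> h \<Longrightarrow> poly h \<theta> \<in> K" by (auto simp: K_def)

lemma fixed_rational:
  assumes h: "poly_over \<rat> h" and fixed: "\<sigma> (poly h \<theta>) = poly h \<theta>" shows "poly h \<theta> \<in> \<rat>"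
proof -
  obtain q r where r: "h = q * F + r" "poly_over \<rat> r" "r = 0 \<or> degree r < degree F"
    using poly_over_divide_monic[OF csubring_Rats_set F_over_Rats F_monic h] by blast
  have hr: "poly h z = poly r z" if "z \<in> roots" for z using r(1) that by (simp add: roots_def)
  have deg: "degree r < 7" using r(3) F_degree by auto
  have const: "poly h ((\<tau> ^^ k) \<theta>) = poly h \<theta>" for k
    using \<sigma>_iterate_poly[OF h, of k] fixed by (induction k) (auto simp: \<sigma>_iterate_poly[OF h])
  define g where "g = r - [:poly h \<theta>:]"
  have "g = 0"
  proof (rule ccontr)
    assume g0: "g \<noteq> 0"
    have "inj_on (\<lambda>i. (\<tau> ^^ i) \<theta>) {..<7}" by (rule iterates_distinct[OF \<theta>_root])
    moreover have "(\<lambda>i. (\<tau> ^^ i) \<theta>) ` {..<7} \<subseteq> {z. poly g z = 0}"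
      using const hr \<tau>_iterate_root[OF \<theta>_root] by (auto simp: g_def)
    ultimately have "7 \<le> card {z. poly g z = 0}"
      using card_mono[OF poly_roots_finite[OF g0]] by (metis card_image card_lessThan)
    moreover have "degree g < 7" unfolding g_def using deg by (intro degree_diff_less) auto
    ultimately show False using card_poly_roots_bound[OF g0] by simp
  qed
  then have "coeff r 0 = poly h \<theta>" by (simp add: g_def)
  then show ?thesis using r(2) unfolding poly_over_def by metis
qed

lemma cyclic_septic: "cyclic_septic_field K \<sigma> \<theta> F"
proof
  have in_K: "\<exists>h. poly_over \<rat> h \<and> x = poly h \<theta>" if "x \<in> K" for x using that by (auto simp: K_def)
  show "csubring K"
    unfolding csubring_def
  proof (intro conjI ballI)
    show "1 \<in> K" using K_poly[OF poly_over_1[OF csubring_Rats_set]] by simp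
    fix a b assume "a \<in> K" "b \<in> K"
    then obtain g h where gh: "poly_over \<rat> g" "a = poly g \<theta>" "poly_over \<rat> h" "b = poly h \<theta>" using in_K by blast
    show "a - b \<in> K" using K_poly[OF poly_over_diff[OF csubring_Rats_set gh(1,3)]] gh by simp
    show "a * b \<in> K" using K_poly[OF poly_over_mult[OF csubring_Rats_set gh(1,3)]] gh by simp
  qed
  show "inverse x \<in> K" if x: "x \<in> K" for x
  proof (cases "x = 0")
    case True
    then show ?thesis using x by simp
  next
    case False
    obtain h where h: "poly_over \<rat> h" "x = poly h \<theta>" using in_K[OF x] by blast
    obtain q r where r: "h = q * F + r" "poly_over \<rat> r" "r = 0 \<or> degree r < degree F"
      using poly_over_divide_monic[OF csubring_Rats_set F_over_Rats F_monic h(1)] by blast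
    have xr: "x = poly r \<theta>" using h(2) r(1) \<theta> by simp
    then have "r \<noteq> 0" using False by auto
    then obtain g where "poly_over \<rat> g" "poly g \<theta> * x = 1"
      using inverse_value[OF \<theta> r(2)] r(3) F_degree xr by auto
    then show ?thesis using K_poly[of g] by (metis inverse_unique mult.commute)
  qed
  show "\<sigma> x \<in> K" if x: "x \<in> K" for x
  proof -
    obtain h where h: "poly_over \<rat> h" "x = poly h \<theta>" using in_K[OF x] by blast
    obtain g where g: "poly_over \<rat> g" "\<And>z. z \<in> roots \<Longrightarrow> \<tau> z = poly g z" using \<tau>_poly by blast
    have "\<sigma> x = poly (pcompose h g) \<theta>" using \<sigma>_poly[OF h(1)] h(2) g(2)[OF \<theta>_root] by (simp add: poly_pcompose)
    then show ?thesis using K_poly[OF poly_over_pcompose[OF csubring_Rats_set h(1) g(1)]] by simp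
  qed
  show "\<sigma> 1 = 1" using \<sigma>_poly[OF poly_over_1[OF csubring_Rats_set]] by simp
  show "\<sigma> (x - y) = \<sigma> x - \<sigma> y" and "\<sigma> (x * y) = \<sigma> x * \<sigma> y" if xy: "x \<in> K" "y \<in> K" for x y
  proof -
    obtain g h where gh: "poly_over \<rat> g" "x = poly g \<theta>" "poly_over \<rat> h" "y = poly h \<theta>" using in_K[OF xy(1)] in_K[OF xy(2)] by blast
    show "\<sigma> (x - y) = \<sigma> x - \<sigma> y"
      using \<sigma>_poly[OF poly_over_diff[OF csubring_Rats_set gh(1,3)]] \<sigma>_poly[OF gh(1)] \<sigma>_poly[OF gh(3)] gh by simp
    show "\<sigma> (x * y) = \<sigma> x * \<sigma> y"
      using \<sigma>_poly[OF poly_over_mult[OF csubring_Rats_set gh(1,3)]] \<sigma>_poly[OF gh(1)] \<sigma>_poly[OF gh(3)] gh by simp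
  qed
  show "(\<sigma> ^^ 7) x = x" if "x \<in> K" for x
    using in_K[OF that] \<sigma>_iterate_poly[of _ 7] \<tau>_order(1)[OF \<theta>_root] by auto
  show "x \<in> \<rat>" if "x \<in> K" "\<sigma> x = x" for x using in_K[OF that(1)] that(2) fixed_rational by blast
  have id: "poly_over \<rat> [:0, 1::complex:]"
    by (intro poly_over_pCons poly_over_0 csubring_Rats_set) auto
  show "\<theta> \<in> K" using K_poly[OF id] by simp
  show "\<sigma> \<theta> \<noteq> \<theta>" using \<sigma>_poly[OF id] \<tau>_moves[OF \<theta>_root] by simp
  show "\<exists>h. poly_over \<rat> h \<and> x = poly h \<theta>" if "x \<in> K" for x using in_K[OF that] .
  show "poly_over \<int> F" by (rule F_over)
  show "lead_coeff F = 1" by (rule F_monic)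
  show "degree F = 7" by (rule F_degree)
  show "poly F \<theta> = 0" by (rule \<theta>)
qed

lemma rat_adjoin_eq: "rat_adjoin \<theta> = K"
proof -
  interpret cyclic_septic_field K \<sigma> \<theta> F by (rule cyclic_septic)
  show ?thesis by (rule rat_adjoin_eq_K[OF \<theta>_OK \<theta>_moved])
qed

lemma K_real: "K \<subseteq> \<real>"
proof -
  have "csubring (\<real> :: complex set)" by (auto simp: csubring_def)
  moreover have "\<theta> \<in> \<real>" using roots_real \<theta>_root by blast
  ultimately have "poly h \<theta> \<in> \<real>" if "poly_over \<rat> h" for h
    using poly_over_value poly_over_mono[OF that Rats_subset_Reals] by blast
  then show ?thesis by (auto simp: K_def)
qed

end
end

text \<open>
  The value modulo \<open>p\<close> depends only on the residues of \<open>t\<close> and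
  \<open>c\<close>, which leaves finitely many evaluations.
\<close>

lemma no_root_mod_small_prime:
  fixes t c :: int
  assumes p: "p \<in> {2, 3, 5}" and t: "coprime t p"
  shows "\<not> p dvd poly (hashimoto_hoshi_poly t) c"
proof -
  define E :: "int \<Rightarrow> int \<Rightarrow> int" where "E t c = poly (hashimoto_hoshi_poly t) c" for t c
  have cong: "[E t c = E (t mod p) (c mod p)] (mod p)"
    unfolding E_def hashimoto_hoshi_poly_def
    by (simp only: poly_pCons poly_0, intro cong_add cong_mult cong_pow cong_diff cong_minus_minus_iff[THEN iffD2] cong_refl)
      (simp_all add: cong_def)
  have tm: "t mod p \<noteq> 0"
    using t p by (auto simp: coprime_iff_gcd_eq_1 gcd_proj2_iff dvd_eq_mod_eq_0[symmetric])
  have E: "E i j mod p \<noteq> 0" if "0 < i" "i < p" "0 \<le> j" "j < p" for i j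
  proof -
    have "i \<in> {1, 2, 3, 4}" "j \<in> {0, 1, 2, 3, 4}" using that p by auto
    then show ?thesis using p that by (auto simp: E_def hashimoto_hoshi_poly_def)
  qed
  have "0 < p" using p by auto
  then have "0 \<le> t mod p" "t mod p < p" "0 \<le> c mod p" "c mod p < p" by simp_all
  moreover from this tm have "0 < t mod p" by linarith
  ultimately have "0 < t mod p" "t mod p < p" "0 \<le> c mod p" "c mod p < p" by simp_all
  then have "E (t mod p) (c mod p) mod p \<noteq> 0" by (rule E)
  then show ?thesis using cong unfolding cong_def E_def by (metis dvd_imp_mod_0)
qed

theorem theorem5p3:
  fixes t :: int and \<theta> :: complex
  assumes "odd t" and "coprime t 15"
    and "poly (map_poly of_int (hashimoto_hoshi_poly t)) \<theta> = 0"
  shows "\<not> monogenic (rat_adjoin \<theta>) \<and> field_index (rat_adjoin \<theta>) = 1"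
proof -
  interpret hashimoto_hoshi t using assms(1) by unfold_locales
  have \<theta>: "poly F \<theta> = 0" using assms(3) by (simp add: F_def)
  interpret cyclic_septic_field "K \<theta>" "\<sigma> \<theta>" \<theta> F by (rule cyclic_septic[OF \<theta>])
  have coprime: "coprime t (int p)" if "p \<in> {2, 3, 5}" for p
  proof -
    have "coprime t 2" using assms(1) by simp
    moreover have "coprime t (3 * 5)" using assms(2) by simp
    then have "coprime t 3" "coprime t 5" by (simp_all only: coprime_mult_right_iff)
    ultimately show ?thesis using that by auto
  qed
  have "field_index (K \<theta>) = 1"
  proof (rule field_index_eq_1)
    fix p :: nat and c n :: int
    assume p: "p \<in> {2, 3, 5}" and n: "poly F (of_int c) = of_int n"
    have "poly F (of_int c) = of_int (poly (hashimoto_hoshi_poly t) c)"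
      by (simp add: F_def poly_altdef coeff_map_poly degree_map_poly)
    then have "n = poly (hashimoto_hoshi_poly t) c" using n by (metis of_int_eq_iff)
    then show "\<not> int p dvd n" using no_root_mod_small_prime[of "int p" t c] coprime[OF p] p by auto
  qed
  moreover have "\<not> monogenic (K \<theta>)" by (rule not_monogenic[OF K_real[OF \<theta>]])
  ultimately show ?thesis by (simp add: rat_adjoin_eq[OF \<theta>])
qed

end
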